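(* Let $N_2(t)$ be the renewal Hawkes process with minimum of endogenous and exogenous variables ($\mathrm{R}_2$Hawkes process) and let $m_2(t)=\mathbb{E}[N_2(t)]$. For every $t\ge0$, $m_2(t)$ satisfies the integral equation $$m_2(t)=\Psi_2(t)+\int_0^t m_2(t-v)\,n_2(v)\,\mathrm{d}v,$$ where $\Psi_2(t):=\int_0^t[1+k_{2,0}(t-y)]F_g(y)\,\mathrm{d}y$ and $n_2(y):=G_f(y)+F_g(y)$, with $G_f(y):=[1-G(y)]f(y)$ and $F_g(y):=[1-F(y)]g(y)$ for every $y\ge0$, and where $k_{2,0}(t)$ satisfies the integral equation $$k_{2,0}(t)=\int_0^t[1+k_{2,0}(t-v)]\,\eta h(v)\,\mathrm{d}v.$$ Moreover, the Laplace transform of $m_2(t)$ is given by $$m_2^*(s)=\frac{F_g^*(s)}{s[1-\eta h^*(s)][1-G_f^*(s)-F_g^*(s)]}.$$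
   Context: Data: $\mu:[0,\infty)\to\mathbb{R}$ is a positive function (background intensity), $\eta>0$ (branching ratio), and $h$ is a positive, locally bounded function on $[0,\infty)$ with $\int_0^\infty h(t)\,\mathrm{d}t=1$ (offspring density). Put $G(t)=1-e^{-\int_0^t\mu(v)\,\mathrm{d}v}$ and $g(t)=G'(t)=\mu(t)e^{-\int_0^t\mu(v)\,\mathrm{d}v}$. The random variables $Y_1,Y_2,\ldots$ are positive, i.i.d., with distribution function $F$ and density $f$; they are exogenous, i.e. generated independently of the mechanism producing the events of the point process. $\mathrm{R}_2$Hawkes process: a simple point process $N_2(t)$ on $[0,\infty)$, started with empty history ($N_2(0)=0$). The background (immigrant) intensity is renewed at times $V_0=0$, $V_i=\min(Y_i+V_{i-1},T_i)$ for $i\ge1$, where $T_i$ is the first immigration virtual event time after the renewal point $V_{i-1}$: $T_i-V_{i-1}$ is independent of the past and of $Y_i$ and has distribution function $G$ (failure rate $\mu$). The immigrant event at $T_i$ actually occurs (is a point of $N_2$) if $V_i=T_i$; otherwise the background intensity is renewed at $V_i=Y_i+V_{i-1}$ with no immigrant in $(V_{i-1},V_i]$. With $J(t)=\max\{i:V_i<t\}$, the intensity of $N_2$ relative to the enlarged filtration $\sigma(N_2(s),V_{J(s)},\,0\le s\le t)$ is $$\lambda_2(t)=\mu\big(t-V_{J(t)}\big)+\eta\int_0^{t-}h(t-v)\,\mathrm{d}N_2(v).$$ For a function $w$, $w^*(s)=\int_0^\infty e^{-st}w(t)\,\mathrm{d}t$ denotes its Laplace transform. *)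

theory Defs
  imports "HOL-Probability.Probability"
begin

definition G :: "(real \<Rightarrow> real) \<Rightarrow> real \<Rightarrow> real" where
  "G \<mu> t = 1 - exp (- (LBINT v:{0..t}. \<mu> v))"

definition g :: "(real \<Rightarrow> real) \<Rightarrow> real \<Rightarrow> real" where
  "g \<mu> t = \<mu> t * exp (- (LBINT v:{0..t}. \<mu> v))"

definition Gf :: "(real \<Rightarrow> real) \<Rightarrow> (real \<Rightarrow> real) \<Rightarrow> real \<Rightarrow> real" where
  "Gf \<mu> f y = (1 - G \<mu> y) * f y"

definition Fg :: "(real \<Rightarrow> real) \<Rightarrow> (real \<Rightarrow> real) \<Rightarrow> real \<Rightarrow> real" where
  "Fg \<mu> F y = (1 - F y) * g \<mu> y"

definition n2 :: "(real \<Rightarrow> real) \<Rightarrow> (real \<Rightarrow> real) \<Rightarrow> (real \<Rightarrow> real) \<Rightarrow> real \<Rightarrow> real" where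
  "n2 \<mu> F f y = Gf \<mu> f y + Fg \<mu> F y"

text \<open>A simple point process is given by its locally finite random set \<open>P \<omega>\<close> of points in
  \<open>(0, \<infinity>)\<close>; \<open>num_points P t\<close> is the associated counting variable \<open>N\<^sub>2(t)\<close>.\<close>

definition num_points :: "('a \<Rightarrow> real set) \<Rightarrow> real \<Rightarrow> 'a \<Rightarrow> nat" where
  "num_points P t \<omega> = card (P \<omega> \<inter> {0<..t})"

definition simple_point_process :: "'a measure \<Rightarrow> ('a \<Rightarrow> real set) \<Rightarrow> bool" where
  "simple_point_process M P \<longleftrightarrow>
     (\<forall>\<omega>\<in>space M. P \<omega> \<subseteq> {0<..} \<and> (\<forall>t. finite (P \<omega> \<inter> {0<..t}))) \<and>
     (\<forall>t\<ge>0. num_points P t \<in> M \<rightarrow>\<^sub>M count_space UNIV)"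

text \<open>The predictable sigma-algebra on \<open>[0, \<infinity>) \<times> \<Omega>\<close> of a filtration \<open>\<F>\<close>, and stochastic
  intensities in the sense of Bremaud: \<open>E \<integral> C(t) dN(t) = E \<integral> C(t) l(t) dt\<close> for all nonnegative
  predictable \<open>C\<close>.\<close>

definition predictable :: "'a measure \<Rightarrow> (real \<Rightarrow> 'a measure) \<Rightarrow> (real \<times> 'a) measure" where
  "predictable M \<F> = sigma ({0..} \<times> space M)
     ({{0} \<times> A |A. A \<in> sets (\<F> 0)} \<union> {{s<..t} \<times> A |s t A. 0 \<le> s \<and> s \<le> t \<and> A \<in> sets (\<F> s)})"

definition has_intensity ::
  "'a measure \<Rightarrow> (real \<Rightarrow> 'a measure) \<Rightarrow> ('a \<Rightarrow> real set) \<Rightarrow> (real \<Rightarrow> 'a \<Rightarrow> real) \<Rightarrow> bool" where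
  "has_intensity M \<F> P l \<longleftrightarrow>
     (\<forall>t\<ge>0. \<forall>\<omega>\<in>space M. 0 \<le> l t \<omega>) \<and>
     (\<lambda>(t, \<omega>). l t \<omega>) \<in> borel_measurable (predictable M \<F>) \<and>
     (\<forall>C :: real \<times> 'a \<Rightarrow> ennreal. C \<in> borel_measurable (predictable M \<F>) \<longrightarrow>
        (\<integral>\<^sup>+\<omega>. (\<integral>\<^sup>+t. C (t, \<omega>) \<partial>count_space (P \<omega>)) \<partial>M) =
        (\<integral>\<^sup>+\<omega>. (\<integral>\<^sup>+t\<in>{0..}. C (t, \<omega>) * ennreal (l t \<omega>) \<partial>lborel) \<partial>M))"

text \<open>\<open>Y i\<close> and \<open>T i\<close> are used for \<open>i \<ge> 1\<close> only. The virtual times \<open>T i\<close> are extended real: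
  if \<open>\<mu>\<close> has finite total mass, then \<open>G\<close> is defective and \<open>T i = \<infinity>\<close> (no further virtual event)
  has positive probability. The renewal times are finite because the \<open>Y i\<close> are.\<close>

primrec V :: "(nat \<Rightarrow> 'a \<Rightarrow> real) \<Rightarrow> (nat \<Rightarrow> 'a \<Rightarrow> ereal) \<Rightarrow> nat \<Rightarrow> 'a \<Rightarrow> real" where
  "V Y T 0 \<omega> = 0"
| "V Y T (Suc i) \<omega> = real_of_ereal (min (ereal (Y (Suc i) \<omega> + V Y T i \<omega>)) (T (Suc i) \<omega>))"

text \<open>The supremum in \<open>nat\<close> is the maximum, except that \<open>Sup {} = 0\<close>, so \<open>J(0) = 0\<close>.\<close>

definition J :: "(nat \<Rightarrow> 'a \<Rightarrow> real) \<Rightarrow> (nat \<Rightarrow> 'a \<Rightarrow> ereal) \<Rightarrow> real \<Rightarrow> 'a \<Rightarrow> nat" where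
  "J Y T t \<omega> = Sup {i. V Y T i \<omega> < t}"

definition last_renewal ::
  "(nat \<Rightarrow> 'a \<Rightarrow> real) \<Rightarrow> (nat \<Rightarrow> 'a \<Rightarrow> ereal) \<Rightarrow> real \<Rightarrow> 'a \<Rightarrow> real" where
  "last_renewal Y T t \<omega> = V Y T (J Y T t \<omega>) \<omega>"

definition immigrants ::
  "(nat \<Rightarrow> 'a \<Rightarrow> real) \<Rightarrow> (nat \<Rightarrow> 'a \<Rightarrow> ereal) \<Rightarrow> 'a \<Rightarrow> real set" where
  "immigrants Y T \<omega> = {V Y T i \<omega> |i. 1 \<le> i \<and> ereal (V Y T i \<omega>) = T i \<omega>}"

definition R2_intensity ::
  "(real \<Rightarrow> real) \<Rightarrow> real \<Rightarrow> (real \<Rightarrow> real) \<Rightarrow> (nat \<Rightarrow> 'a \<Rightarrow> real) \<Rightarrow> (nat \<Rightarrow> 'a \<Rightarrow> ereal) \<Rightarrow>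
   ('a \<Rightarrow> real set) \<Rightarrow> real \<Rightarrow> 'a \<Rightarrow> real" where
  "R2_intensity \<mu> \<eta> h Y T P t \<omega> =
     \<mu> (t - last_renewal Y T t \<omega>) + \<eta> * (\<Sum>v\<in>P \<omega> \<inter> {0<..<t}. h (t - v))"

text \<open>The enlarged filtration \<open>\<sigma>(N\<^sub>2(s), V\<^bsub>J(s)\<^esub>, 0 \<le> s \<le> t)\<close>.\<close>

definition history ::
  "'a measure \<Rightarrow> (nat \<Rightarrow> 'a \<Rightarrow> real) \<Rightarrow> (nat \<Rightarrow> 'a \<Rightarrow> ereal) \<Rightarrow> ('a \<Rightarrow> real set) \<Rightarrow>
   real \<Rightarrow> 'a measure" where
  "history M Y T P t = sigma (space M)
     (\<Union>s\<in>{0..t}. sets (vimage_algebra (space M) (num_points P s) (count_space UNIV)) \<union>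
                  sets (vimage_algebra (space M) (last_renewal Y T s) borel))"

text \<open>The past at the renewal time \<open>V\<^sub>i\<close>: all \<open>Y\<^sub>j\<close>, \<open>T\<^sub>j\<close> with \<open>1 \<le> j \<le> i\<close> and the process \<open>N\<^sub>2\<close>
  stopped at \<open>V\<^sub>i\<close>.\<close>

definition past ::
  "'a measure \<Rightarrow> (nat \<Rightarrow> 'a \<Rightarrow> real) \<Rightarrow> (nat \<Rightarrow> 'a \<Rightarrow> ereal) \<Rightarrow> ('a \<Rightarrow> real set) \<Rightarrow>
   nat \<Rightarrow> 'a measure" where
  "past M Y T P i = sigma (space M)
     ((\<Union>j\<in>{1..i}. sets (vimage_algebra (space M) (Y j) borel) \<union>
                   sets (vimage_algebra (space M) (T j) borel)) \<union>
      (\<Union>s\<in>{0..}. sets (vimage_algebra (space M)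
                          (\<lambda>\<omega>. num_points P (min s (V Y T i \<omega>)) \<omega>) (count_space UNIV))))"

definition wait ::
  "(nat \<Rightarrow> 'a \<Rightarrow> real) \<Rightarrow> (nat \<Rightarrow> 'a \<Rightarrow> ereal) \<Rightarrow> nat \<Rightarrow> 'a \<Rightarrow> ereal" where
  "wait Y T i \<omega> = T i \<omega> - ereal (V Y T (i - 1) \<omega>)"

locale R2_Hawkes = prob_space M for M :: "'a measure" +
  fixes \<mu> :: "real \<Rightarrow> real" and \<eta> :: real and h F f :: "real \<Rightarrow> real"
    and Y :: "nat \<Rightarrow> 'a \<Rightarrow> real" and T :: "nat \<Rightarrow> 'a \<Rightarrow> ereal" and P :: "'a \<Rightarrow> real set"
  assumes mu_pos: "\<And>t. 0 \<le> t \<Longrightarrow> 0 < \<mu> t"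
    and mu_integrable: "\<And>t. 0 \<le> t \<Longrightarrow> set_integrable lborel {0..t} \<mu>"
    and eta_pos: "0 < \<eta>"
    and h_pos: "\<And>t. 0 \<le> t \<Longrightarrow> 0 < h t"
    and h_locally_bounded: "\<And>t. 0 \<le> t \<Longrightarrow> bounded (h ` {0..t})"
    and h_integrable: "set_integrable lborel {0..} h"
    and h_integral: "(LBINT t:{0..}. h t) = 1"
    and Y_pos: "\<And>i \<omega>. 1 \<le> i \<Longrightarrow> \<omega> \<in> space M \<Longrightarrow> 0 < Y i \<omega>"
    and f_nonneg: "\<And>x. 0 \<le> f x"
    and Y_density: "\<And>i. 1 \<le> i \<Longrightarrow> distributed M lborel (Y i) (\<lambda>x. ennreal (f x))"
    and Y_cdf: "\<And>i. 1 \<le> i \<Longrightarrow> cdf (distr M borel (Y i)) = F"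
    and T_measurable: "\<And>i. 1 \<le> i \<Longrightarrow> T i \<in> borel_measurable M"
    and T_after: "\<And>i \<omega>. 1 \<le> i \<Longrightarrow> \<omega> \<in> space M \<Longrightarrow> ereal (V Y T (i - 1) \<omega>) < T i \<omega>"
    and wait_cdf: "\<And>i t. 1 \<le> i \<Longrightarrow> 0 \<le> t \<Longrightarrow>
      prob {\<omega> \<in> space M. wait Y T i \<omega> \<le> ereal t} = G \<mu> t"
    \<comment> \<open>the past at \<open>V\<^bsub>i-1\<^esub>\<close>, \<open>Y\<^sub>i\<close> and \<open>T\<^sub>i - V\<^bsub>i-1\<^esub>\<close> are mutually independent; in particular so
        are all the \<open>Y\<^sub>i\<close>\<close>
    and wait_indep_Y: "\<And>i. 1 \<le> i \<Longrightarrow> indep_var borel (Y i) borel (wait Y T i)"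
    and indep_past: "\<And>i. 1 \<le> i \<Longrightarrow>
      indep_set (sets (past M Y T P (i - 1)))
        (sets (vimage_algebra (space M) (\<lambda>\<omega>. (Y i \<omega>, wait Y T i \<omega>)) (borel \<Otimes>\<^sub>M borel)))"
    and point_process: "simple_point_process M P"
    and immigrants_occur: "\<And>\<omega>. \<omega> \<in> space M \<Longrightarrow> immigrants Y T \<omega> \<subseteq> P \<omega>"
    and intensity: "has_intensity M (history M Y T P) P (R2_intensity \<mu> \<eta> h Y T P)"

definition m2 :: "'a measure \<Rightarrow> ('a \<Rightarrow> real set) \<Rightarrow> real \<Rightarrow> real" where
  "m2 M P t = (LINT \<omega>|M. real (num_points P t \<omega>))"

text \<open>Local integrability is the class in which \<open>k\<^bsub>2,0\<^esub>\<close> is uniquely determined by its integral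
  equation.\<close>

definition k20_equation :: "real \<Rightarrow> (real \<Rightarrow> real) \<Rightarrow> (real \<Rightarrow> real) \<Rightarrow> bool" where
  "k20_equation \<eta> h k \<longleftrightarrow>
     (\<forall>t\<ge>0. set_integrable lborel {0..t} k \<and>
            k t = (LBINT v:{0..t}. (1 + k (t - v)) * (\<eta> * h v)))"

definition Psi2 ::
  "(real \<Rightarrow> real) \<Rightarrow> (real \<Rightarrow> real) \<Rightarrow> (real \<Rightarrow> real) \<Rightarrow> real \<Rightarrow> real" where
  "Psi2 \<mu> F k t = (LBINT y:{0..t}. (1 + k (t - y)) * Fg \<mu> F y)"

definition laplace_kernel ::
  "(real \<Rightarrow> real) \<Rightarrow> 'b \<Rightarrow> real \<Rightarrow> 'b::{real_normed_field, banach, second_countable_topology}" where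
  "laplace_kernel w s t = exp (- (s * of_real t)) * of_real (w t)"

definition laplace_exists ::
  "(real \<Rightarrow> real) \<Rightarrow> 'b::{real_normed_field, banach, second_countable_topology} \<Rightarrow> bool" where
  "laplace_exists w s \<longleftrightarrow> set_integrable lborel {0..} (laplace_kernel w s)"

definition laplace ::
  "(real \<Rightarrow> real) \<Rightarrow> 'b \<Rightarrow> 'b::{real_normed_field, banach, second_countable_topology}" where
  "laplace w s = (LBINT t:{0..}. laplace_kernel w s t)"

end

theory Submission
  imports Defs
begin

text \<open>The computation rests on one identity. Since \<open>N\<^sub>2\<close> has intensity \<open>\<lambda>\<^sub>2\<close>, the mean \<open>m\<^sub>2(t)\<close> is the
expectation of \<open>\<integral>\<^sub>0\<^sup>t \<lambda>\<^sub>2\<close>. Its two summands can be computed separately. The excitation part of the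
intensity integrates to \<open>\<eta> \<integral>\<^sub>0\<^sup>t h(u) N\<^sub>2(t - u) du\<close>, path by path. The baseline part splits into the
renewal cycles \<open>(V\<^sub>i, V\<^sub>i\<^sub>+\<^sub>1]\<close>: age \<open>u\<close> is reached in cycle \<open>i\<close> before time \<open>t\<close> if and only if
\<open>V\<^sub>i \<le> t - u\<close> and \<open>V\<^sub>i\<^sub>+\<^sub>1 - V\<^sub>i \<ge> u\<close>, and as the length of a cycle is independent of its starting point
and has survival function \<open>(1 - F)(1 - G)\<close>, the hazard \<open>\<mu>(u)\<close> accumulated there has mean
\<open>\<integral>\<^sub>0\<^sup>t P(V\<^sub>i \<le> t - u) F\<^sub>g(u) du\<close>. With \<open>*\<close> for convolution on the half-line and \<open>R\<close> for the
renewal function \<open>\<Sum>\<^sub>i P(V\<^sub>i \<le> t)\<close> this reads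

  \<open>m\<^sub>2 = A + m\<^sub>2 * \<eta>h\<close>  where  \<open>A = R * F\<^sub>g\<close>  (lemmas mean_compensator and events_mean_equation).

A cycle has density \<open>n\<^sub>2\<close> (lemma distr_gap), so \<open>R = 1 + R * n\<^sub>2\<close> and \<open>A = 1 * F\<^sub>g + A * n\<^sub>2\<close>. Thus
\<open>m\<^sub>2\<close> solves a Volterra equation with kernel \<open>\<eta>h\<close>. Now let \<open>K = 1 + k\<^sub>2\<^sub>,\<^sub>0\<close>, so that
\<open>K = 1 + K * \<eta>h\<close>. By commutativity and associativity of convolution the function
\<open>K * F\<^sub>g + m\<^sub>2 * n\<^sub>2\<close> solves the same Volterra equation as \<open>m\<^sub>2\<close>; locally bounded solutions are unique,
which is the integral equation \<open>m\<^sub>2 = \<Psi>\<^sub>2 + m\<^sub>2 * n\<^sub>2\<close> (lemma events_mean_renewal_equation). The Laplace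
transform turns the equations for \<open>m\<^sub>2\<close> and \<open>A\<close> into linear equations for \<open>m\<^sub>2\<^sup>*\<close> and \<open>A\<^sup>*\<close>
(lemma laplace_m2).

Two points need care. First, \<open>m\<^sub>2 = A + m\<^sub>2 * \<eta>h\<close> is also satisfied by functions that are infinite from
some time on, so finiteness of \<open>m\<^sub>2\<close> does not follow from it. It is obtained by stopping: the process
of the first \<open>n\<close> points has a mean bounded by \<open>n\<close> which satisfies the equation as an inequality, and
a Gronwall estimate with an exponential weight bounds it uniformly in \<open>n\<close> (lemma
events_mean_finite). Secondly, the formula for the transform divides by \<open>s\<close>, \<open>1 - \<eta>h\<^sup>*(s)\<close> and \<open>1 - n\<^sub>2\<^sup>*(s)\<close>. These are nonzero whenever
\<open>m\<^sub>2\<^sup>*(s)\<close> exists: \<open>m\<^sub>2\<close> is eventually bounded below by a positive constant, hence \<open>Re s > 0\<close>; the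
equation at the real point \<open>\<sigma> = Re s\<close> forces \<open>\<eta>h\<^sup>*(\<sigma>) < 1\<close> because \<open>A\<^sup>*(\<sigma>) > 0\<close> and
\<open>m\<^sub>2\<^sup>*(\<sigma>) < \<infinity>\<close>; and \<open>n\<^sub>2\<^sup>*(\<sigma>) < 1\<close> because \<open>n\<^sub>2\<close> is a probability density on \<open>(0, \<infinity>)\<close>.

All equations are first proved for functions with values in \<open>[0, \<infinity>]\<close>, where convolutions always
exist and the order of integration never matters.\<close>

section \<open>Convolution and Laplace transform of nonnegative functions\<close>

text \<open>Functions on the half-line are extended by zero to the whole line (predicate \<open>causal\<close> below); then
the integral over the line is the usual convolution integral over \<open>[0, t]\<close>, and translation
invariance of Lebesgue measure makes convolution commutative and associative.\<close>

definition conv :: "(real \<Rightarrow> ennreal) \<Rightarrow> (real \<Rightarrow> ennreal) \<Rightarrow> real \<Rightarrow> ennreal" where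
  "conv a b t = (\<integral>\<^sup>+v. a (t - v) * b v \<partial>lborel)"

definition nn_laplace :: "real \<Rightarrow> (real \<Rightarrow> ennreal) \<Rightarrow> ennreal" where
  "nn_laplace \<sigma> a = (\<integral>\<^sup>+t. ennreal (exp (- (\<sigma> * t))) * a t \<partial>lborel)"

definition causal :: "(real \<Rightarrow> ennreal) \<Rightarrow> bool" where
  "causal a \<longleftrightarrow> (\<forall>t<0. a t = 0)"

lemma causalD: "causal a \<Longrightarrow> t < 0 \<Longrightarrow> a t = 0"
  by (simp add: causal_def)

lemma nn_integral_shift:
  fixes a :: "real \<Rightarrow> ennreal"
  assumes [measurable]: "a \<in> borel_measurable borel"
  shows "(\<integral>\<^sup>+v. a (v - c) \<partial>lborel) = (\<integral>\<^sup>+v. a v \<partial>lborel)"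
  using nn_integral_real_affine[of a 1 "-c"] by (simp add: add.commute)

lemma nn_integral_reflect:
  fixes a :: "real \<Rightarrow> ennreal"
  assumes [measurable]: "a \<in> borel_measurable borel"
  shows "(\<integral>\<^sup>+v. a (c - v) \<partial>lborel) = (\<integral>\<^sup>+v. a v \<partial>lborel)"
  using nn_integral_real_affine[of a "-1" c] by simp

lemma measurable_conv [measurable]:
  assumes [measurable]: "a \<in> borel_measurable borel" "b \<in> borel_measurable borel"
  shows "conv a b \<in> borel_measurable borel"
  unfolding conv_def by measurable

lemma conv_commute:
  assumes [measurable]: "a \<in> borel_measurable borel" "b \<in> borel_measurable borel"
  shows "conv a b = conv b a"
proof
  fix t
  have "conv a b t = (\<integral>\<^sup>+v. a (t - (t - v)) * b (t - v) \<partial>lborel)"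
    unfolding conv_def
    using nn_integral_reflect[of "\<lambda>v. a (t - v) * b v" t] by simp
  then show "conv a b t = conv b a t"
    by (simp add: conv_def mult.commute)
qed

lemma conv_assoc:
  assumes [measurable]: "a \<in> borel_measurable borel" "b \<in> borel_measurable borel"
    "c \<in> borel_measurable borel"
  shows "conv (conv a b) c = conv a (conv b c)"
proof
  fix t
  have "conv a (conv b c) t = (\<integral>\<^sup>+w. (\<integral>\<^sup>+v. a (t - w) * (b (w - v) * c v) \<partial>lborel) \<partial>lborel)"
    unfolding conv_def by (simp add: nn_integral_cmult)
  also have "\<dots> = (\<integral>\<^sup>+v. (\<integral>\<^sup>+w. a (t - w) * (b (w - v) * c v) \<partial>lborel) \<partial>lborel)"
    by (rule lborel_pair.Fubini') measurable
  also have "\<dots> = (\<integral>\<^sup>+v. (\<integral>\<^sup>+w. a (t - v - w) * b w \<partial>lborel) * c v \<partial>lborel)"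
  proof (rule nn_integral_cong)
    fix v
    have "(\<integral>\<^sup>+w. a (t - w) * (b (w - v) * c v) \<partial>lborel)
        = (\<integral>\<^sup>+w. (\<lambda>u. a (t - v - u) * b u * c v) (w - v) \<partial>lborel)"
      by (simp add: mult.assoc)
    also have "\<dots> = (\<integral>\<^sup>+w. a (t - v - w) * b w * c v \<partial>lborel)"
      by (rule nn_integral_shift) measurable
    also have "\<dots> = (\<integral>\<^sup>+w. a (t - v - w) * b w \<partial>lborel) * c v"
      by (rule nn_integral_multc) measurable
    finally show "(\<integral>\<^sup>+w. a (t - w) * (b (w - v) * c v) \<partial>lborel) = \<dots>" .
  qed
  finally show "conv (conv a b) c t = conv a (conv b c) t"
    by (simp add: conv_def)
qed

lemma conv_add_left:
  assumes [measurable]: "a \<in> borel_measurable borel" "b \<in> borel_measurable borel"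
    "c \<in> borel_measurable borel"
  shows "conv (\<lambda>t. a t + b t) c t = conv a c t + conv b c t"
  unfolding conv_def by (simp add: distrib_right nn_integral_add)

lemma conv_suminf_left:
  assumes [measurable]: "\<And>i. a i \<in> borel_measurable borel" "b \<in> borel_measurable borel"
  shows "conv (\<lambda>t. \<Sum>i. a i t) b t = (\<Sum>i. conv (a i) b t)"
  unfolding conv_def by (simp add: nn_integral_suminf flip: ennreal_suminf_multc)

lemma conv_mono:
  assumes "\<And>t. a t \<le> a' t" "\<And>t. b t \<le> b' t"
  shows "conv a b t \<le> conv a' b' t"
  unfolding conv_def by (intro nn_integral_mono mult_mono assms) auto

lemma causal_conv: "causal a \<Longrightarrow> causal b \<Longrightarrow> causal (conv a b)"
  unfolding causal_def conv_def
proof safe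
  fix t :: real
  assume ab: "\<forall>t<0. a t = 0" "\<forall>t<0. b t = 0" and t: "t < 0"
  have "a (t - v) * b v = 0" for v
    using ab t by (cases "v < 0") auto
  then show "(\<integral>\<^sup>+v. a (t - v) * b v \<partial>lborel) = 0" by (simp del: mult_eq_0_iff)
qed

lemma nn_laplace_conv:
  assumes [measurable]: "a \<in> borel_measurable borel" "b \<in> borel_measurable borel"
  shows "nn_laplace \<sigma> (conv a b) = nn_laplace \<sigma> a * nn_laplace \<sigma> b"
proof -
  have "nn_laplace \<sigma> (conv a b)
      = (\<integral>\<^sup>+t. (\<integral>\<^sup>+v. (ennreal (exp (- (\<sigma> * (t - v)))) * a (t - v)) * (ennreal (exp (- (\<sigma> * v))) * b v) \<partial>lborel) \<partial>lborel)"
    unfolding nn_laplace_def conv_def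
  proof (rule nn_integral_cong)
    fix t
    have "ennreal (exp (- (\<sigma> * t))) * (a (t - v) * b v)
        = (ennreal (exp (- (\<sigma> * (t - v)))) * a (t - v)) * (ennreal (exp (- (\<sigma> * v))) * b v)" for v
    proof -
      have "exp (- (\<sigma> * t)) = exp (- (\<sigma> * (t - v))) * exp (- (\<sigma> * v))"
        by (simp add: algebra_simps flip: exp_add)
      then show ?thesis
        by (simp add: ennreal_mult' mult_ac)
    qed
    then show "ennreal (exp (- (\<sigma> * t))) * (\<integral>\<^sup>+v. a (t - v) * b v \<partial>lborel) =
      (\<integral>\<^sup>+v. (ennreal (exp (- (\<sigma> * (t - v)))) * a (t - v)) * (ennreal (exp (- (\<sigma> * v))) * b v) \<partial>lborel)"
      by (subst nn_integral_cmult[symmetric]) simp_all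
  qed
  also have "\<dots> = (\<integral>\<^sup>+v. (\<integral>\<^sup>+t. (ennreal (exp (- (\<sigma> * (t - v)))) * a (t - v)) * (ennreal (exp (- (\<sigma> * v))) * b v) \<partial>lborel) \<partial>lborel)"
    by (rule lborel_pair.Fubini') measurable
  also have "\<dots> = (\<integral>\<^sup>+v. (\<integral>\<^sup>+t. (\<lambda>u. ennreal (exp (- (\<sigma> * u))) * a u) (t - v) \<partial>lborel) * (ennreal (exp (- (\<sigma> * v))) * b v) \<partial>lborel)"
    by (simp add: nn_integral_multc)
  also have "\<dots> = (\<integral>\<^sup>+v. nn_laplace \<sigma> a * (ennreal (exp (- (\<sigma> * v))) * b v) \<partial>lborel)"
    unfolding nn_laplace_def by (subst nn_integral_shift) simp_all
  also have "\<dots> = nn_laplace \<sigma> a * nn_laplace \<sigma> b"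
    unfolding nn_laplace_def by (rule nn_integral_cmult) measurable
  finally show ?thesis .
qed

lemma nn_laplace_add:
  assumes [measurable]: "a \<in> borel_measurable borel" "b \<in> borel_measurable borel"
  shows "nn_laplace \<sigma> (\<lambda>t. a t + b t) = nn_laplace \<sigma> a + nn_laplace \<sigma> b"
  unfolding nn_laplace_def by (simp add: distrib_left nn_integral_add)

lemma nn_laplace_mono: "(\<And>t. a t \<le> b t) \<Longrightarrow> nn_laplace \<sigma> a \<le> nn_laplace \<sigma> b"
  unfolding nn_laplace_def by (intro nn_integral_mono mult_left_mono) auto

section \<open>Linear Volterra equations\<close>

text \<open>Convolution with \<open>b\<close> multiplies the norm \<open>sup x(s) e\<^sup>-\<^sup>\<theta>\<^sup>s\<close> by at most \<open>b\<^sup>*(\<theta>)\<close>, which is small for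
large \<open>\<theta>\<close>. This makes Volterra equations contractive on every bounded interval.\<close>

lemma conv_exp_bound:
  assumes [measurable]: "b \<in> borel_measurable borel"
    and b: "causal b" and x: "causal x"
    and le: "\<And>s. 0 \<le> s \<Longrightarrow> s \<le> t \<Longrightarrow> x s \<le> C * ennreal (exp (\<theta> * s))"
  shows "conv x b t \<le> C * ennreal (exp (\<theta> * t)) * nn_laplace \<theta> b"
proof -
  have "x (t - v) * b v \<le> C * ennreal (exp (\<theta> * t)) * (ennreal (exp (- (\<theta> * v))) * b v)" for v
  proof (cases "0 \<le> v \<and> v \<le> t")
    case True
    have "exp (\<theta> * (t - v)) = exp (\<theta> * t) * exp (- (\<theta> * v))"
      by (simp add: algebra_simps flip: exp_add)
    then have "C * ennreal (exp (\<theta> * (t - v))) * b v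
        = C * ennreal (exp (\<theta> * t)) * (ennreal (exp (- (\<theta> * v))) * b v)"
      by (simp add: ennreal_mult' mult_ac)
    moreover have "x (t - v) * b v \<le> C * ennreal (exp (\<theta> * (t - v))) * b v"
      using le[of "t - v"] True by (intro mult_right_mono) auto
    ultimately show ?thesis by simp
  next
    case False
    then have "x (t - v) * b v = 0"
      using causalD[OF b, of v] causalD[OF x, of "t - v"] by (cases "v < 0") auto
    then show ?thesis by (simp del: mult_eq_0_iff)
  qed
  then have "conv x b t \<le> (\<integral>\<^sup>+v. C * ennreal (exp (\<theta> * t)) * (ennreal (exp (- (\<theta> * v))) * b v) \<partial>lborel)"
    unfolding conv_def by (intro nn_integral_mono)
  also have "\<dots> = C * ennreal (exp (\<theta> * t)) * nn_laplace \<theta> b"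
    unfolding nn_laplace_def by (rule nn_integral_cmult) measurable
  finally show ?thesis .
qed

text \<open>If \<open>b\<^sup>*(\<theta>) \<le> 1/2\<close>, each application of the inequality halves the part of the bound that stems from
the finite a priori bound \<open>B\<close>, which thus disappears in the limit, while the contributions of \<open>\<alpha>\<close>
form a geometric series with sum at most \<open>2\<alpha>\<close>.\<close>

lemma volterra_gronwall:
  fixes x b :: "real \<Rightarrow> ennreal" and \<alpha> B \<theta> \<tau> :: real
  assumes [measurable]: "b \<in> borel_measurable borel"
    and b: "causal b" "nn_laplace \<theta> b \<le> ennreal (1/2)" and x: "causal x" and \<theta>: "0 \<le> \<theta>"
    and nonneg: "0 \<le> \<alpha>" "0 \<le> B"
    and bd: "\<And>t. 0 \<le> t \<Longrightarrow> t \<le> \<tau> \<Longrightarrow> x t \<le> ennreal B"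
    and le: "\<And>t. 0 \<le> t \<Longrightarrow> t \<le> \<tau> \<Longrightarrow> x t \<le> ennreal \<alpha> + conv x b t"
    and t: "0 \<le> t" "t \<le> \<tau>"
  shows "x t \<le> ennreal (2 * \<alpha> * exp (\<theta> * t))"
proof -
  have step: "x t \<le> ennreal ((2 * \<alpha> + B / 2 ^ n) * exp (\<theta> * t))" if "0 \<le> t" "t \<le> \<tau>" for n t
    using that
  proof (induction n arbitrary: t)
    case 0
    have "B * 1 \<le> (2 * \<alpha> + B) * exp (\<theta> * t)"
      using 0 nonneg \<theta> by (intro mult_mono) auto
    then show ?case
      using bd[OF 0] by (auto intro: order.trans ennreal_leI)
  next
    case (Suc n)
    let ?C = "2 * \<alpha> + B / 2 ^ n"
    have C: "0 \<le> ?C" using nonneg by simp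
    have "x t \<le> ennreal \<alpha> + conv x b t" by (rule le[OF Suc.prems])
    also have "conv x b t \<le> ennreal ?C * ennreal (exp (\<theta> * t)) * nn_laplace \<theta> b"
      using Suc C by (intro conv_exp_bound b x) (auto simp flip: ennreal_mult)
    also have "\<dots> \<le> ennreal ?C * ennreal (exp (\<theta> * t)) * ennreal (1/2)"
      by (intro mult_left_mono b) auto
    also have "\<dots> = ennreal (?C * exp (\<theta> * t) * (1/2))"
      using C by (simp only: ennreal_mult exp_ge_zero mult_nonneg_nonneg zero_le_divide_iff zero_le_one zero_le_numeral simp_thms)
    also have "ennreal \<alpha> + \<dots> = ennreal (\<alpha> + ?C * exp (\<theta> * t) * (1/2))"
      using C nonneg by (subst ennreal_plus) auto
    also have "\<dots> \<le> ennreal ((2 * \<alpha> + B / 2 ^ Suc n) * exp (\<theta> * t))"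
    proof (rule ennreal_leI)
      have "\<alpha> * 1 \<le> \<alpha> * exp (\<theta> * t)"
        using Suc.prems nonneg \<theta> by (intro mult_left_mono) auto
      then show "\<alpha> + ?C * exp (\<theta> * t) * (1/2) \<le> (2 * \<alpha> + B / 2 ^ Suc n) * exp (\<theta> * t)"
        by (simp add: algebra_simps)
    qed
    finally show ?case by (simp add: add_left_mono)
  qed
  have "(\<lambda>n. ennreal ((2 * \<alpha> + B / 2 ^ n) * exp (\<theta> * t))) \<longlonglongrightarrow> ennreal ((2 * \<alpha> + 0) * exp (\<theta> * t))"
    by (intro tendsto_intros LIMSEQ_divide_realpow_zero) auto
  then show ?thesis
    using step[OF t] by (intro LIMSEQ_le_const[of _ _ "x t"]) auto
qed

text \<open>The distance of two solutions satisfies the homogeneous inequality \<open>d \<le> d * b\<close>, so it vanishes by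
the Gronwall estimate with \<open>\<alpha> = 0\<close>. Monotonicity supplies the local bounds.\<close>

lemma volterra_unique:
  fixes x y a b :: "real \<Rightarrow> ennreal"
  assumes [measurable]: "x \<in> borel_measurable borel" "y \<in> borel_measurable borel"
      "b \<in> borel_measurable borel"
    and causal: "causal x" "causal y" "causal b"
    and b: "nn_laplace \<theta> b \<le> ennreal (1/2)" "0 \<le> \<theta>"
    and mono: "mono x" "mono y" and finite: "\<And>t. x t < \<infinity>" "\<And>t. y t < \<infinity>"
    and eq: "\<And>t. 0 \<le> t \<Longrightarrow> x t = a t + conv x b t" "\<And>t. 0 \<le> t \<Longrightarrow> y t = a t + conv y b t"
  shows "x = y"
proof
  fix \<tau>
  define d where "d t = ennreal \<bar>enn2real (x t) - enn2real (y t)\<bar>" for t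
  have [measurable]: "d \<in> borel_measurable borel" unfolding d_def by measurable
  have d: "x t \<le> y t + d t" "y t \<le> x t + d t" for t
    using finite[of t] unfolding d_def
    by (cases "x t"; cases "y t"; force simp flip: ennreal_plus intro!: ennreal_leI)+
  have d_le: "d t \<le> e" if "x t \<le> y t + e" "y t \<le> x t + e" for t e
    using that finite[of t] unfolding d_def
    by (cases "x t"; cases "y t"; cases e) (auto simp flip: ennreal_plus)
  have causal_d: "causal d" using causal by (simp add: causal_def d_def)
  show "x \<tau> = y \<tau>"
  proof (cases "0 \<le> \<tau>")
    case True
    have "d \<tau> \<le> ennreal (2 * 0 * exp (\<theta> * \<tau>))"
    proof (rule volterra_gronwall[where B = "enn2real (x \<tau> + y \<tau>)" and \<tau> = \<tau>])
      fix t assume t: "0 \<le> t" "t \<le> \<tau>"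
      have "d t \<le> x \<tau> + y \<tau>"
        using monoD[OF mono(1) t(2)] monoD[OF mono(2) t(2)]
        by (intro d_le) (auto intro: order.trans add_increasing add_increasing2)
      then show "d t \<le> ennreal (enn2real (x \<tau> + y \<tau>))"
        using finite[of \<tau>] by simp
      have "conv x b t \<le> conv y b t + conv d b t" "conv y b t \<le> conv x b t + conv d b t"
        using d by (auto intro!: conv_mono simp flip: conv_add_left)
      then show "d t \<le> ennreal 0 + conv d b t"
        by (intro d_le) (auto simp: eq[OF t(1)] add.assoc intro: add_left_mono)
    qed (use b causal causal_d True in auto)
    then show ?thesis using d[of \<tau>] by (auto intro: antisym)
  qed (use causal in \<open>simp add: causal_def\<close>)
qed

lemma conv_mono_arg:
  assumes "mono a"
  shows "mono (conv a b)"
  unfolding conv_def using monoD[OF assms]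
  by (intro monoI nn_integral_mono mult_right_mono) auto

lemma conv_le_of_mono:
  assumes [measurable]: "b \<in> borel_measurable borel" and "mono a" "causal b"
    and b: "(\<integral>\<^sup>+v. b v \<partial>lborel) \<le> 1"
  shows "conv a b t \<le> a t"
proof -
  have "conv a b t \<le> (\<integral>\<^sup>+v. a t * b v \<partial>lborel)"
    unfolding conv_def
  proof (rule nn_integral_mono)
    fix v
    show "a (t - v) * b v \<le> a t * b v"
    proof (cases "v < 0")
      case False
      then show ?thesis using monoD[OF \<open>mono a\<close>, of "t - v" t] by (intro mult_right_mono) auto
    qed (simp add: causalD[OF \<open>causal b\<close>])
  qed
  also have "\<dots> = a t * (\<integral>\<^sup>+v. b v \<partial>lborel)"
    by (rule nn_integral_cmult) measurable
  also have "\<dots> \<le> a t * 1" by (intro mult_left_mono b) auto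
  finally show ?thesis by simp
qed

text \<open>The equation \<open>x\<^sup>* = a\<^sup>* + x\<^sup>* b\<^sup>*\<close> for the transforms alone would allow \<open>x\<^sup>* = \<infinity>\<close>. The truncation of
\<open>x\<close> at time \<open>n\<close> satisfies it as an inequality and has a finite transform, which is therefore at most
\<open>a\<^sup>* / (1 - b\<^sup>*)\<close>.\<close>

lemma volterra_laplace_finite:
  fixes x a b :: "real \<Rightarrow> ennreal"
  assumes [measurable]: "x \<in> borel_measurable borel" "a \<in> borel_measurable borel"
      "b \<in> borel_measurable borel"
    and causal: "causal x" "causal b" and mono: "mono x" and finite: "\<And>t. x t < \<infinity>"
    and le: "\<And>t. 0 \<le> t \<Longrightarrow> x t \<le> a t + conv x b t"
    and \<sigma>: "0 \<le> \<sigma>" and a: "nn_laplace \<sigma> a < \<infinity>" and b: "nn_laplace \<sigma> b < 1"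
  shows "nn_laplace \<sigma> x < \<infinity>"
proof -
  define x' where "x' n t = indicator {..real n} t * x t" for n t
  have [measurable]: "x' n \<in> borel_measurable borel" for n unfolding x'_def by measurable
  obtain \<beta> where \<beta>: "nn_laplace \<sigma> b = ennreal \<beta>" "0 \<le> \<beta>" "\<beta> < 1"
    using b by (cases "nn_laplace \<sigma> b") auto
  obtain \<alpha> where \<alpha>: "nn_laplace \<sigma> a = ennreal \<alpha>" "0 \<le> \<alpha>"
    using a by (cases "nn_laplace \<sigma> a") auto
  have bound: "nn_laplace \<sigma> (x' n) \<le> ennreal (\<alpha> / (1 - \<beta>))" for n
  proof -
    have "x' n t \<le> a t + conv (x' n) b t" for t
    proof (cases "0 \<le> t \<and> t \<le> real n")
      case True
      have "conv x b t \<le> conv (x' n) b t"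
        unfolding conv_def
      proof (rule nn_integral_mono)
        fix v
        show "x (t - v) * b v \<le> x' n (t - v) * b v"
        proof (cases "v < 0")
          case False
          then show ?thesis using True by (simp add: x'_def)
        qed (simp add: causalD[OF causal(2)])
      qed
      then have "a t + conv x b t \<le> a t + conv (x' n) b t" by (rule add_left_mono)
      with le[of t] True have "x t \<le> a t + conv (x' n) b t" by (blast intro: order.trans)
      then show ?thesis using True by (simp add: x'_def)
    qed (use causalD[OF causal(1), of t] in \<open>auto simp: x'_def indicator_def\<close>)
    then have "nn_laplace \<sigma> (x' n) \<le> nn_laplace \<sigma> (\<lambda>t. a t + conv (x' n) b t)"
      by (rule nn_laplace_mono)
    also have "\<dots> = ennreal \<alpha> + nn_laplace \<sigma> (x' n) * ennreal \<beta>"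
      by (simp add: nn_laplace_add nn_laplace_conv \<alpha> \<beta>)
    finally have ineq: "nn_laplace \<sigma> (x' n) \<le> ennreal \<alpha> + nn_laplace \<sigma> (x' n) * ennreal \<beta>" .
    have "nn_laplace \<sigma> (x' n) \<le> (\<integral>\<^sup>+t. x (real n) * indicator {0..real n} t \<partial>lborel)"
      unfolding nn_laplace_def
    proof (rule nn_integral_mono)
      fix t
      show "ennreal (exp (- (\<sigma> * t))) * x' n t \<le> x (real n) * indicator {0..real n} t"
      proof (cases "t \<in> {0..real n}")
        case True
        then have "ennreal (exp (- (\<sigma> * t))) * x t \<le> 1 * x (real n)"
          using \<sigma> monoD[OF mono, of t "real n"] by (intro mult_mono) auto
        then show ?thesis using True by (simp add: x'_def)
      qed (use causalD[OF causal(1), of t] in \<open>auto simp: x'_def indicator_def\<close>)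
    qed
    also have "\<dots> < \<infinity>"
      using finite[of "real n"] by (simp add: nn_integral_cmult ennreal_mult_less_top)
    finally obtain l where l: "nn_laplace \<sigma> (x' n) = ennreal l" "0 \<le> l"
      by (cases "nn_laplace \<sigma> (x' n)") auto
    then have "l \<le> \<alpha> + l * \<beta>"
      using ineq \<alpha> \<beta> by (simp flip: ennreal_mult ennreal_plus)
    then show ?thesis
      using \<beta> l by (auto simp: pos_le_divide_eq algebra_simps intro!: ennreal_leI)
  qed
  have "nn_laplace \<sigma> x = (\<integral>\<^sup>+t. (SUP n. ennreal (exp (- (\<sigma> * t))) * x' n t) \<partial>lborel)"
    unfolding nn_laplace_def
  proof (rule nn_integral_cong)
    fix t
    obtain N where "t \<le> real N" using real_arch_simple by blast
    then have "x t \<le> x' N t" by (simp add: x'_def)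
    then have "ennreal (exp (- (\<sigma> * t))) * x t \<le> (SUP n. ennreal (exp (- (\<sigma> * t))) * x' n t)"
      by (intro SUP_upper2[of N] mult_left_mono) auto
    then show "ennreal (exp (- (\<sigma> * t))) * x t = (SUP n. ennreal (exp (- (\<sigma> * t))) * x' n t)"
      by (intro antisym SUP_least mult_left_mono) (auto simp: x'_def indicator_def)
  qed
  also have "\<dots> = (SUP n. nn_laplace \<sigma> (x' n))"
    unfolding nn_laplace_def
    by (intro nn_integral_monotone_convergence_SUP)
       (auto simp: incseq_def le_fun_def x'_def indicator_def intro!: mult_left_mono)
  also have "\<dots> \<le> ennreal (\<alpha> / (1 - \<beta>))"
    by (intro SUP_least bound)
  finally show ?thesis by (simp add: le_less_trans)
qed

text \<open>The \<open>n\<close>-fold convolution of \<open>b\<close>, integrated over \<open>[0, t]\<close>; for a probability density \<open>b\<close> this is the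
distribution function of a sum of \<open>n\<close> independent variables with density \<open>b\<close>.\<close>

primrec conv_power :: "(real \<Rightarrow> ennreal) \<Rightarrow> nat \<Rightarrow> real \<Rightarrow> ennreal" where
  "conv_power b 0 = indicator {0..}"
| "conv_power b (Suc n) = conv (conv_power b n) b"

text \<open>The Neumann series solving \<open>K = 1 + K * b\<close>. For a probability density it is the renewal function; for
\<open>b = \<eta>h\<close> it is \<open>1 + k\<^sub>2\<^sub>,\<^sub>0\<close>.\<close>

definition renewal_fun :: "(real \<Rightarrow> ennreal) \<Rightarrow> real \<Rightarrow> ennreal" where
  "renewal_fun b t = (\<Sum>n. conv_power b n t)"

lemma measurable_conv_power [measurable]:
  assumes [measurable]: "b \<in> borel_measurable borel"
  shows "conv_power b n \<in> borel_measurable borel"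
  by (induction n) auto

lemma causal_indicator [simp]: "causal (indicator {0..})"
  by (simp add: causal_def)

lemma causal_conv_power: "causal b \<Longrightarrow> causal (conv_power b n)"
  by (induction n) (auto intro: causal_conv)

lemma mono_conv_power: "mono (conv_power b n)"
proof (induction n)
  case 0
  then show ?case by (auto intro!: monoI simp: indicator_def)
qed (simp add: conv_mono_arg)

lemma conv_power_bound:
  assumes [measurable]: "b \<in> borel_measurable borel" and "causal b" "0 \<le> \<theta>"
  shows "conv_power b n t \<le> nn_laplace \<theta> b ^ n * ennreal (exp (\<theta> * t))"
proof (induction n arbitrary: t)
  case 0
  have "ennreal 1 \<le> ennreal (exp (\<theta> * t))" if "0 \<le> t"
    using that \<open>0 \<le> \<theta>\<close> by (intro ennreal_leI) simp
  then show ?case by (simp add: indicator_def)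
next
  case (Suc n)
  have "conv_power b (Suc n) t \<le> nn_laplace \<theta> b ^ n * ennreal (exp (\<theta> * t)) * nn_laplace \<theta> b"
    using assms Suc by (simp add: conv_exp_bound causal_conv_power)
  then show ?case by (simp add: mult_ac)
qed

lemma measurable_renewal_fun [measurable]:
  assumes [measurable]: "b \<in> borel_measurable borel"
  shows "renewal_fun b \<in> borel_measurable borel"
  unfolding renewal_fun_def by measurable

lemma causal_renewal_fun: "causal b \<Longrightarrow> causal (renewal_fun b)"
  using causal_conv_power[of b] by (simp add: causal_def renewal_fun_def)

lemma mono_renewal_fun: "mono (renewal_fun b)"
  unfolding renewal_fun_def using monoD[OF mono_conv_power]
  by (intro monoI suminf_le) auto

lemma renewal_fun_finite:
  assumes [measurable]: "b \<in> borel_measurable borel"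
    and "causal b" "0 \<le> \<theta>" and less: "nn_laplace \<theta> b < 1"
  shows "renewal_fun b t < \<infinity>"
proof -
  obtain q where q: "nn_laplace \<theta> b = ennreal q" "0 \<le> q" "q < 1"
    using less by (cases "nn_laplace \<theta> b") auto
  have "renewal_fun b t \<le> (\<Sum>n. ennreal (q ^ n * exp (\<theta> * t)))"
    unfolding renewal_fun_def
    using conv_power_bound[OF assms(1-3), of _ t] q
    by (intro suminf_le) (auto simp: ennreal_power ennreal_mult)
  also have "\<dots> = ennreal (\<Sum>n. q ^ n * exp (\<theta> * t))"
    using q by (intro suminf_ennreal2) (auto intro: summable_mult2)
  finally show ?thesis by (simp add: le_less_trans)
qed

lemma renewal_fun_equation:
  assumes [measurable]: "b \<in> borel_measurable borel"
  shows "renewal_fun b t = indicator {0..} t + conv (renewal_fun b) b t"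
proof -
  have "renewal_fun b t = conv_power b 0 t + (\<Sum>n. conv_power b (Suc n) t)"
    unfolding renewal_fun_def using suminf_offset[of "\<lambda>n. conv_power b n t" 1] by simp
  also have "(\<Sum>n. conv_power b (Suc n) t) = conv (renewal_fun b) b t"
    unfolding renewal_fun_def[abs_def] by (subst conv_suminf_left) auto
  finally show ?thesis by simp
qed

lemma exists_exponent_nn_laplace_le:
  fixes b :: "real \<Rightarrow> ennreal"
  assumes [measurable]: "b \<in> borel_measurable borel"
    and b: "causal b" "(\<integral>\<^sup>+t. b t \<partial>lborel) < \<infinity>"
  shows "\<exists>\<theta>\<ge>0. nn_laplace \<theta> b \<le> ennreal (1/2)"
proof -
  have "(\<lambda>n. \<integral>\<^sup>+t. ennreal (exp (- (real n * t))) * b t \<partial>lborel) \<longlonglongrightarrow> (\<integral>\<^sup>+(t::real). 0 \<partial>lborel)"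
  proof (rule nn_integral_dominated_convergence[where w = b])
    show "AE t in lborel. ennreal (exp (- (real n * t))) * b t \<le> b t" for n
    proof (rule AE_I2)
      fix t :: real
      show "ennreal (exp (- (real n * t))) * b t \<le> b t"
      proof (cases "t < 0")
        case True
        then show ?thesis using causalD[OF b(1)] by simp
      next
        case False
        then have "ennreal (exp (- (real n * t))) \<le> ennreal 1" by (intro ennreal_leI) simp
        then show ?thesis using mult_right_mono[of _ 1 "b t"] by simp
      qed
    qed
    have "AE t in lborel. b t \<noteq> \<infinity>"
      using b(2) by (intro nn_integral_noteq_infinite) auto
    moreover have "AE t in lborel. t \<noteq> (0::real)" by (rule AE_lborel_singleton)
    ultimately show "AE t in lborel. (\<lambda>n. ennreal (exp (- (real n * t))) * b t) \<longlonglongrightarrow> 0"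
    proof eventually_elim
      case (elim t)
      show ?case
      proof (cases "t < 0")
        case True
        then show ?thesis using causalD[OF b(1)] by simp
      next
        case False
        with elim have t: "0 < t" by simp
        have "(\<lambda>n. exp (- t) ^ n) \<longlonglongrightarrow> 0"
          using t by (intro LIMSEQ_realpow_zero) auto
        then have "(\<lambda>n. ennreal (exp (- (real n * t)))) \<longlonglongrightarrow> ennreal 0"
          by (intro tendsto_ennrealI) (simp flip: exp_of_nat_mult)
        then have "(\<lambda>n. ennreal (exp (- (real n * t))) * b t) \<longlonglongrightarrow> ennreal 0 * b t"
          using elim by (intro tendsto_mult_ennreal tendsto_const) auto
        then show ?thesis by simp
      qed
    qed
  qed (use b in auto)
  then have "(\<lambda>n. nn_laplace (real n) b) \<longlonglongrightarrow> 0"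
    by (simp add: nn_laplace_def)
  then have "eventually (\<lambda>n. nn_laplace (real n) b < ennreal (1/2)) sequentially"
    by (rule order_tendstoD) (unfold ennreal_less_zero_iff, simp)
  then obtain n where "nn_laplace (real n) b < ennreal (1/2)"
    by (auto simp: eventually_sequentially)
  then show ?thesis by (intro exI[of _ "real n"]) auto
qed

section \<open>Nonnegative integrands on the half-line\<close>

text \<open>This lemma and the next translate between real integrals over sets and integrals of functions with values in
\<open>[0, \<infinity>]\<close>. Measurability is stated for \<open>\<Phi>\<close>, so that \<open>\<phi>\<close> may be arbitrary off the set.\<close>

lemma set_integral_eq_nn_integral:
  fixes \<phi> :: "real \<Rightarrow> real" and \<Phi> :: "real \<Rightarrow> ennreal"
  assumes [measurable]: "\<Phi> \<in> borel_measurable borel"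
    and eq: "\<And>v. \<Phi> v = indicator S v * ennreal (\<phi> v)"
    and nonneg: "\<And>v. v \<in> S \<Longrightarrow> 0 \<le> \<phi> v"
  shows "(LBINT v:S. \<phi> v) = enn2real (\<integral>\<^sup>+v. \<Phi> v \<partial>lborel)"
    and "(\<integral>\<^sup>+v. \<Phi> v \<partial>lborel) < \<infinity> \<Longrightarrow> set_integrable lborel S \<phi>"
proof -
  have e: "indicator S v * \<phi> v = enn2real (\<Phi> v)" for v
    using nonneg[of v] by (auto simp: eq indicator_def)
  have e': "\<Phi> v = ennreal (indicator S v * \<phi> v)" for v
    using nonneg[of v] by (auto simp: eq indicator_def)
  have m: "(\<lambda>v. indicator S v * \<phi> v) \<in> borel_measurable borel"
    unfolding e by measurable
  have nn: "0 \<le> indicator S v * \<phi> v" for v using nonneg by (auto simp: indicator_def)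
  show "(LBINT v:S. \<phi> v) = enn2real (\<integral>\<^sup>+v. \<Phi> v \<partial>lborel)"
    unfolding set_lebesgue_integral_def real_scaleR_def e'
    using m nn by (intro integral_eq_nn_integral) auto
  show "set_integrable lborel S \<phi>" if "(\<integral>\<^sup>+v. \<Phi> v \<partial>lborel) < \<infinity>"
    using that m nn unfolding set_integrable_def real_scaleR_def e'
    by (intro integrableI_nonneg) auto
qed

lemma nn_integral_set_integrable:
  fixes \<phi> :: "real \<Rightarrow> real"
  assumes "set_integrable lborel S \<phi>" and nonneg: "\<And>v. v \<in> S \<Longrightarrow> 0 \<le> \<phi> v"
  shows "(\<integral>\<^sup>+v. indicator S v * ennreal (\<phi> v) \<partial>lborel) = ennreal (LBINT v:S. \<phi> v)"
proof -
  have "(\<integral>\<^sup>+v. indicator S v * ennreal (\<phi> v) \<partial>lborel)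
      = (\<integral>\<^sup>+v. ennreal (indicator S v * \<phi> v) \<partial>lborel)"
    using nonneg by (intro nn_integral_cong) (auto simp: indicator_def)
  also have "\<dots> = ennreal (LBINT v:S. \<phi> v)"
    using assms unfolding set_lebesgue_integral_def real_scaleR_def set_integrable_def
    by (intro nn_integral_eq_integral) (auto simp: indicator_def)
  finally show ?thesis .
qed

lemma borel_measurable_on_halfline:
  fixes \<phi> :: "real \<Rightarrow> real"
  assumes "\<And>t. 0 \<le> t \<Longrightarrow> set_integrable lborel {0..t} \<phi>"
  shows "(\<lambda>t. indicator {0..} t * \<phi> t) \<in> borel_measurable borel"
proof (rule borel_measurable_LIMSEQ_real)
  show "(\<lambda>v. indicator {0..real n} v * \<phi> v) \<in> borel_measurable borel" for n
    using assms[of "real n"] unfolding set_integrable_def by (simp add: borel_measurable_integrable)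
  show "(\<lambda>n. indicator {0..real n} t * \<phi> t) \<longlonglongrightarrow> indicator {0..} t * \<phi> t" for t
  proof (rule tendsto_eventually)
    obtain N where N: "t \<le> real N" using real_arch_simple by blast
    show "\<forall>\<^sub>F n in sequentially. indicator {0..real n} t * \<phi> t = indicator {0..} t * \<phi> t"
      using N by (auto simp: eventually_sequentially indicator_def intro!: exI[of _ N])
  qed
qed

text \<open>The function \<open>g = \<mu> e\<^sup>-\<^sup>\<Lambda>\<close> with \<open>\<Lambda>(x) = \<integral>\<^sub>0\<^sup>x \<mu>\<close> is a density of \<open>G = 1 - e\<^sup>-\<^sup>\<Lambda>\<close>. As \<open>\<mu>\<close> is merely
integrable, \<open>\<Lambda>\<close> need not be differentiable everywhere. However, \<open>D = \<integral> g + e\<^sup>-\<^sup>\<Lambda>\<close> satisfies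
\<open>\<bar>D(b) - D(a)\<bar> \<le> (\<Lambda>(b) - \<Lambda>(a))\<^sup>2\<close>, so as a function of the value of \<open>\<Lambda>\<close> it has derivative zero
everywhere and is constant.\<close>

lemma nn_integral_hazard_density:
  fixes \<mu> :: "real \<Rightarrow> real"
  assumes nonneg: "\<And>t. 0 \<le> t \<Longrightarrow> 0 \<le> \<mu> t"
    and int: "\<And>t. 0 \<le> t \<Longrightarrow> set_integrable lborel {0..t} \<mu>"
    and t: "0 \<le> t"
  shows "(\<integral>\<^sup>+v. indicator {0..t} v * ennreal (g \<mu> v) \<partial>lborel) = ennreal (G \<mu> t)"
proof -
  define \<Lambda> where "\<Lambda> x = (LBINT v:{0..x}. \<mu> v)" for x
  have \<Lambda>_0: "\<Lambda> 0 = 0" unfolding \<Lambda>_def set_lebesgue_integral_def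
    by (intro integral_eq_zero_AE) (use AE_lborel_singleton[of "0::real"] in eventually_elim, auto)
  have incr: "\<Lambda> b - \<Lambda> a = (LBINT v:{a<..b}. \<mu> v)" and sub: "set_integrable lborel {a<..b} \<mu>"
    if "0 \<le> a" "a \<le> b" for a b
  proof -
    show s: "set_integrable lborel {a<..b} \<mu>"
      by (rule set_integrable_subset[OF int[of b]]) (use that in auto)
    have "{0..b} = {0..a} \<union> {a<..b}" using that by auto
    then show "\<Lambda> b - \<Lambda> a = (LBINT v:{a<..b}. \<mu> v)"
      unfolding \<Lambda>_def using s int[of a] that by (subst \<open>{0..b} = _\<close>, subst set_integral_Un) auto
  qed
  have \<Lambda>_mono: "\<Lambda> a \<le> \<Lambda> b" if "0 \<le> a" "a \<le> b" for a b
  proof -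
    have "0 \<le> (LBINT v:{a<..b}. \<mu> v)"
      unfolding set_lebesgue_integral_def
      by (intro integral_nonneg_AE AE_I2) (use that nonneg in \<open>auto simp: indicator_def\<close>)
    then show ?thesis using incr[OF that] by simp
  qed
  have \<Lambda>_cont: "continuous_on {0..t} \<Lambda>"
  proof -
    have "\<Lambda> x = integral {0..x} \<mu>" if "x \<in> {0..t}" for x
      unfolding \<Lambda>_def using that int[of x] by (intro set_borel_integral_eq_integral) auto
    moreover have "continuous_on {0..t} (\<lambda>x. integral {0..x} \<mu>)"
      using int[OF t] by (intro indefinite_integral_continuous_1 set_borel_integral_eq_integral)
    ultimately show ?thesis
      using continuous_on_cong[of "{0..t}" "{0..t}" \<Lambda> "\<lambda>x. integral {0..x} \<mu>"] by simp
  qed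
  have meas_mu: "(\<lambda>t. indicator {0..} t * \<mu> t) \<in> borel_measurable borel"
    by (rule borel_measurable_on_halfline) (rule int)
  have meas_\<Lambda>: "\<Lambda> \<in> borel_measurable borel"
  proof (rule borel_measurable_mono)
    show "mono \<Lambda>"
    proof (rule monoI)
      fix a b :: real assume ab: "a \<le> b"
      show "\<Lambda> a \<le> \<Lambda> b"
      proof (cases "0 \<le> a")
        case True
        then show ?thesis using \<Lambda>_mono ab by simp
      next
        case False
        then have "\<Lambda> a = 0" by (simp add: \<Lambda>_def set_lebesgue_integral_def)
        moreover have "0 \<le> \<Lambda> b" unfolding \<Lambda>_def set_lebesgue_integral_def
          by (intro integral_nonneg_AE AE_I2) (use nonneg in \<open>auto simp: indicator_def\<close>)
        ultimately show ?thesis by simp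
      qed
    qed
  qed
  have g_eq: "g \<mu> v = \<mu> v * exp (- \<Lambda> v)" for v
    by (simp add: g_def \<Lambda>_def)
  have int_g: "set_integrable lborel {0..x} (g \<mu>)" if x: "0 \<le> x" for x
  proof -
    have m: "(\<lambda>v. indicator {0..x} v * ((indicator {0..} v * \<mu> v) * exp (- \<Lambda> v))) \<in> borel_measurable borel"
      using meas_mu meas_\<Lambda> by measurable
    have "(\<lambda>v. indicator {0..x} v * ((indicator {0..} v * \<mu> v) * exp (- \<Lambda> v)))
        = (\<lambda>v. indicator {0..x} v * g \<mu> v)"
      by (auto simp: fun_eq_iff g_eq indicator_def)
    with m have m': "(\<lambda>v. indicator {0..x} v * g \<mu> v) \<in> borel_measurable lborel" by simp
    show ?thesis
      unfolding set_integrable_def real_scaleR_def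
    proof (rule Bochner_Integration.integrable_bound[OF int[OF x, unfolded set_integrable_def real_scaleR_def] m'])
      show "AE v in lborel. norm (indicator {0..x} v * g \<mu> v) \<le> norm (indicator {0..x} v * \<mu> v)"
      proof (rule AE_I2)
        fix v
        show "norm (indicator {0..x} v * g \<mu> v) \<le> norm (indicator {0..x} v * \<mu> v)"
        proof (cases "v \<in> {0..x}")
          case True
          then have "exp (- \<Lambda> v) \<le> 1" using \<Lambda>_mono[of 0 v] \<Lambda>_0 by auto
          then have "\<bar>\<mu> v\<bar> * exp (- \<Lambda> v) \<le> \<bar>\<mu> v\<bar> * 1" by (intro mult_left_mono) auto
          then show ?thesis using True by (simp add: g_eq abs_mult)
        qed simp
      qed
    qed
  qed
  define D where "D x = (LBINT v:{0..x}. g \<mu> v) + exp (- \<Lambda> x)" for x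
  have D_quad: "\<bar>D b - D a\<bar> \<le> (\<Lambda> b - \<Lambda> a)\<^sup>2" if ab: "0 \<le> a" "a \<le> b" for a b
  proof -
    have s: "set_integrable lborel {a<..b} (g \<mu>)"
      by (rule set_integrable_subset[OF int_g[of b]]) (use that in auto)
    have "{0..b} = {0..a} \<union> {a<..b}" using that by auto
    then have I: "(LBINT v:{0..b}. g \<mu> v) - (LBINT v:{0..a}. g \<mu> v) = (LBINT v:{a<..b}. g \<mu> v)"
      using s int_g[of a] that by (subst \<open>{0..b} = _\<close>, subst set_integral_Un) auto
    have up: "(LBINT v:{a<..b}. g \<mu> v) \<le> (LBINT v:{a<..b}. exp (- \<Lambda> a) * \<mu> v)"
      using sub[OF ab] that by (intro set_integral_mono s) (auto simp: g_eq mult.commute intro!: mult_left_mono nonneg \<Lambda>_mono)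
    have lo: "(LBINT v:{a<..b}. exp (- \<Lambda> b) * \<mu> v) \<le> (LBINT v:{a<..b}. g \<mu> v)"
      using sub[OF ab] that by (intro set_integral_mono s) (auto simp: g_eq mult.commute intro!: mult_left_mono nonneg \<Lambda>_mono)
    define x where "x = \<Lambda> b - \<Lambda> a"
    have x: "0 \<le> x" using \<Lambda>_mono[OF ab] by (simp add: x_def)
    \<comment> \<open>on \<open>(a, b]\<close> the factor \<open>e\<^sup>-\<^sup>\<Lambda>\<close> lies between \<open>c e\<^sup>-\<^sup>x\<close> and \<open>c\<close>\<close>
    define c where "c = exp (- \<Lambda> a)"
    have c: "0 \<le> c" "c \<le> 1" using \<Lambda>_mono[of 0 a] \<Lambda>_0 ab by (auto simp: c_def)
    have eb: "exp (- \<Lambda> b) = c * exp (- x)" by (simp add: c_def x_def flip: exp_add)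
    have "D b - D a = (LBINT v:{a<..b}. g \<mu> v) + c * exp (- x) - c"
      using I by (simp add: D_def eb c_def)
    moreover have "(LBINT v:{a<..b}. g \<mu> v) \<le> c * x"
      using up incr[OF ab] by (simp add: c_def x_def)
    moreover have "c * exp (- x) * x \<le> (LBINT v:{a<..b}. g \<mu> v)"
      using lo incr[OF ab] by (simp add: eb x_def)
    ultimately have "D b - D a \<le> c * (x + exp (- x) - 1)" "c * (exp (- x) * (1 + x) - 1) \<le> D b - D a"
      by (auto simp: algebra_simps)
    moreover have q1: "x + exp (- x) - 1 \<le> x\<^sup>2"
    proof -
      have "exp (- x) * (1 + x) \<le> exp (- x) * exp x" by (intro mult_left_mono) (auto simp: exp_ge_add_one_self)
      then have e: "exp (- x) * (1 + x) \<le> 1" by (simp flip: exp_add)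
      have "1 \<le> (1 - x + x\<^sup>2) * (1 + x)" using x by (simp add: algebra_simps power2_eq_square)
      with e have "exp (- x) * (1 + x) \<le> (1 - x + x\<^sup>2) * (1 + x)" by linarith
      then have "exp (- x) \<le> 1 - x + x\<^sup>2" using x by (simp add: mult_le_cancel_right)
      then show ?thesis by simp
    qed
    moreover have q2: "- x\<^sup>2 \<le> exp (- x) * (1 + x) - 1"
    proof -
      have "(1 - x) * (1 + x) \<le> exp (- x) * (1 + x)"
        using x exp_ge_add_one_self[of "- x"] by (intro mult_right_mono) auto
      then show ?thesis by (simp add: algebra_simps power2_eq_square)
    qed
    moreover have "c * (x + exp (- x) - 1) \<le> c * x\<^sup>2" "c * (- x\<^sup>2) \<le> c * (exp (- x) * (1 + x) - 1)"
      using mult_left_mono[OF q1 c(1)] mult_left_mono[OF q2 c(1)] by simp_all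
    moreover have "c * x\<^sup>2 \<le> 1 * x\<^sup>2" using c by (intro mult_right_mono) auto
    ultimately show ?thesis unfolding x_def[symmetric] by (auto simp: abs_le_iff)
  qed
  \<comment> \<open>reparametrize by the value of \<open>\<Lambda>\<close>; any preimage will do, because \<open>D\<close> agrees where \<open>\<Lambda>\<close> does\<close>
  define L where "L = \<Lambda> t"
  have "\<forall>u\<in>{0..L}. \<exists>s\<in>{0..t}. \<Lambda> s = u"
    using IVT'[of \<Lambda> 0 _ t] \<Lambda>_0 t \<Lambda>_cont by (fastforce simp: L_def)
  then obtain s where s: "\<And>u. u \<in> {0..L} \<Longrightarrow> s u \<in> {0..t} \<and> \<Lambda> (s u) = u" by metis
  have Ds: "\<bar>D (s u) - D (s v)\<bar> \<le> (u - v)\<^sup>2" if "u \<in> {0..L}" "v \<in> {0..L}" for u v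
  proof (cases "s v \<le> s u")
    case True
    then show ?thesis using D_quad[of "s v" "s u"] s that by auto
  next
    case False
    then show ?thesis using D_quad[of "s u" "s v"] s that
      by (auto simp: abs_minus_commute power2_commute)
  qed
  have L: "0 \<le> L" using \<Lambda>_mono[of 0 t] t \<Lambda>_0 by (simp add: L_def)
  have "\<exists>c. \<forall>u\<in>{0..L}. D (s u) = c"
  proof (rule has_field_derivative_zero_constant)
    fix u assume u: "u \<in> {0..L}"
    have "((\<lambda>v. (D (s v) - D (s u)) / (v - u)) \<longlongrightarrow> 0) (at u within {0..L})"
    proof (rule Lim_null_comparison)
      show "\<forall>\<^sub>F v in at u within {0..L}. norm ((D (s v) - D (s u)) / (v - u)) \<le> \<bar>v - u\<bar>"
        unfolding eventually_at_filter
      proof (intro always_eventually allI impI)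
        fix v assume v: "v \<noteq> u" "v \<in> {0..L}"
        have "\<bar>D (s v) - D (s u)\<bar> \<le> \<bar>v - u\<bar> * \<bar>v - u\<bar>"
          using Ds[OF v(2) u] by (simp add: power2_eq_square flip: abs_mult)
        then show "norm ((D (s v) - D (s u)) / (v - u)) \<le> \<bar>v - u\<bar>"
          using v by (simp add: divide_le_eq)
      qed
      show "((\<lambda>v. \<bar>v - u\<bar>) \<longlongrightarrow> 0) (at u within {0..L})"
        by (rule tendsto_eq_intros tendsto_ident_at refl | simp)+
    qed
    then show "((\<lambda>v. D (s v)) has_field_derivative 0) (at u within {0..L})"
      by (simp add: has_field_derivative_iff)
  qed simp
  then have "D (s L) = D (s 0)" using L by auto
  moreover have "D (s L) = D t"
  proof -
    have "\<bar>D t - D (s L)\<bar> \<le> (\<Lambda> t - \<Lambda> (s L))\<^sup>2" using s[of L] L by (intro D_quad) auto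
    then show ?thesis using s[of L] L by (simp add: L_def)
  qed
  moreover have "D (s 0) = D 0"
  proof -
    have "\<bar>D (s 0) - D 0\<bar> \<le> (\<Lambda> (s 0) - \<Lambda> 0)\<^sup>2" using s[of 0] L by (intro D_quad) auto
    then show ?thesis using s[of 0] L by (simp add: \<Lambda>_0)
  qed
  moreover have "(LBINT v:{0..0}. g \<mu> v) = 0"
    unfolding set_lebesgue_integral_def
    by (intro integral_eq_zero_AE) (use AE_lborel_singleton[of "0::real"] in eventually_elim, auto)
  ultimately have "(LBINT v:{0..t}. g \<mu> v) = G \<mu> t"
    by (simp add: D_def \<Lambda>_0) (simp add: G_def \<Lambda>_def)
  moreover have "(\<integral>\<^sup>+v. indicator {0..t} v * ennreal (g \<mu> v) \<partial>lborel) = ennreal (LBINT v:{0..t}. g \<mu> v)"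
    using nonneg by (intro nn_integral_set_integrable int_g t) (auto simp: g_eq)
  ultimately show ?thesis by simp
qed

definition halfline :: "(real \<Rightarrow> real) \<Rightarrow> real \<Rightarrow> ennreal" where
  "halfline \<phi> t = indicator {0..} t * ennreal (\<phi> t)"

lemma halfline_pos [simp]: "0 \<le> t \<Longrightarrow> halfline \<phi> t = ennreal (\<phi> t)"
  and halfline_neg [simp]: "t < 0 \<Longrightarrow> halfline \<phi> t = 0"
  by (simp_all add: halfline_def)

lemma causal_halfline [simp]: "causal (halfline \<phi>)"
  by (simp add: causal_def)

lemma measurable_halfline:
  assumes "(\<lambda>t. indicator {0..} t * \<phi> t) \<in> borel_measurable borel"
  shows "halfline \<phi> \<in> borel_measurable borel"
proof -
  have "halfline \<phi> = (\<lambda>t. ennreal (indicator {0..} t * \<phi> t))"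
    by (auto simp: halfline_def fun_eq_iff indicator_def)
  then show ?thesis using assms by simp
qed

lemma indicator_times_cong:
  "(v \<in> S \<Longrightarrow> a = b) \<Longrightarrow> indicator S v * a = indicator S v * (b :: ennreal)"
  by (auto simp: indicator_def)

text \<open>Integration by parts: split the square \<open>[0, x]\<^sup>2\<close> along its diagonal, a null set.\<close>

lemma nn_integral_by_parts:
  fixes a b :: "real \<Rightarrow> ennreal"
  assumes [measurable]: "a \<in> borel_measurable borel" "b \<in> borel_measurable borel"
  shows "(\<integral>\<^sup>+v. indicator {0..x} v * a v \<partial>lborel) * (\<integral>\<^sup>+v. indicator {0..x} v * b v \<partial>lborel) =
    (\<integral>\<^sup>+v. indicator {0..x} v * (a v * (\<integral>\<^sup>+u. indicator {0..v} u * b u \<partial>lborel)) \<partial>lborel) +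
    (\<integral>\<^sup>+v. indicator {0..x} v * (b v * (\<integral>\<^sup>+u. indicator {0..v} u * a u \<partial>lborel)) \<partial>lborel)"
    (is "?A * ?B = ?L + ?R")
proof -
  define w :: "real \<Rightarrow> real \<Rightarrow> ennreal" where
    "w v u = (if 0 \<le> v \<and> v \<le> x \<and> 0 \<le> u \<and> u \<le> v then 1 else 0)" for v u
  have [measurable]: "(\<lambda>z. w (p z) (q z)) \<in> borel_measurable N"
    if [measurable]: "p \<in> borel_measurable N" "q \<in> borel_measurable N" for p q and N :: "'z measure"
    unfolding w_def by measurable
  have "?A * ?B = (\<integral>\<^sup>+v. (\<integral>\<^sup>+u. indicator {0..x} v * a v * (indicator {0..x} u * b u) \<partial>lborel) \<partial>lborel)"
    by (simp add: nn_integral_cmult nn_integral_multc)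
  also have "\<dots> = (\<integral>\<^sup>+v. (\<integral>\<^sup>+u. w v u * (a v * b u) + w u v * (a v * b u) \<partial>lborel) \<partial>lborel)"
  proof (rule nn_integral_cong, rule nn_integral_cong_AE)
    fix v :: real
    have "AE u in lborel. u \<noteq> v" by (rule AE_lborel_singleton)
    then show "AE u in lborel. indicator {0..x} v * a v * (indicator {0..x} u * b u) =
        w v u * (a v * b u) + w u v * (a v * b u)"
      by eventually_elim (auto simp: w_def indicator_def)
  qed
  also have "\<dots> = (\<integral>\<^sup>+v. (\<integral>\<^sup>+u. w v u * (a v * b u) \<partial>lborel) \<partial>lborel) + (\<integral>\<^sup>+v. (\<integral>\<^sup>+u. w u v * (a v * b u) \<partial>lborel) \<partial>lborel)"
    by (simp add: nn_integral_add)
  also have "(\<integral>\<^sup>+v. (\<integral>\<^sup>+u. w v u * (a v * b u) \<partial>lborel) \<partial>lborel) = ?L"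
  proof (rule nn_integral_cong)
    fix v :: real
    have "(\<integral>\<^sup>+u. w v u * (a v * b u) \<partial>lborel) = (\<integral>\<^sup>+u. indicator {0..x} v * a v * (indicator {0..v} u * b u) \<partial>lborel)"
      by (intro nn_integral_cong) (auto simp: w_def indicator_def)
    then show "(\<integral>\<^sup>+u. w v u * (a v * b u) \<partial>lborel) =
        indicator {0..x} v * (a v * (\<integral>\<^sup>+u. indicator {0..v} u * b u \<partial>lborel))"
      by (simp add: nn_integral_cmult mult.assoc)
  qed
  also have "(\<integral>\<^sup>+v. (\<integral>\<^sup>+u. w u v * (a v * b u) \<partial>lborel) \<partial>lborel) = (\<integral>\<^sup>+u. (\<integral>\<^sup>+v. w u v * (a v * b u) \<partial>lborel) \<partial>lborel)"
    by (rule lborel_pair.Fubini') measurable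
  also have "\<dots> = ?R"
  proof (rule nn_integral_cong)
    fix v :: real
    have "(\<integral>\<^sup>+u. w v u * (a u * b v) \<partial>lborel) = (\<integral>\<^sup>+u. indicator {0..x} v * b v * (indicator {0..v} u * a u) \<partial>lborel)"
      by (intro nn_integral_cong) (auto simp: w_def indicator_def mult.commute)
    then show "(\<integral>\<^sup>+u. w v u * (a u * b v) \<partial>lborel) =
        indicator {0..x} v * (b v * (\<integral>\<^sup>+u. indicator {0..v} u * a u \<partial>lborel))"
      by (simp add: nn_integral_cmult mult.assoc)
  qed
  finally show ?thesis .
qed

lemma vimage_algebra_subset: "A \<in> sets (vimage_algebra \<Omega> Z N) \<Longrightarrow> A \<subseteq> \<Omega>"
  using sets.sets_into_space[of A "vimage_algebra \<Omega> Z N"] by simp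

lemma measurable_sigma_generated:
  assumes "sets (vimage_algebra \<Omega> Z N) \<subseteq> E" "E \<subseteq> Pow \<Omega>" "Z \<in> \<Omega> \<rightarrow> space N"
  shows "Z \<in> measurable (sigma \<Omega> E) N"
proof (rule measurableI)
  fix A assume "A \<in> sets N"
  then have "Z -` A \<inter> \<Omega> \<in> sets (vimage_algebra \<Omega> Z N)" by (rule in_vimage_algebra)
  with assms show "Z -` A \<inter> space (sigma \<Omega> E) \<in> sets (sigma \<Omega> E)"
    by (auto simp: space_measure_of_conv sets_measure_of_conv)
qed (use assms in \<open>auto simp: space_measure_of_conv\<close>)

context R2_Hawkes
begin

section \<open>Distribution of a renewal cycle\<close>

lemma measurable_Y: "1 \<le> i \<Longrightarrow> Y i \<in> borel_measurable M"
  using distributed_measurable[OF Y_density] by simp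

lemma measurable_f [measurable]: "f \<in> borel_measurable borel"
  using distributed_real_measurable[OF _ Y_density[of 1]] f_nonneg by simp

lemma F_prob: "1 \<le> i \<Longrightarrow> F x = prob {\<omega>\<in>space M. Y i \<omega> \<le> x}"
  using Y_cdf[of i] measurable_Y[of i]
  by (auto simp: cdf_def measure_distr vimage_def Int_def conj_commute dest!: sym[of _ F])

lemma F_bounds: "0 \<le> F x" "F x \<le> 1" "mono F"
proof -
  show "0 \<le> F x" "F x \<le> 1" by (simp_all add: F_prob[of 1])
  show "mono F"
    using measurable_Y[of 1]
    by (auto intro!: monoI finite_measure_mono simp: F_prob[of 1])
qed

lemma measurable_F [measurable]: "F \<in> borel_measurable borel"
  using F_bounds(3) by (rule borel_measurable_mono)

lemma nn_integral_f: "0 \<le> x \<Longrightarrow> (\<integral>\<^sup>+v. indicator {0..x} v * ennreal (f v) \<partial>lborel) = ennreal (F x)"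
proof -
  have "(\<integral>\<^sup>+v. indicator {0..x} v * ennreal (f v) \<partial>lborel) = emeasure M (Y 1 -` {0..x} \<inter> space M)"
    using distributed_emeasure[OF Y_density[of 1], of "{0..x}"] by (simp add: mult.commute)
  also have "Y 1 -` {0..x} \<inter> space M = {\<omega>\<in>space M. Y 1 \<omega> \<le> x}"
    using Y_pos[OF order.refl, THEN less_imp_le] by auto
  finally show ?thesis by (simp add: F_prob[of 1] emeasure_eq_measure)
qed

lemma nn_integral_g: "0 \<le> x \<Longrightarrow> (\<integral>\<^sup>+v. indicator {0..x} v * ennreal (g \<mu> v) \<partial>lborel) = ennreal (G \<mu> x)"
  using mu_pos mu_integrable by (intro nn_integral_hazard_density) (auto intro: less_imp_le)

lemma measurable_wait: "1 \<le> i \<Longrightarrow> wait Y T i \<in> borel_measurable M"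
  using wait_indep_Y[of i] by (simp add: indep_var_eq)

lemma G_neg: "t < 0 \<Longrightarrow> G \<mu> t = 0"
  by (simp add: G_def set_lebesgue_integral_def)

lemma G_bounds: "0 \<le> G \<mu> t" "G \<mu> t < 1" "mono (G \<mu>)"
proof -
  have nn: "0 \<le> G \<mu> t" for t
    by (cases "0 \<le> t") (simp_all add: G_neg wait_cdf[of 1, symmetric])
  show "0 \<le> G \<mu> t" by (rule nn)
  show "G \<mu> t < 1" by (simp add: G_def)
  show "mono (G \<mu>)"
  proof (rule monoI)
    fix s t :: real assume "s \<le> t"
    show "G \<mu> s \<le> G \<mu> t"
    proof (cases "s < 0")
      case True then show ?thesis using nn by (simp add: G_neg)
    next
      case False
      with \<open>s \<le> t\<close> measurable_wait[of 1] show ?thesis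
        by (auto intro!: finite_measure_mono intro: order.trans simp: wait_cdf[of 1, symmetric])
    qed
  qed
qed

lemma measurable_G [measurable]: "G \<mu> \<in> borel_measurable borel"
  using G_bounds(3) by (rule borel_measurable_mono)

lemma measurable_mu [measurable]: "halfline \<mu> \<in> borel_measurable borel"
  by (intro measurable_halfline borel_measurable_on_halfline mu_integrable)

lemma measurable_h_real [measurable]: "(\<lambda>t. indicator {0..} t * h t) \<in> borel_measurable borel"
  using h_integrable unfolding set_integrable_def by (auto dest: borel_measurable_integrable)

lemma measurable_h [measurable]: "halfline (\<lambda>t. \<eta> * h t) \<in> borel_measurable borel"
proof (rule measurable_halfline)
  have "(\<lambda>t. \<eta> * (indicator {0..} t * h t)) \<in> borel_measurable borel" by measurable
  then show "(\<lambda>t. indicator {0..} t * (\<eta> * h t)) \<in> borel_measurable borel"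
    by (simp add: mult.left_commute)
qed

lemma g_eq: "g \<mu> t = \<mu> t * (1 - G \<mu> t)"
  by (simp add: g_def G_def)

lemma g_pos: "0 \<le> t \<Longrightarrow> 0 < g \<mu> t"
  using mu_pos[of t] G_bounds(2)[of t] by (simp add: g_eq)

lemma measurable_g [measurable]: "halfline (g \<mu>) \<in> borel_measurable borel"
proof -
  have "halfline (g \<mu>) = (\<lambda>t. halfline \<mu> t * ennreal (1 - G \<mu> t))"
    using mu_pos G_bounds(2)
    by (auto simp: halfline_def fun_eq_iff indicator_def g_eq ennreal_mult less_imp_le)
  then show ?thesis by simp
qed

lemma Fg_nonneg: "0 \<le> t \<Longrightarrow> 0 \<le> Fg \<mu> F t"
  using g_pos[of t] F_bounds(2)[of t] by (simp add: Fg_def)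

lemma Gf_nonneg: "0 \<le> Gf \<mu> f t"
  using f_nonneg[of t] G_bounds(2)[of t] by (simp add: Gf_def)

lemma n2_nonneg: "0 \<le> t \<Longrightarrow> 0 \<le> n2 \<mu> F f t"
  using Fg_nonneg[of t] Gf_nonneg[of t] by (simp add: n2_def)

lemma halfline_Fg: "halfline (Fg \<mu> F) t = halfline \<mu> t * ennreal ((1 - F t) * (1 - G \<mu> t))"
  using mu_pos[of t] G_bounds(2)[of t] F_bounds(2)[of t]
  by (cases "0 \<le> t") (auto simp: Fg_def g_eq mult_ac simp flip: ennreal_mult)

lemma measurable_Fg [measurable]: "halfline (Fg \<mu> F) \<in> borel_measurable borel"
  by (subst measurable_cong[OF halfline_Fg]) measurable

lemma measurable_Gf [measurable]: "Gf \<mu> f \<in> borel_measurable borel"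
  unfolding Gf_def by measurable

lemma measurable_halfline_Gf [measurable]: "halfline (Gf \<mu> f) \<in> borel_measurable borel"
  by (intro measurable_halfline) measurable

lemma halfline_n2: "halfline (n2 \<mu> F f) t = halfline (Gf \<mu> f) t + halfline (Fg \<mu> F) t"
  using Fg_nonneg[of t] Gf_nonneg[of t] by (cases "0 \<le> t") (auto simp: n2_def)

lemma measurable_n2 [measurable]: "halfline (n2 \<mu> F f) \<in> borel_measurable borel"
  by (subst measurable_cong[OF halfline_n2]) measurable

text \<open>The density \<open>n\<^sub>2 = (1 - G) f + (1 - F) g\<close> is the derivative of \<open>1 - (1 - F)(1 - G) = F + G - FG\<close>:
adding \<open>Gf + Fg\<close>, whose integral is \<open>FG\<close> by parts, gives \<open>f + g\<close>.\<close>

lemma nn_integral_n2: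
  assumes x: "0 \<le> x"
  shows "(\<integral>\<^sup>+v. indicator {0..x} v * halfline (n2 \<mu> F f) v \<partial>lborel)
    = ennreal (1 - (1 - F x) * (1 - G \<mu> x))"
proof -
  let ?f = "\<lambda>v. ennreal (f v)" and ?g = "halfline (g \<mu>)"
  let ?I = "\<lambda>a. \<integral>\<^sup>+v. indicator {0..x} v * a v \<partial>lborel"
  have If: "(\<integral>\<^sup>+v. indicator {0..y} v * ?f v \<partial>lborel) = ennreal (F y)" if "0 \<le> y" for y
    using nn_integral_f[OF that] .
  have Ig: "(\<integral>\<^sup>+v. indicator {0..y} v * ?g v \<partial>lborel) = ennreal (G \<mu> y)" if "0 \<le> y" for y
  proof -
    have "(\<integral>\<^sup>+v. indicator {0..y} v * ?g v \<partial>lborel) = (\<integral>\<^sup>+v. indicator {0..y} v * ennreal (g \<mu> v) \<partial>lborel)"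
      by (intro nn_integral_cong) (auto simp: indicator_def)
    then show ?thesis using nn_integral_g[OF that] by simp
  qed
  have "?I (halfline (n2 \<mu> F f)) + (?I (\<lambda>v. ?f v * ennreal (G \<mu> v)) + ?I (\<lambda>v. ?g v * ennreal (F v)))
      = ?I (\<lambda>v. halfline (n2 \<mu> F f) v + (?f v * ennreal (G \<mu> v) + ?g v * ennreal (F v)))"
    by (simp add: distrib_left nn_integral_add)
  also have "\<dots> = ?I (\<lambda>v. ?f v + ?g v)"
  proof (rule nn_integral_cong)
    fix v
    show "indicator {0..x} v * (halfline (n2 \<mu> F f) v + (?f v * ennreal (G \<mu> v) + ?g v * ennreal (F v)))
      = indicator {0..x} v * (?f v + ?g v)"
    proof (cases "v \<in> {0..x}")
      case True
      then have "halfline (n2 \<mu> F f) v + (?f v * ennreal (G \<mu> v) + ?g v * ennreal (F v))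
          = ennreal (n2 \<mu> F f v + (f v * G \<mu> v + g \<mu> v * F v))"
        using f_nonneg[of v] g_pos[of v] n2_nonneg[of v] F_bounds(1)[of v] G_bounds(1)[of v]
        by (simp add: ennreal_mult)
      also have "n2 \<mu> F f v + (f v * G \<mu> v + g \<mu> v * F v) = f v + g \<mu> v"
        by (simp add: n2_def Gf_def Fg_def algebra_simps)
      finally show ?thesis using True f_nonneg[of v] g_pos[of v] by simp
    qed simp
  qed
  also have "\<dots> = ennreal (F x) + ennreal (G \<mu> x)"
    using If[OF x] Ig[OF x] by (simp add: distrib_left nn_integral_add)
  also have "?I (\<lambda>v. ?f v * ennreal (G \<mu> v)) + ?I (\<lambda>v. ?g v * ennreal (F v)) = ennreal (F x) * ennreal (G \<mu> x)"
  proof -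
    have "?I (\<lambda>v. ?f v * ennreal (G \<mu> v)) = ?I (\<lambda>v. ?f v * (\<integral>\<^sup>+u. indicator {0..v} u * ?g u \<partial>lborel))"
      "?I (\<lambda>v. ?g v * ennreal (F v)) = ?I (\<lambda>v. ?g v * (\<integral>\<^sup>+u. indicator {0..v} u * ?f u \<partial>lborel))"
      by (intro nn_integral_cong indicator_times_cong; simp add: If Ig)+
    then show ?thesis
      using nn_integral_by_parts[of ?f ?g x] If[OF x] Ig[OF x] by simp
  qed
  finally have "?I (halfline (n2 \<mu> F f)) + ennreal (F x * G \<mu> x) = ennreal (F x + G \<mu> x)"
    using F_bounds(1)[of x] G_bounds(1)[of x] by (simp add: ennreal_mult)
  then have "?I (halfline (n2 \<mu> F f)) = ennreal (F x + G \<mu> x) - ennreal (F x * G \<mu> x)"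
    by (metis ennreal_add_diff_cancel_right ennreal_neq_top)
  then show ?thesis
    using F_bounds(1)[of x] G_bounds(1)[of x] by (simp add: ennreal_minus algebra_simps del: ennreal_plus)
qed

section \<open>The renewal times\<close>

lemma V_0: "V Y T 0 = (\<lambda>_. 0)"
  by (simp add: fun_eq_iff)

lemma V_Suc_fun: "V Y T (Suc i) =
    (\<lambda>\<omega>. real_of_ereal (min (ereal (Y (Suc i) \<omega> + V Y T i \<omega>)) (T (Suc i) \<omega>)))"
  by (simp add: fun_eq_iff)

text \<open>The length of the cycle from \<open>V\<^sub>i\<close> to \<open>V\<^sub>i\<^sub>+\<^sub>1\<close>. It is finite even if the waiting time is not.\<close>

definition gap :: "nat \<Rightarrow> 'a \<Rightarrow> real" where
  "gap i \<omega> = real_of_ereal (min (ereal (Y (Suc i) \<omega>)) (wait Y T (Suc i) \<omega>))"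

lemma wait_pos: "\<omega> \<in> space M \<Longrightarrow> 0 < wait Y T (Suc i) \<omega>"
  using T_after[of "Suc i" \<omega>] by (simp add: wait_def ereal_less_minus)

lemma V_Suc: 
  assumes "\<omega> \<in> space M"
  shows "V Y T (Suc i) \<omega> = gap i \<omega> + V Y T i \<omega>"
  using T_after[of "Suc i" \<omega>] assms
  by (cases "T (Suc i) \<omega>") (auto simp: gap_def wait_def min_def)

lemma less_gap_iff: "\<omega> \<in> space M \<Longrightarrow> x < gap i \<omega> \<longleftrightarrow> x < Y (Suc i) \<omega> \<and> ereal x < wait Y T (Suc i) \<omega>"
  using wait_pos[of \<omega> i]
  by (cases "wait Y T (Suc i) \<omega>") (auto simp: gap_def min_def)

lemma gap_pos: "\<omega> \<in> space M \<Longrightarrow> 0 < gap i \<omega>"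
  using less_gap_iff[of \<omega> 0 i] wait_pos[of \<omega> i] Y_pos[of "Suc i" \<omega>] by (simp add: zero_ereal_def)

lemma measurable_gap [measurable]: "gap i \<in> borel_measurable M"
  using measurable_Y[of "Suc i"] measurable_wait[of "Suc i"] unfolding gap_def by measurable

lemma space_past [simp]: "space (past M Y T P i) = space M"
  by (simp add: past_def space_measure_of_conv)

lemma measurable_past:
  assumes "1 \<le> j" "j \<le> i"
  shows "Y j \<in> borel_measurable (past M Y T P i)" "T j \<in> borel_measurable (past M Y T P i)"
  unfolding past_def using assms
  by (auto intro!: measurable_sigma_generated dest: vimage_algebra_subset)

lemma measurable_V_past:
  "j \<le> i \<Longrightarrow> V Y T j \<in> borel_measurable (past M Y T P i)"
proof (induction j)
  case (Suc j)
  have [measurable]: "V Y T j \<in> borel_measurable (past M Y T P i)" using Suc by simp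
  have [measurable]: "Y (Suc j) \<in> borel_measurable (past M Y T P i)"
    "T (Suc j) \<in> borel_measurable (past M Y T P i)"
    using measurable_past[of "Suc j" i] Suc.prems by auto
  show ?case unfolding V_Suc_fun by measurable
qed (simp add: V_0)

lemma measurable_V [measurable]: "V Y T i \<in> borel_measurable M"
proof (induction i)
  case (Suc i)
  have "(\<lambda>\<omega>. gap i \<omega> + V Y T i \<omega>) \<in> borel_measurable M" using Suc by measurable
  then show ?case by (subst measurable_cong[OF V_Suc])
qed (simp add: V_0)

lemma emeasure_gap_greater:
  assumes "0 \<le> x"
  shows "emeasure M {\<omega>\<in>space M. x < gap i \<omega>} = ennreal ((1 - F x) * (1 - G \<mu> x))"
proof -
  note [measurable] = measurable_Y[of "Suc i"] measurable_wait[of "Suc i"]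
  have "prob {\<omega>\<in>space M. x < gap i \<omega>} = prob (((\<lambda>\<omega>. ereal (Y (Suc i) \<omega>)) -` {ereal x<..} \<inter> space M) \<inter> (wait Y T (Suc i) -` {ereal x<..} \<inter> space M))"
    by (intro arg_cong[where f=prob]) (auto simp: less_gap_iff)
  also have "\<dots> = prob ((\<lambda>\<omega>. ereal (Y (Suc i) \<omega>)) -` {ereal x<..} \<inter> space M) * prob (wait Y T (Suc i) -` {ereal x<..} \<inter> space M)"
  proof (rule indep_setD)
    show "indep_set (sigma_sets (space M) {(\<lambda>\<omega>. ereal (Y (Suc i) \<omega>)) -` A \<inter> space M |A. A \<in> sets borel})
        (sigma_sets (space M) {wait Y T (Suc i) -` A \<inter> space M |A. A \<in> sets borel})"
      using wait_indep_Y[of "Suc i"] by (simp add: indep_var_eq)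
  qed (rule sigma_sets.Basic, intro CollectI exI[of _ "{ereal x<..}"], simp)+
  also have "prob ((\<lambda>\<omega>. ereal (Y (Suc i) \<omega>)) -` {ereal x<..} \<inter> space M) = 1 - F x"
    using prob_compl[of "{\<omega>\<in>space M. Y (Suc i) \<omega> \<le> x}"]
    by (auto simp: F_prob[of "Suc i"] set_diff_eq not_le vimage_def Int_def conj_commute cong: conj_cong)
  also have "prob (wait Y T (Suc i) -` {ereal x<..} \<inter> space M) = 1 - G \<mu> x"
    using prob_compl[of "{\<omega>\<in>space M. wait Y T (Suc i) \<omega> \<le> ereal x}"] assms
    by (auto simp: wait_cdf set_diff_eq not_le vimage_def Int_def conj_commute cong: conj_cong)
  finally show ?thesis by (simp add: emeasure_eq_measure)
qed

lemma distr_gap: "distr M borel (gap i) = density lborel (halfline (n2 \<mu> F f))"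
proof (rule measure_eqI_generator_eq)
  let ?E = "range (\<lambda>a::real. {..a})"
  show "Int_stable ?E" by (auto simp: Int_stable_def min_def)
  show "sets (distr M borel (gap i)) = sigma_sets UNIV ?E"
    "sets (density lborel (halfline (n2 \<mu> F f))) = sigma_sets UNIV ?E"
    by (simp_all add: borel_eq_atMost)
  show "range (\<lambda>n. {..real n}) \<subseteq> ?E" "(\<Union>n. {..real n}) = UNIV"
    by (auto intro: real_arch_simple)
  show "emeasure (distr M borel (gap i)) {..real n} \<noteq> \<infinity>" for n
    by (simp add: emeasure_distr)
  fix A assume "A \<in> ?E"
  then obtain x where A: "A = {..x}" by auto
  have "emeasure M {\<omega>\<in>space M. gap i \<omega> \<le> x} = (\<integral>\<^sup>+v. halfline (n2 \<mu> F f) v * indicator {..x} v \<partial>lborel)"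
  proof (cases "0 \<le> x")
    case True
    have eq: "{\<omega>\<in>space M. gap i \<omega> \<le> x} = space M - {\<omega>\<in>space M. x < gap i \<omega>}" by auto
    then have "emeasure M {\<omega>\<in>space M. gap i \<omega> \<le> x} = 1 - ennreal ((1 - F x) * (1 - G \<mu> x))"
      using emeasure_gap_greater[OF True, of i]
      by (subst eq, subst emeasure_compl) (auto simp: emeasure_space_1)
    also have "\<dots> = ennreal (1 - (1 - F x) * (1 - G \<mu> x))"
      using F_bounds(2)[of x] G_bounds(2)[of x]
      by (subst ennreal_1[symmetric], subst ennreal_minus) auto
    also have "\<dots> = (\<integral>\<^sup>+v. indicator {0..x} v * halfline (n2 \<mu> F f) v \<partial>lborel)"
      using nn_integral_n2[OF True] ..
    also have "\<dots> = (\<integral>\<^sup>+v. halfline (n2 \<mu> F f) v * indicator {..x} v \<partial>lborel)"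
      by (intro nn_integral_cong) (auto simp: halfline_def indicator_def)
    finally show ?thesis .
  next
    case False
    then have "{\<omega>\<in>space M. gap i \<omega> \<le> x} = {}"
      using gap_pos[of _ i] by (force simp: not_le)
    moreover have "halfline (n2 \<mu> F f) v * indicator {..x} v = 0" for v
      using False by (auto simp: halfline_def indicator_def)
    ultimately show ?thesis by (simp only: emeasure_empty nn_integral_const mult_zero_left)
  qed
  then show "emeasure (distr M borel (gap i)) A = emeasure (density lborel (halfline (n2 \<mu> F f))) A"
    by (simp add: A emeasure_distr emeasure_density vimage_def Int_def conj_commute)
qed auto

lemma nn_laplace_n2: "nn_laplace \<sigma> (halfline (n2 \<mu> F f)) = (\<integral>\<^sup>+\<omega>. ennreal (exp (- (\<sigma> * gap i \<omega>))) \<partial>M)"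
proof -
  have "(\<integral>\<^sup>+\<omega>. ennreal (exp (- (\<sigma> * gap i \<omega>))) \<partial>M) = (\<integral>\<^sup>+x. ennreal (exp (- (\<sigma> * x))) \<partial>distr M borel (gap i))"
    by (simp add: nn_integral_distr)
  then show ?thesis
    by (simp add: distr_gap nn_integral_density nn_laplace_def mult.commute)
qed

text \<open>The transform of \<open>n\<^sub>2\<close> is the mean of \<open>exp (- \<sigma> gap)\<close>, and cycles have positive length.\<close>

lemma nn_laplace_n2_less_1:
  assumes "0 < \<sigma>"
  shows "nn_laplace \<sigma> (halfline (n2 \<mu> F f)) < 1"
proof -
  have le: "exp (- (\<sigma> * gap 0 \<omega>)) < 1" if "\<omega> \<in> space M" for \<omega>
    using assms gap_pos[OF that, of 0] by simp
  have "(\<integral>\<^sup>+\<omega>. ennreal (exp (- (\<sigma> * gap 0 \<omega>))) \<partial>M) < (\<integral>\<^sup>+\<omega>. 1 \<partial>M)"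
  proof (rule nn_integral_less)
    have *: "(\<integral>\<^sup>+\<omega>. ennreal (exp (- (\<sigma> * gap 0 \<omega>))) \<partial>M) \<le> (\<integral>\<^sup>+\<omega>. 1 \<partial>M)"
      using le by (intro nn_integral_mono) (auto simp: ennreal_le_1 less_imp_le)
    then show "(\<integral>\<^sup>+\<omega>. ennreal (exp (- (\<sigma> * gap 0 \<omega>))) \<partial>M) \<noteq> \<infinity>"
      by (auto simp: emeasure_space_1 top_unique)
    show "AE \<omega> in M. ennreal (exp (- (\<sigma> * gap 0 \<omega>))) \<le> 1"
      using le by (intro AE_I2) (auto simp: ennreal_le_1 less_imp_le)
    show "\<not> (AE \<omega> in M. 1 \<le> ennreal (exp (- (\<sigma> * gap 0 \<omega>))))"
    proof
      assume "AE \<omega> in M. 1 \<le> ennreal (exp (- (\<sigma> * gap 0 \<omega>)))"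
      then have "AE \<omega> in M. False"
        using AE_space by eventually_elim (use le in \<open>force simp: not_le\<close>)
      then show False by simp
    qed
  qed auto
  then show ?thesis by (simp add: nn_laplace_n2[of _ 0] emeasure_space_1)
qed

definition renewal_cdf :: "nat \<Rightarrow> real \<Rightarrow> ennreal" where
  "renewal_cdf i t = emeasure M {\<omega>\<in>space M. V Y T i \<omega> \<le> t}"

lemma measurable_renewal_cdf [measurable]: "renewal_cdf i \<in> borel_measurable borel"
proof -
  have "(\<lambda>t. prob {\<omega>\<in>space M. V Y T i \<omega> \<le> t}) \<in> borel_measurable borel"
    by (intro borel_measurable_mono monoI finite_measure_mono) auto
  then show ?thesis
    by (simp add: renewal_cdf_def[abs_def] emeasure_eq_measure)
qed

lemma V_nonneg: "\<omega> \<in> space M \<Longrightarrow> 0 \<le> V Y T i \<omega>"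
  by (induction i) (auto simp: V_Suc V_0 intro: add_nonneg_nonneg less_imp_le[OF gap_pos] simp del: V.simps)

text \<open>\<open>V\<^sub>i\<close> is a function of the past at \<open>V\<^sub>i\<close>, and the next cycle length is a function of the pair
\<open>(Y\<^sub>i\<^sub>+\<^sub>1, T\<^sub>i\<^sub>+\<^sub>1 - V\<^sub>i)\<close>, which is independent of that past.\<close>

lemma indep_V_gap_sets:
  assumes "A \<in> sets borel" "B \<in> sets borel"
  shows "V Y T i -` A \<inter> space M \<in> sets (past M Y T P i)"
    "gap i -` B \<inter> space M \<in>
      sets (vimage_algebra (space M) (\<lambda>\<omega>. (Y (Suc i) \<omega>, wait Y T (Suc i) \<omega>)) (borel \<Otimes>\<^sub>M borel))"
proof -
  show "V Y T i -` A \<inter> space M \<in> sets (past M Y T P i)"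
    using measurable_sets[OF measurable_V_past[OF order.refl] assms(1)] by simp
  let ?\<phi> = "\<lambda>(y, w). real_of_ereal (min (ereal y) w)"
  have "?\<phi> -` B \<inter> space (borel \<Otimes>\<^sub>M borel) \<in> sets (borel \<Otimes>\<^sub>M borel)"
    using assms(2) by measurable
  from in_vimage_algebra[OF this, of "\<lambda>\<omega>. (Y (Suc i) \<omega>, wait Y T (Suc i) \<omega>)" "space M"]
  show "gap i -` B \<inter> space M \<in>
      sets (vimage_algebra (space M) (\<lambda>\<omega>. (Y (Suc i) \<omega>, wait Y T (Suc i) \<omega>)) (borel \<Otimes>\<^sub>M borel))"
    by (simp add: gap_def vimage_def space_pair_measure)
qed

lemma prob_V_gap:
  assumes "A \<in> sets borel" "B \<in> sets borel"
  shows "prob ((V Y T i -` A \<inter> space M) \<inter> (gap i -` B \<inter> space M)) =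
    prob (V Y T i -` A \<inter> space M) * prob (gap i -` B \<inter> space M)"
  using indep_past[of "Suc i"] indep_V_gap_sets[OF assms] by (intro indep_setD) auto

lemma indep_gap_V: "indep_var borel (gap i) borel (V Y T i)"
  unfolding indep_var_eq
proof (intro conjI)
  have *: "sigma_sets (space M) {X -` A \<inter> space M |A. A \<in> sets borel} = {X -` A \<inter> space M |A. A \<in> sets borel}"
    for X :: "'a \<Rightarrow> real"
    using sets_vimage_algebra2[of X "space M" borel] sets_vimage_algebra[of "space M" X borel] by simp
  show "indep_set (sigma_sets (space M) {gap i -` A \<inter> space M |A. A \<in> sets borel})
     (sigma_sets (space M) {V Y T i -` A \<inter> space M |A. A \<in> sets borel})"
    unfolding * using prob_V_gap[of _ _ i]
    by (intro indep_setI) (auto simp: Int_commute mult.commute)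
qed measurable

lemma renewal_cdf_Suc: "renewal_cdf (Suc i) = conv (renewal_cdf i) (halfline (n2 \<mu> F f))"
proof
  fix t
  have "renewal_cdf (Suc i) t = emeasure M {\<omega>\<in>space M. gap i \<omega> + V Y T i \<omega> \<le> t}"
    unfolding renewal_cdf_def by (intro arg_cong[where f="emeasure M"]) (auto simp: V_Suc simp del: V.simps)
  also have "\<dots> = emeasure (distr M borel (\<lambda>\<omega>. gap i \<omega> + V Y T i \<omega>)) {..t}"
    by (simp add: emeasure_distr vimage_def Int_def conj_commute)
  also have "distr M borel (\<lambda>\<omega>. gap i \<omega> + V Y T i \<omega>) = convolution (distr M borel (gap i)) (distr M borel (V Y T i))"
    by (intro sum_indep_random_variable indep_gap_V) measurable
  also have "emeasure \<dots> {..t} = (\<integral>\<^sup>+x. emeasure (distr M borel (V Y T i)) {a. a + x \<in> {..t}} \<partial>distr M borel (gap i))"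
    by (intro convolution_emeasure finite_measure_distr) auto
  also have "\<dots> = (\<integral>\<^sup>+x. renewal_cdf i (t - x) \<partial>distr M borel (gap i))"
    by (intro nn_integral_cong)
      (simp add: renewal_cdf_def emeasure_distr vimage_def Int_def conj_commute le_diff_eq)
  also have "\<dots> = conv (renewal_cdf i) (halfline (n2 \<mu> F f)) t"
    by (simp add: distr_gap nn_integral_density conv_def mult.commute)
  finally show "renewal_cdf (Suc i) t = \<dots>" .
qed

lemma renewal_cdf_eq: "renewal_cdf i = conv_power (halfline (n2 \<mu> F f)) i"
proof (induction i)
  case 0
  show ?case
    by (auto simp: renewal_cdf_def V_0 emeasure_space_1 indicator_def fun_eq_iff simp del: V.simps)
qed (simp add: renewal_cdf_Suc)

abbreviation renewal_mean :: "real \<Rightarrow> ennreal" where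
  "renewal_mean \<equiv> renewal_fun (halfline (n2 \<mu> F f))"

lemma renewal_mean_eq: "renewal_mean t = (\<Sum>i. renewal_cdf i t)"
  by (simp add: renewal_fun_def renewal_cdf_eq)

lemma renewal_mean_finite: "renewal_mean t < \<infinity>"
  using nn_laplace_n2_less_1[of 1] by (intro renewal_fun_finite[of _ 1]) auto

text \<open>The renewal function is finite, so by Borel--Cantelli the renewal times almost surely do not
accumulate. On the exceptional null set \<open>last_renewal\<close> need not be the last renewal time before \<open>t\<close>:
there the supremum that defines \<open>J\<close> may be that of an infinite set.\<close>

lemma AE_V_unbounded: "AE \<omega> in M. \<forall>t. finite {i. V Y T i \<omega> \<le> t}"
proof -
  have "AE \<omega> in M. finite {i. V Y T i \<omega> \<le> real n}" for n
  proof -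
    have "AE \<omega> in M. eventually (\<lambda>i. \<omega> \<in> space M - {\<omega>\<in>space M. V Y T i \<omega> \<le> real n}) sequentially"
    proof (rule borel_cantelli_AE1)
      have "(\<Sum>i. ennreal (prob {\<omega>\<in>space M. V Y T i \<omega> \<le> real n})) \<noteq> \<top>"
        using renewal_mean_finite[of "real n"]
        by (simp add: renewal_mean_eq renewal_cdf_def emeasure_eq_measure less_top)
      then show "summable (\<lambda>i. prob {\<omega>\<in>space M. V Y T i \<omega> \<le> real n})"
        by (intro summable_suminf_not_top) auto
    qed (auto simp: less_top[symmetric])
    then show ?thesis
      using AE_space
    proof eventually_elim
      case (elim \<omega>)
      then have "eventually (\<lambda>i. \<not> V Y T i \<omega> \<le> real n) sequentially"
        by (auto elim: eventually_mono)
      then show ?case by (simp add: eventually_cofinite flip: cofinite_eq_sequentially)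
    qed
  qed
  then have "AE \<omega> in M. \<forall>n::nat. finite {i. V Y T i \<omega> \<le> real n}"
    by (simp add: AE_all_countable)
  then show ?thesis
  proof eventually_elim
    case (elim \<omega>)
    show ?case
    proof
      fix t
      obtain n where "t \<le> real n" using real_arch_simple by blast
      then have "{i. V Y T i \<omega> \<le> t} \<subseteq> {i. V Y T i \<omega> \<le> real n}" by auto
      with elim show "finite {i. V Y T i \<omega> \<le> t}" by (blast intro: finite_subset)
    qed
  qed
qed

end

section \<open>Counting points\<close>

lemma finite_points:
  "simple_point_process M P \<Longrightarrow> \<omega> \<in> space M \<Longrightarrow> finite (P \<omega> \<inter> {0<..t})"
  by (simp add: simple_point_process_def)

lemma num_points_nonpos: "t \<le> 0 \<Longrightarrow> num_points P t \<omega> = 0"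
  by (simp add: num_points_def)

lemma num_points_mono:
  assumes "simple_point_process M P" "\<omega> \<in> space M" "s \<le> t"
  shows "num_points P s \<omega> \<le> num_points P t \<omega>"
  unfolding num_points_def using finite_points[OF assms(1,2)] assms(3)
  by (intro card_mono) auto

lemma num_points_right_continuous:
  assumes "simple_point_process M P" "\<omega> \<in> space M"
  obtains e where "s < e" "\<And>q. s \<le> q \<Longrightarrow> q < e \<Longrightarrow> num_points P q \<omega> = num_points P s \<omega>"
proof
  \<comment> \<open>the next point after \<open>s\<close>, or \<open>s + 1\<close> if none comes earlier\<close>
  let ?D = "insert (s + 1) (P \<omega> \<inter> {0<..s + 1} \<inter> {s<..})"
  have fin: "finite ?D" using finite_points[OF assms, of "s + 1"] by simp
  then show "s < Min ?D" by (subst Min_gr_iff) auto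
  fix q assume q: "s \<le> q" "q < Min ?D"
  have "v \<le> s" if "v \<in> P \<omega>" "0 < v" "v \<le> q" for v
  proof (rule ccontr)
    assume "\<not> v \<le> s"
    moreover have "Min ?D \<le> s + 1" using fin by (intro Min_le) auto
    ultimately have "v \<in> ?D" using that q by auto
    then have "Min ?D \<le> v" using fin by (rule Min_le[rotated])
    then show False using that q by simp
  qed
  then have "P \<omega> \<inter> {0<..q} = P \<omega> \<inter> {0<..s}" using q by auto
  then show "num_points P q \<omega> = num_points P s \<omega>" by (simp add: num_points_def)
qed

lemma measurable_num_points_fixed:
  assumes "simple_point_process M P"
  shows "num_points P t \<in> measurable M (count_space UNIV)"
proof (cases "0 \<le> t")
  case False
  then have "num_points P t = (\<lambda>_. 0)" by (auto simp: num_points_nonpos)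
  then show ?thesis by simp
qed (use assms in \<open>simp add: simple_point_process_def\<close>)

text \<open>Joint measurability in time and chance: \<open>num_points\<close> is right-continuous and increasing in time, so it
is below \<open>n\<close> at a time if and only if it is below \<open>n\<close> at some later rational time.\<close>

lemma measurable_num_points:
  assumes P: "simple_point_process M P"
    and [measurable]: "f \<in> borel_measurable N" and k [measurable]: "k \<in> measurable N M"
  shows "(\<lambda>z. num_points P (f z) (k z)) \<in> measurable N (count_space UNIV)"
proof -
  note [measurable] = measurable_num_points_fixed[OF P]
  have "Measurable.pred N (\<lambda>z. num_points P (f z) (k z) < n)" for n
  proof -
    have "num_points P (f z) (k z) < n \<longleftrightarrow> (\<exists>r::rat. f z < of_rat r \<and> num_points P (of_rat r) (k z) < n)"
      if z: "z \<in> space N" for z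
    proof
      have kz: "k z \<in> space M" using measurable_space[OF k z] .
      assume less: "num_points P (f z) (k z) < n"
      obtain e where e: "f z < e" "\<And>q. f z \<le> q \<Longrightarrow> q < e \<Longrightarrow> num_points P q (k z) = num_points P (f z) (k z)"
        using num_points_right_continuous[OF P kz] by blast
      obtain q where q: "q \<in> \<rat>" "f z < q" "q < e" using Rats_dense_in_real[OF e(1)] by blast
      obtain r where "q = of_rat r" using q(1) by (rule Rats_cases)
      with q have "f z < of_rat r" "of_rat r < e" by simp_all
      with e(2)[of "of_rat r"] less show "\<exists>r::rat. f z < of_rat r \<and> num_points P (of_rat r) (k z) < n" by auto
    next
      have kz: "k z \<in> space M" using measurable_space[OF k z] .
      assume "\<exists>r::rat. f z < of_rat r \<and> num_points P (of_rat r) (k z) < n"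
      then show "num_points P (f z) (k z) < n"
        using num_points_mono[OF P kz, of "f z"] by (meson less_imp_le le_less_trans)
    qed
    moreover have "Measurable.pred N (\<lambda>z. \<exists>r::rat. f z < of_rat r \<and> num_points P (of_rat r) (k z) < n)"
      by measurable
    ultimately show ?thesis by (rule measurable_cong[THEN iffD2])
  qed
  note [measurable] = this
  have "Measurable.pred N (\<lambda>z. num_points P (f z) (k z) = n)" for n
  proof -
    have "num_points P (f z) (k z) = n \<longleftrightarrow>
        num_points P (f z) (k z) < Suc n \<and> \<not> num_points P (f z) (k z) < n" for z
      by auto
    then show ?thesis by (subst measurable_cong, assumption) measurable
  qed
  then show ?thesis
    by (subst measurable_count_space_eq2_countable) (auto simp: pred_def vimage_def Int_def conj_commute)
qed

definition point_mean :: "'a measure \<Rightarrow> ('a \<Rightarrow> real set) \<Rightarrow> real \<Rightarrow> ennreal" where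
  "point_mean M P t = (\<integral>\<^sup>+\<omega>. of_nat (num_points P t \<omega>) \<partial>M)"

lemma causal_point_mean: "causal (point_mean M P)"
  by (simp add: causal_def point_mean_def num_points_nonpos)

lemma (in sigma_finite_measure) measurable_point_mean:
  assumes "simple_point_process M P"
  shows "point_mean M P \<in> borel_measurable borel"
proof -
  have [measurable]: "(\<lambda>z. num_points P (fst z) (snd z)) \<in> measurable (borel \<Otimes>\<^sub>M M) (count_space UNIV)"
    by (intro measurable_num_points[OF assms]) measurable
  show ?thesis unfolding point_mean_def by measurable
qed

lemma point_mean_mono:
  assumes "simple_point_process M P" "s \<le> t"
  shows "point_mean M P s \<le> point_mean M P t"
  unfolding point_mean_def using num_points_mono[OF assms(1) _ assms(2)]
  by (intro nn_integral_mono) simp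

lemma excitation_decomposition:
  assumes c: "\<And>u. 0 \<le> u \<Longrightarrow> 0 \<le> c u" and fin: "finite (D \<inter> {0<..t})"
  shows "indicator {0<..t} s * ennreal (\<Sum>v\<in>D \<inter> {0<..<s}. c (s - v)) =
    (\<Sum>v\<in>D \<inter> {0<..t}. indicator {v<..t} s * halfline c (s - v))"
proof (cases "s \<in> {0<..t}")
  case True
  have "ennreal (\<Sum>v\<in>D \<inter> {0<..<s}. c (s - v)) = (\<Sum>v\<in>D \<inter> {0<..<s}. indicator {v<..t} s * halfline c (s - v))"
    using True c by (subst sum_ennreal[symmetric]) (auto intro!: sum.cong)
  also have "\<dots> = (\<Sum>v\<in>D \<inter> {0<..t}. indicator {v<..t} s * halfline c (s - v))"
    using True fin by (intro sum.mono_neutral_left) (auto simp: indicator_def)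
  finally show ?thesis using True by simp
next
  case False
  then show ?thesis by (auto intro!: sum.neutral[symmetric] simp: indicator_def)
qed

text \<open>Exchange sum and integral: a point \<open>v\<close> contributes \<open>\<integral> c\<close> over \<open>[0, t - v]\<close>, and age \<open>u\<close> is counted for
exactly the points \<open>v \<le> t - u\<close>. Applied to one path of the process, this computes the integral of
the excitation part of the intensity.\<close>

lemma nn_integral_excitation:
  assumes [measurable]: "halfline c \<in> borel_measurable borel"
    and c: "\<And>u. 0 \<le> u \<Longrightarrow> 0 \<le> c u" and fin: "finite (D \<inter> {0<..t})"
  shows "(\<integral>\<^sup>+s. indicator {0<..t} s * ennreal (\<Sum>v\<in>D \<inter> {0<..<s}. c (s - v)) \<partial>lborel)
    = (\<integral>\<^sup>+u. of_nat (card (D \<inter> {0<..t - u})) * halfline c u \<partial>lborel)"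
proof -
  let ?D = "D \<inter> {0<..t}"
  have "(\<integral>\<^sup>+s. indicator {0<..t} s * ennreal (\<Sum>v\<in>D \<inter> {0<..<s}. c (s - v)) \<partial>lborel)
      = (\<integral>\<^sup>+s. (\<Sum>v\<in>?D. indicator {v<..t} s * halfline c (s - v)) \<partial>lborel)"
    by (intro nn_integral_cong excitation_decomposition c fin)
  also have "\<dots> = (\<Sum>v\<in>?D. \<integral>\<^sup>+s. indicator {v<..t} s * halfline c (s - v) \<partial>lborel)"
    by (intro nn_integral_sum) measurable
  also have "\<dots> = (\<Sum>v\<in>?D. \<integral>\<^sup>+u. indicator {0..t - v} u * halfline c u \<partial>lborel)"
  proof (rule sum.cong[OF refl])
    fix v
    have "(\<integral>\<^sup>+s. indicator {v<..t} s * halfline c (s - v) \<partial>lborel)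
        = (\<integral>\<^sup>+s. (\<lambda>u. indicator {0<..t - v} u * halfline c u) (s - v) \<partial>lborel)"
      by (intro nn_integral_cong) (auto simp: indicator_def)
    also have "\<dots> = (\<integral>\<^sup>+u. indicator {0<..t - v} u * halfline c u \<partial>lborel)"
      by (rule nn_integral_shift) measurable
    also have "\<dots> = (\<integral>\<^sup>+u. indicator {0..t - v} u * halfline c u \<partial>lborel)"
      using AE_lborel_singleton[of "0::real"]
      by (intro nn_integral_cong_AE, eventually_elim) (auto simp: indicator_def)
    finally show "(\<integral>\<^sup>+s. indicator {v<..t} s * halfline c (s - v) \<partial>lborel) = \<dots>" .
  qed
  also have "\<dots> = (\<integral>\<^sup>+u. (\<Sum>v\<in>?D. indicator {0..t - v} u * halfline c u) \<partial>lborel)"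
    by (intro nn_integral_sum[symmetric]) measurable
  also have "\<dots> = (\<integral>\<^sup>+u. of_nat (card (D \<inter> {0<..t - u})) * halfline c u \<partial>lborel)"
  proof (rule nn_integral_cong)
    fix u :: real
    show "(\<Sum>v\<in>?D. indicator {0..t - v} u * halfline c u) = of_nat (card (D \<inter> {0<..t - u})) * halfline c u"
    proof (cases "0 \<le> u")
      case True
      have "(\<Sum>v\<in>?D. indicator {0..t - v} u * halfline c u) = (\<Sum>v\<in>D \<inter> {0<..t - u}. indicator {0..t - v} u * halfline c u)"
        using True fin by (intro sum.mono_neutral_right) (auto simp: indicator_def)
      also have "\<dots> = (\<Sum>v\<in>D \<inter> {0<..t - u}. halfline c u)"
        using True by (intro sum.cong) (auto simp: indicator_def)
      finally show ?thesis by simp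
    qed simp
  qed
  finally show ?thesis .
qed

text \<open>The first \<open>n\<close> points of \<open>P\<close>, described by the predictable condition that fewer than \<open>n\<close> points came
strictly before.\<close>

definition first_points :: "nat \<Rightarrow> ('a \<Rightarrow> real set) \<Rightarrow> 'a \<Rightarrow> real set" where
  "first_points n P \<omega> = {v \<in> P \<omega>. card (P \<omega> \<inter> {0<..<v}) < n}"

lemma card_first_elements:
  fixes S :: "'b::linorder set"
  assumes "finite S"
  shows "card {v\<in>S. card (S \<inter> {..<v}) < n} = min n (card S)"
  using assms
proof (induction S rule: finite_linorder_max_induct)
  case (insert b A)
  have "insert b A \<inter> {..<v} = A \<inter> {..<v}" if "v \<in> A" for v
    using insert.hyps that by auto
  moreover have "insert b A \<inter> {..<b} = A" using insert.hyps by auto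
  ultimately have "{v\<in>insert b A. card (insert b A \<inter> {..<v}) < n}
      = {v\<in>A. card (A \<inter> {..<v}) < n} \<union> (if card A < n then {b} else {})"
    by (auto split: if_splits)
  then show ?case using insert by (auto simp: min_def)
qed simp

lemma num_points_first_points:
  assumes P: "simple_point_process M P" and \<omega>: "\<omega> \<in> space M"
  shows "num_points (first_points n P) t \<omega> = min n (num_points P t \<omega>)"
proof -
  let ?S = "P \<omega> \<inter> {0<..t}"
  have "?S \<inter> {..<v} = P \<omega> \<inter> {0<..<v}" if "v \<in> ?S" for v using that by auto
  then have "first_points n P \<omega> \<inter> {0<..t} = {v\<in>?S. card (?S \<inter> {..<v}) < n}"
    by (auto simp: first_points_def)
  then show ?thesis
    unfolding num_points_def using card_first_elements[OF finite_points[OF P \<omega>, of t]] by simp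
qed

lemma simple_point_process_first_points:
  assumes P: "simple_point_process M P"
  shows "simple_point_process M (first_points n P)"
  unfolding simple_point_process_def
proof (intro conjI ballI allI impI)
  fix \<omega> t assume \<omega>: "\<omega> \<in> space M"
  then show "first_points n P \<omega> \<subseteq> {0<..}" "finite (first_points n P \<omega> \<inter> {0<..t})"
    using P finite_points[OF P \<omega>, of t]
    by (auto simp: first_points_def simple_point_process_def intro: finite_subset[rotated])
next
  fix t :: real
  note [measurable] = measurable_num_points_fixed[OF P]
  show "num_points (first_points n P) t \<in> measurable M (count_space UNIV)"
    by (subst measurable_cong[OF num_points_first_points[OF P]]) measurable
qed

lemma nn_integral_indicator_count_space:
  assumes "finite (B \<inter> {x. Q x})"
  shows "(\<integral>\<^sup>+x. (if Q x then 1 else 0) \<partial>count_space B) = (of_nat (card (B \<inter> {x. Q x})) :: ennreal)"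
  using assms by (subst nn_integral_count_space'[of "B \<inter> {x. Q x}"]) auto

context R2_Hawkes
begin

section \<open>Mean of the compensator\<close>

abbreviation offspring :: "real \<Rightarrow> ennreal" where
  "offspring \<equiv> halfline (\<lambda>t. \<eta> * h t)"

abbreviation events_mean :: "real \<Rightarrow> ennreal" where
  "events_mean \<equiv> point_mean M P"

text \<open>The mean number of immigrants, in the form \<open>R * F\<^sub>g\<close> in which it arises from the baseline part of
the intensity.\<close>

definition immigrant_mean :: "real \<Rightarrow> ennreal" where
  "immigrant_mean = conv renewal_mean (halfline (Fg \<mu> F))"

lemma measurable_immigrant_mean [measurable]: "immigrant_mean \<in> borel_measurable borel"
  unfolding immigrant_mean_def by measurable

lemma measurable_events_mean [measurable]: "events_mean \<in> borel_measurable borel"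
  by (rule measurable_point_mean[OF point_process])

lemma causal_immigrant_mean: "causal immigrant_mean"
  unfolding immigrant_mean_def by (intro causal_conv causal_renewal_fun causal_halfline)

text \<open>Exactly one cycle \<open>(V\<^sub>i, V\<^sub>i\<^sub>+\<^sub>1]\<close> contains \<open>s\<close>, the one with \<open>i = J(s)\<close>; the other terms of the sum
vanish.\<close>

lemma baseline_decomposition:
  assumes \<omega>: "\<omega> \<in> space M" and fin: "finite {i. V Y T i \<omega> \<le> s}" and s: "0 < s"
  shows "last_renewal Y T s \<omega> < s"
    and "ennreal (\<mu> (s - last_renewal Y T s \<omega>)) =
      (\<Sum>i. indicator {V Y T i \<omega><..V Y T (Suc i) \<omega>} s * halfline \<mu> (s - V Y T i \<omega>))"
proof -
  have mono: "strict_mono (\<lambda>i. V Y T i \<omega>)"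
    using gap_pos[OF \<omega>] by (intro strict_monoI_Suc) (simp add: V_Suc[OF \<omega>] del: V.simps)
  let ?I = "{i. V Y T i \<omega> < s}"
  have I: "finite ?I" "0 \<in> ?I"
    using s by (auto intro: finite_subset[OF _ fin])
  define j where "j = J Y T s \<omega>"
  have ne: "?I \<noteq> {}" using I(2) by blast
  have j: "j = Max ?I" by (simp only: j_def J_def Sup_nat_def ne if_False)
  have "j \<in> ?I" unfolding j using I(1) ne by (rule Max_in)
  then show less: "last_renewal Y T s \<omega> < s" by (simp add: last_renewal_def j_def)
  have "Suc j \<notin> ?I"
  proof
    assume "Suc j \<in> ?I"
    then have "Suc j \<le> j" unfolding j using I by (intro Max_ge) auto
    then show False by simp
  qed
  then have le: "s \<le> V Y T (Suc j) \<omega>" by simp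
  have "(\<Sum>i. indicator {V Y T i \<omega><..V Y T (Suc i) \<omega>} s * halfline \<mu> (s - V Y T i \<omega>))
      = (\<Sum>i\<in>{j}. indicator {V Y T i \<omega><..V Y T (Suc i) \<omega>} s * halfline \<mu> (s - V Y T i \<omega>))"
  proof (rule suminf_finite)
    fix i assume i: "i \<notin> {j}"
    have "s \<notin> {V Y T i \<omega><..V Y T (Suc i) \<omega>}"
    proof (cases "i < j")
      case True
      then have "V Y T (Suc i) \<omega> \<le> V Y T j \<omega>"
        using monoD[OF strict_mono_mono[OF mono], of "Suc i" j] by (simp del: V.simps)
      then show ?thesis using \<open>j \<in> ?I\<close> by simp
    next
      case False
      with i have "V Y T (Suc j) \<omega> \<le> V Y T i \<omega>"
        using monoD[OF strict_mono_mono[OF mono], of "Suc j" i] by (simp del: V.simps)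
      then show ?thesis using le by simp
    qed
    then show "indicator {V Y T i \<omega><..V Y T (Suc i) \<omega>} s * halfline \<mu> (s - V Y T i \<omega>) = 0" by simp
  qed simp
  also have "\<dots> = indicator {V Y T j \<omega><..V Y T (Suc j) \<omega>} s * halfline \<mu> (s - V Y T j \<omega>)"
    by (subst sum.insert) (simp_all only: sum.empty add_0_right finite.emptyI empty_iff not_False_eq_True)
  finally show "ennreal (\<mu> (s - last_renewal Y T s \<omega>)) =
      (\<Sum>i. indicator {V Y T i \<omega><..V Y T (Suc i) \<omega>} s * halfline \<mu> (s - V Y T i \<omega>))"
    using le less by (simp add: last_renewal_def j_def del: V.simps)
qed

text \<open>In terms of the age \<open>u = s - V\<^sub>i\<close>, the hazard of cycle \<open>i\<close> up to time \<open>t\<close> is the integral of \<open>\<mu>(u)\<close>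
over those \<open>u\<close> with \<open>V\<^sub>i \<le> t - u\<close> and \<open>u < gap\<close>, up to the null set \<open>{0, gap}\<close>. By independence these
two events have joint probability \<open>P(V\<^sub>i \<le> t - u) (1 - F(u)) (1 - G(u))\<close>.\<close>

lemma mean_baseline_cycle:
  "(\<integral>\<^sup>+\<omega>. (\<integral>\<^sup>+s. indicator {0<..t} s *
      (indicator {V Y T i \<omega><..V Y T (Suc i) \<omega>} s * halfline \<mu> (s - V Y T i \<omega>)) \<partial>lborel) \<partial>M)
    = conv (renewal_cdf i) (halfline (Fg \<mu> F)) t" (is "?lhs = _")
  and measurable_baseline_cycle: "(\<lambda>\<omega>. \<integral>\<^sup>+s. indicator {0<..t} s *
      (indicator {V Y T i \<omega><..V Y T (Suc i) \<omega>} s * halfline \<mu> (s - V Y T i \<omega>)) \<partial>lborel)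
      \<in> borel_measurable M"
proof -
  interpret lborel_M: pair_sigma_finite lborel M ..
  let ?w = "\<lambda>\<omega> u. (if V Y T i \<omega> \<le> t - u \<and> u < gap i \<omega> then 1 else 0) * halfline \<mu> u"
  have cycle: "(\<integral>\<^sup>+s. indicator {0<..t} s *
      (indicator {V Y T i \<omega><..V Y T (Suc i) \<omega>} s * halfline \<mu> (s - V Y T i \<omega>)) \<partial>lborel)
      = (\<integral>\<^sup>+u. ?w \<omega> u \<partial>lborel)" if \<omega>: "\<omega> \<in> space M" for \<omega>
  proof -
    have "(\<integral>\<^sup>+s. indicator {0<..t} s *
        (indicator {V Y T i \<omega><..V Y T (Suc i) \<omega>} s * halfline \<mu> (s - V Y T i \<omega>)) \<partial>lborel)
      = (\<integral>\<^sup>+s. (\<lambda>u. indicator {..t - V Y T i \<omega>} u * indicator {0<..gap i \<omega>} u * halfline \<mu> u) (s - V Y T i \<omega>) \<partial>lborel)"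
      using V_nonneg[OF \<omega>, of i]
      by (intro nn_integral_cong) (auto simp: indicator_def V_Suc[OF \<omega>] simp del: V.simps)
    also have "\<dots> = (\<integral>\<^sup>+u. indicator {..t - V Y T i \<omega>} u * indicator {0<..gap i \<omega>} u * halfline \<mu> u \<partial>lborel)"
      by (rule nn_integral_shift) measurable
    also have "\<dots> = (\<integral>\<^sup>+u. ?w \<omega> u \<partial>lborel)"
      using AE_lborel_singleton[of "0::real"] AE_lborel_singleton[of "gap i \<omega>"]
    proof (intro nn_integral_cong_AE, eventually_elim)
      case (elim u)
      then show ?case by (cases "u < 0") (auto simp: indicator_def)
    qed
    finally show ?thesis .
  qed
  show "(\<lambda>\<omega>. \<integral>\<^sup>+s. indicator {0<..t} s *
      (indicator {V Y T i \<omega><..V Y T (Suc i) \<omega>} s * halfline \<mu> (s - V Y T i \<omega>)) \<partial>lborel)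
      \<in> borel_measurable M"
    by (subst measurable_cong[OF cycle]) measurable
  have "?lhs = (\<integral>\<^sup>+\<omega>. (\<integral>\<^sup>+u. ?w \<omega> u \<partial>lborel) \<partial>M)"
    by (rule nn_integral_cong) (rule cycle)
  also have "\<dots> = (\<integral>\<^sup>+u. (\<integral>\<^sup>+\<omega>. ?w \<omega> u \<partial>M) \<partial>lborel)"
    by (rule lborel_M.Fubini') measurable
  also have "\<dots> = (\<integral>\<^sup>+u. renewal_cdf i (t - u) * halfline (Fg \<mu> F) u \<partial>lborel)"
  proof (rule nn_integral_cong)
    fix u :: real
    show "(\<integral>\<^sup>+\<omega>. ?w \<omega> u \<partial>M) = renewal_cdf i (t - u) * halfline (Fg \<mu> F) u"
    proof (cases "0 \<le> u")
      case True
      let ?A = "V Y T i -` {..t - u} \<inter> space M" and ?B = "gap i -` {u<..} \<inter> space M"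
      have "(\<integral>\<^sup>+\<omega>. ?w \<omega> u \<partial>M) = (\<integral>\<^sup>+\<omega>. (if V Y T i \<omega> \<le> t - u \<and> u < gap i \<omega> then 1 else 0) \<partial>M) * halfline \<mu> u"
        by (rule nn_integral_multc) measurable
      also have "(\<integral>\<^sup>+\<omega>. (if V Y T i \<omega> \<le> t - u \<and> u < gap i \<omega> then 1 else 0) \<partial>M)
          = (\<integral>\<^sup>+\<omega>. indicator (?A \<inter> ?B) \<omega> \<partial>M)"
        by (intro nn_integral_cong) (auto simp: indicator_def)
      also have "\<dots> = emeasure M (?A \<inter> ?B)"
        by (intro nn_integral_indicator) measurable
      also have "\<dots> = emeasure M ?A * emeasure M ?B"
        using prob_V_gap[of "{..t - u}" "{u<..}" i] by (simp add: emeasure_eq_measure ennreal_mult)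
      also have "emeasure M ?A = renewal_cdf i (t - u)"
        unfolding renewal_cdf_def by (intro arg_cong[where f="emeasure M"]) auto
      also have "emeasure M ?B = ennreal ((1 - F u) * (1 - G \<mu> u))"
        unfolding emeasure_gap_greater[OF True, of i, symmetric]
        by (intro arg_cong[where f="emeasure M"]) auto
      finally show ?thesis by (simp add: halfline_Fg mult_ac)
    qed simp
  qed
  finally show "?lhs = conv (renewal_cdf i) (halfline (Fg \<mu> F)) t"
    by (simp add: conv_def)
qed

text \<open>For \<open>Q = P\<close> the inner integrand is the intensity, so this computes the mean number of events. The
general \<open>Q\<close> serves the stopping argument, where the excitation comes from the first \<open>n\<close> points only.\<close>

lemma mean_compensator:
  assumes Q: "simple_point_process M Q"
  shows "(\<integral>\<^sup>+\<omega>. (\<integral>\<^sup>+s. indicator {0<..t} s * (ennreal (\<mu> (s - last_renewal Y T s \<omega>)) +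
      ennreal (\<Sum>v\<in>Q \<omega> \<inter> {0<..<s}. \<eta> * h (s - v))) \<partial>lborel) \<partial>M)
    = immigrant_mean t + conv (point_mean M Q) offspring t"
proof -
  interpret lborel_M: pair_sigma_finite lborel M ..
  let ?c = "\<lambda>\<omega> i s. indicator {0<..t} s * (indicator {V Y T i \<omega><..V Y T (Suc i) \<omega>} s * halfline \<mu> (s - V Y T i \<omega>))"
  let ?e = "\<lambda>\<omega> s. indicator {0<..t} s * ennreal (\<Sum>v\<in>Q \<omega> \<inter> {0<..<s}. \<eta> * h (s - v))"
  let ?n = "\<lambda>\<omega> u. of_nat (num_points Q (t - u) \<omega>) * offspring u"
  have [measurable]: "(\<lambda>z. num_points Q (t - snd z) (fst z)) \<in> measurable (M \<Otimes>\<^sub>M borel) (count_space UNIV)"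
    by (intro measurable_num_points[OF Q]) measurable
  have [measurable]: "(\<lambda>z. num_points Q (t - fst z) (snd z)) \<in> measurable (borel \<Otimes>\<^sub>M M) (count_space UNIV)"
    by (intro measurable_num_points[OF Q]) measurable
  have [measurable]: "(\<lambda>u. num_points Q (t - u) \<omega>) \<in> measurable borel (count_space UNIV)"
    if "\<omega> \<in> space M" for \<omega>
    using measurable_num_points[OF Q, of "\<lambda>u. t - u" borel "\<lambda>_. \<omega>"] that by simp
  have pathwise: "AE \<omega> in M. (\<integral>\<^sup>+s. indicator {0<..t} s * (ennreal (\<mu> (s - last_renewal Y T s \<omega>)) +
      ennreal (\<Sum>v\<in>Q \<omega> \<inter> {0<..<s}. \<eta> * h (s - v))) \<partial>lborel)
      = (\<Sum>i. \<integral>\<^sup>+s. ?c \<omega> i s \<partial>lborel) + (\<integral>\<^sup>+u. ?n \<omega> u \<partial>lborel)"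
    using AE_V_unbounded AE_space
  proof eventually_elim
    case (elim \<omega>)
    \<comment> \<open>in this form the integrand is visibly measurable in \<open>s\<close>\<close>
    have e: "?e \<omega> s = (\<Sum>v\<in>Q \<omega> \<inter> {0<..t}. indicator {v<..t} s * offspring (s - v))" for s
      using eta_pos h_pos finite_points[OF Q elim(2)]
      by (intro excitation_decomposition) (auto intro: mult_nonneg_nonneg less_imp_le)
    have "(\<integral>\<^sup>+s. indicator {0<..t} s * (ennreal (\<mu> (s - last_renewal Y T s \<omega>)) +
        ennreal (\<Sum>v\<in>Q \<omega> \<inter> {0<..<s}. \<eta> * h (s - v))) \<partial>lborel)
      = (\<integral>\<^sup>+s. (\<Sum>i. ?c \<omega> i s) + ?e \<omega> s \<partial>lborel)"
    proof (rule nn_integral_cong)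
      fix s
      show "indicator {0<..t} s * (ennreal (\<mu> (s - last_renewal Y T s \<omega>)) +
        ennreal (\<Sum>v\<in>Q \<omega> \<inter> {0<..<s}. \<eta> * h (s - v))) = (\<Sum>i. ?c \<omega> i s) + ?e \<omega> s"
        using baseline_decomposition(2)[OF elim(2), of s] elim(1)
        by (cases "s \<in> {0<..t}") (simp_all del: V.simps)
    qed
    also have "\<dots> = (\<integral>\<^sup>+s. (\<Sum>i. ?c \<omega> i s) \<partial>lborel) + (\<integral>\<^sup>+s. ?e \<omega> s \<partial>lborel)"
      unfolding e by (intro nn_integral_add) measurable
    also have "(\<integral>\<^sup>+s. (\<Sum>i. ?c \<omega> i s) \<partial>lborel) = (\<Sum>i. \<integral>\<^sup>+s. ?c \<omega> i s \<partial>lborel)"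
      by (intro nn_integral_suminf) measurable
    also have "(\<integral>\<^sup>+s. ?e \<omega> s \<partial>lborel) = (\<integral>\<^sup>+u. ?n \<omega> u \<partial>lborel)"
      unfolding num_points_def using finite_points[OF Q elim(2)] eta_pos h_pos
      by (intro nn_integral_excitation) (auto intro: mult_nonneg_nonneg less_imp_le)
    finally show ?case .
  qed
  have "(\<integral>\<^sup>+\<omega>. (\<integral>\<^sup>+s. indicator {0<..t} s * (ennreal (\<mu> (s - last_renewal Y T s \<omega>)) +
      ennreal (\<Sum>v\<in>Q \<omega> \<inter> {0<..<s}. \<eta> * h (s - v))) \<partial>lborel) \<partial>M)
    = (\<integral>\<^sup>+\<omega>. (\<Sum>i. \<integral>\<^sup>+s. ?c \<omega> i s \<partial>lborel) + (\<integral>\<^sup>+u. ?n \<omega> u \<partial>lborel) \<partial>M)"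
    by (rule nn_integral_cong_AE) (rule pathwise)
  also have "\<dots> = (\<integral>\<^sup>+\<omega>. (\<Sum>i. \<integral>\<^sup>+s. ?c \<omega> i s \<partial>lborel) \<partial>M) + (\<integral>\<^sup>+\<omega>. (\<integral>\<^sup>+u. ?n \<omega> u \<partial>lborel) \<partial>M)"
  proof (rule nn_integral_add)
    show "(\<lambda>\<omega>. \<Sum>i. \<integral>\<^sup>+s. ?c \<omega> i s \<partial>lborel) \<in> borel_measurable M"
      using measurable_baseline_cycle[measurable] by measurable
    show "(\<lambda>\<omega>. \<integral>\<^sup>+u. ?n \<omega> u \<partial>lborel) \<in> borel_measurable M"
      by measurable
  qed
  also have "(\<integral>\<^sup>+\<omega>. (\<Sum>i. \<integral>\<^sup>+s. ?c \<omega> i s \<partial>lborel) \<partial>M) = (\<Sum>i. \<integral>\<^sup>+\<omega>. (\<integral>\<^sup>+s. ?c \<omega> i s \<partial>lborel) \<partial>M)"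
    by (intro nn_integral_suminf measurable_baseline_cycle)
  also have "\<dots> = (\<Sum>i. conv (renewal_cdf i) (halfline (Fg \<mu> F)) t)"
    unfolding mean_baseline_cycle ..
  also have "\<dots> = immigrant_mean t"
    unfolding immigrant_mean_def renewal_mean_eq[abs_def] by (subst conv_suminf_left) auto
  also have "(\<integral>\<^sup>+\<omega>. (\<integral>\<^sup>+u. ?n \<omega> u \<partial>lborel) \<partial>M) = (\<integral>\<^sup>+u. (\<integral>\<^sup>+\<omega>. ?n \<omega> u \<partial>M) \<partial>lborel)"
    by (rule lborel_M.Fubini') measurable
  also have "\<dots> = conv (point_mean M Q) offspring t"
    unfolding conv_def point_mean_def
    using measurable_num_points_fixed[OF Q] by (intro nn_integral_cong nn_integral_multc) auto
  finally show ?thesis .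
qed

lemma space_history [simp]: "space (history M Y T P t) = space M"
  by (simp add: history_def space_measure_of_conv)

lemma measurable_history_num_points:
  "0 \<le> t \<Longrightarrow> num_points P t \<in> measurable (history M Y T P t) (count_space UNIV)"
  unfolding history_def by (intro measurable_sigma_generated) (auto dest: vimage_algebra_subset)

lemma predictable_rectangle:
  "0 \<le> s \<Longrightarrow> s \<le> t \<Longrightarrow> A \<in> sets (history M Y T P s) \<Longrightarrow>
    {s<..t} \<times> A \<in> sets (predictable M (history M Y T P))"
proof -
  have "({{0} \<times> A |A. A \<in> sets (history M Y T P 0)} \<union>
      {{s<..t} \<times> A |s t A. 0 \<le> s \<and> s \<le> t \<and> A \<in> sets (history M Y T P s)}) \<subseteq> Pow ({0..} \<times> space M)"
    using sets.sets_into_space[of _ "history M Y T P _"] by (fastforce simp: subset_eq)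
  then show "0 \<le> s \<Longrightarrow> s \<le> t \<Longrightarrow> A \<in> sets (history M Y T P s) \<Longrightarrow>
    {s<..t} \<times> A \<in> sets (predictable M (history M Y T P))"
    unfolding predictable_def by (auto intro!: in_measure_of)
qed

lemma intensity_split:
  assumes "\<omega> \<in> space M" "\<And>t. finite {i. V Y T i \<omega> \<le> t}" "0 < s"
  shows "ennreal (R2_intensity \<mu> \<eta> h Y T P s \<omega>) = ennreal (\<mu> (s - last_renewal Y T s \<omega>)) +
      ennreal (\<Sum>v\<in>P \<omega> \<inter> {0<..<s}. \<eta> * h (s - v))"
proof -
  have "0 \<le> \<mu> (s - last_renewal Y T s \<omega>)"
    using baseline_decomposition(1)[OF assms(1,2,3)] mu_pos by (simp add: less_imp_le)
  moreover have "0 \<le> (\<Sum>v\<in>P \<omega> \<inter> {0<..<s}. \<eta> * h (s - v))"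
    using eta_pos h_pos by (intro sum_nonneg mult_nonneg_nonneg) (auto intro: less_imp_le)
  ultimately show ?thesis by (simp add: R2_intensity_def sum_distrib_left)
qed

section \<open>Mean number of events\<close>

text \<open>The defining identity of the intensity for the indicator of a predictable event. It expresses the
mean of the process that keeps the points of \<open>P\<close> for which the event holds.\<close>

lemma intensity_identity:
  assumes "{z \<in> {0<..t} \<times> space M. A (fst z) (snd z)} \<in> sets (predictable M (history M Y T P))"
  shows "point_mean M (\<lambda>\<omega>. {v \<in> P \<omega>. A v \<omega>}) t =
    (\<integral>\<^sup>+\<omega>. (\<integral>\<^sup>+s. indicator {0<..t} s * (if A s \<omega> then
      ennreal (\<mu> (s - last_renewal Y T s \<omega>)) + ennreal (\<Sum>v\<in>P \<omega> \<inter> {0<..<s}. \<eta> * h (s - v)) else 0) \<partial>lborel) \<partial>M)"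
proof -
  let ?A = "{z \<in> {0<..t} \<times> space M. A (fst z) (snd z)}"
  let ?C = "\<lambda>z. indicator ?A z :: ennreal"
  have "?C \<in> borel_measurable (predictable M (history M Y T P))"
    using assms by (intro borel_measurable_indicator)
  then have eq: "(\<integral>\<^sup>+\<omega>. (\<integral>\<^sup>+s. ?C (s, \<omega>) \<partial>count_space (P \<omega>)) \<partial>M) =
      (\<integral>\<^sup>+\<omega>. (\<integral>\<^sup>+s\<in>{0..}. ?C (s, \<omega>) * ennreal (R2_intensity \<mu> \<eta> h Y T P s \<omega>) \<partial>lborel) \<partial>M)"
    using intensity unfolding has_intensity_def by blast
  have "point_mean M (\<lambda>\<omega>. {v \<in> P \<omega>. A v \<omega>}) t = (\<integral>\<^sup>+\<omega>. (\<integral>\<^sup>+s. ?C (s, \<omega>) \<partial>count_space (P \<omega>)) \<partial>M)"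
    unfolding point_mean_def
  proof (rule nn_integral_cong)
    fix \<omega> assume \<omega>: "\<omega> \<in> space M"
    let ?Q = "\<lambda>s. s \<in> {0<..t} \<and> A s \<omega>"
    have fin: "finite (P \<omega> \<inter> {s. ?Q s})"
      by (rule finite_subset[OF _ finite_points[OF point_process \<omega>, of t]]) auto
    have "(\<integral>\<^sup>+s. ?C (s, \<omega>) \<partial>count_space (P \<omega>)) = (\<integral>\<^sup>+s. (if ?Q s then 1 else 0) \<partial>count_space (P \<omega>))"
      using \<omega> by (intro nn_integral_cong) (auto simp: indicator_def)
    also have "\<dots> = of_nat (card (P \<omega> \<inter> {s. ?Q s}))"
      by (rule nn_integral_indicator_count_space) (rule fin)
    also have "P \<omega> \<inter> {s. ?Q s} = {v \<in> P \<omega>. A v \<omega>} \<inter> {0<..t}" by auto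
    finally show "of_nat (num_points (\<lambda>\<omega>. {v \<in> P \<omega>. A v \<omega>}) t \<omega>) = (\<integral>\<^sup>+s. ?C (s, \<omega>) \<partial>count_space (P \<omega>))"
      by (simp add: num_points_def)
  qed
  also note eq
  also have "(\<integral>\<^sup>+\<omega>. (\<integral>\<^sup>+s\<in>{0..}. ?C (s, \<omega>) * ennreal (R2_intensity \<mu> \<eta> h Y T P s \<omega>) \<partial>lborel) \<partial>M)
    = (\<integral>\<^sup>+\<omega>. (\<integral>\<^sup>+s. indicator {0<..t} s * (if A s \<omega> then
      ennreal (\<mu> (s - last_renewal Y T s \<omega>)) + ennreal (\<Sum>v\<in>P \<omega> \<inter> {0<..<s}. \<eta> * h (s - v)) else 0) \<partial>lborel) \<partial>M)"
  proof (rule nn_integral_cong_AE)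
    show "AE \<omega> in M. (\<integral>\<^sup>+s\<in>{0..}. ?C (s, \<omega>) * ennreal (R2_intensity \<mu> \<eta> h Y T P s \<omega>) \<partial>lborel)
      = (\<integral>\<^sup>+s. indicator {0<..t} s * (if A s \<omega> then
        ennreal (\<mu> (s - last_renewal Y T s \<omega>)) + ennreal (\<Sum>v\<in>P \<omega> \<inter> {0<..<s}. \<eta> * h (s - v)) else 0) \<partial>lborel)"
      using AE_V_unbounded AE_space
    proof eventually_elim
      case (elim \<omega>)
      then show ?case
        by (intro nn_integral_cong) (simp add: indicator_def intensity_split)
    qed
  qed
  finally show ?thesis .
qed

lemma events_mean_equation: "events_mean t = immigrant_mean t + conv events_mean offspring t"
proof (cases "0 \<le> t")
  case True
  have "{z \<in> {0<..t} \<times> space M. True} = {0<..t} \<times> space M" by simp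
  also have "\<dots> \<in> sets (predictable M (history M Y T P))"
    using True sets.top[of "history M Y T P 0"] by (intro predictable_rectangle) auto
  finally show ?thesis
    using intensity_identity[of t "\<lambda>_ _. True"] mean_compensator[OF point_process, of t] by simp
next
  case False
  then show ?thesis
    using causalD[OF causal_point_mean[of M P]] causalD[OF causal_immigrant_mean]
      causalD[OF causal_conv[OF causal_point_mean[of M P] causal_halfline]] by simp
qed

text \<open>At least \<open>n\<close> points come strictly before \<open>s\<close> if and only if \<open>N\<^sub>2(q) \<ge> n\<close> for some rational \<open>q < s\<close>, and
the sets \<open>(q, q + m] \<times> {N\<^sub>2(q) \<ge> n}\<close> are predictable rectangles.\<close>

lemma predictable_count_before:
  assumes t: "0 \<le> t"
  shows "{z \<in> {0<..t} \<times> space M. card (P (snd z) \<inter> {0<..<fst z}) < n}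
    \<in> sets (predictable M (history M Y T P))"
proof -
  let ?B = "\<lambda>q m. {q<..q + real m} \<times> {\<omega>\<in>space M. n \<le> num_points P q \<omega>}"
  have iff: "n \<le> card (P \<omega> \<inter> {0<..<s}) \<longleftrightarrow> (\<exists>q\<in>\<rat> \<inter> {0..}. q < s \<and> n \<le> num_points P q \<omega>)"
    if \<omega>: "\<omega> \<in> space M" and s: "0 < s" for \<omega> s
  proof
    let ?D = "P \<omega> \<inter> {0<..<s}"
    have fin: "finite ?D"
      by (rule finite_subset[OF _ finite_points[OF point_process \<omega>, of s]]) auto
    { assume n: "n \<le> card ?D"
      have "Max (insert 0 ?D) < s" using fin s by (subst Max_less_iff) auto
      then obtain q where q: "q \<in> \<rat>" "Max (insert 0 ?D) < q" "q < s"
        using Rats_dense_in_real by blast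
      have le: "v \<le> q" if "v \<in> insert 0 ?D" for v
      proof -
        have "v \<le> Max (insert 0 ?D)" using fin that by (intro Max_ge) auto
        then show ?thesis using q(2) by linarith
      qed
      then have "?D \<subseteq> P \<omega> \<inter> {0<..q}" by auto
      then have "card ?D \<le> num_points P q \<omega>"
        unfolding num_points_def by (intro card_mono finite_points[OF point_process \<omega>])
      then show "\<exists>q\<in>\<rat> \<inter> {0..}. q < s \<and> n \<le> num_points P q \<omega>"
        using q n le[of 0] by (intro bexI[of _ q]) auto }
    { assume "\<exists>q\<in>\<rat> \<inter> {0..}. q < s \<and> n \<le> num_points P q \<omega>"
      then obtain q where "q < s" "n \<le> num_points P q \<omega>" by auto
      moreover have "num_points P q \<omega> \<le> card ?D"
        unfolding num_points_def using \<open>q < s\<close> by (intro card_mono fin) auto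
      ultimately show "n \<le> card ?D" by simp }
  qed
  have "{z \<in> {0<..t} \<times> space M. card (P (snd z) \<inter> {0<..<fst z}) < n}
    = {0<..t} \<times> space M - (\<Union>q\<in>\<rat> \<inter> {0..}. \<Union>m. ?B q m)"
  proof (intro set_eqI)
    fix z :: "real \<times> 'a"
    obtain s \<omega> where z: "z = (s, \<omega>)" by (cases z)
    have "(\<exists>m::nat. s \<le> q + real m)" for q
      using real_arch_simple[of "s - q"] by (auto simp: algebra_simps)
    then show "z \<in> {z \<in> {0<..t} \<times> space M. card (P (snd z) \<inter> {0<..<fst z}) < n}
        \<longleftrightarrow> z \<in> {0<..t} \<times> space M - (\<Union>q\<in>\<rat> \<inter> {0..}. \<Union>m. ?B q m)"
      using iff[of \<omega> s] by (auto simp: z not_le[symmetric])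
  qed
  also have "\<dots> \<in> sets (predictable M (history M Y T P))"
  proof (intro sets.Diff sets.countable_UN'')
    show "countable (\<rat> \<inter> {0..} :: real set)" by (simp add: countable_rat countable_Int1)
    show "{0<..t} \<times> space M \<in> sets (predictable M (history M Y T P))"
      using t sets.top[of "history M Y T P 0"] by (intro predictable_rectangle) auto
    fix q :: real and m :: nat assume q: "q \<in> \<rat> \<inter> {0..}"
    have "{\<omega>\<in>space M. n \<le> num_points P q \<omega>} = num_points P q -` {n..} \<inter> space (history M Y T P q)" by auto
    also have "\<dots> \<in> sets (history M Y T P q)"
      using q by (intro measurable_sets[OF measurable_history_num_points]) auto
    finally show "?B q m \<in> sets (predictable M (history M Y T P))"
      using q by (intro predictable_rectangle) auto
  qed simp
  finally show ?thesis .
qed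

text \<open>As long as fewer than \<open>n\<close> points have occurred before \<open>s\<close>, all of these belong to the first \<open>n\<close>
points, so that the intensity of \<open>P\<close> can be written with excitation by the first \<open>n\<close> points only.
After that time the intensity of the stopped process is zero, whence the inequality.\<close>

lemma first_points_mean_le:
  assumes t: "0 \<le> t"
  shows "point_mean M (first_points n P) t \<le> immigrant_mean t + conv (point_mean M (first_points n P)) offspring t"
proof -
  let ?Q = "first_points n P"
  have "point_mean M ?Q t = (\<integral>\<^sup>+\<omega>. (\<integral>\<^sup>+s. indicator {0<..t} s * (if card (P \<omega> \<inter> {0<..<s}) < n then
      ennreal (\<mu> (s - last_renewal Y T s \<omega>)) + ennreal (\<Sum>v\<in>P \<omega> \<inter> {0<..<s}. \<eta> * h (s - v)) else 0) \<partial>lborel) \<partial>M)"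
    using intensity_identity[OF predictable_count_before[OF t]] by (simp add: first_points_def[abs_def])
  also have "\<dots> \<le> (\<integral>\<^sup>+\<omega>. (\<integral>\<^sup>+s. indicator {0<..t} s * (ennreal (\<mu> (s - last_renewal Y T s \<omega>)) +
      ennreal (\<Sum>v\<in>?Q \<omega> \<inter> {0<..<s}. \<eta> * h (s - v))) \<partial>lborel) \<partial>M)"
  proof (intro nn_integral_mono mult_left_mono)
    fix \<omega> s assume \<omega>: "\<omega> \<in> space M"
    have "P \<omega> \<inter> {0<..<s} \<subseteq> ?Q \<omega> \<inter> {0<..<s}" if "card (P \<omega> \<inter> {0<..<s}) < n"
    proof safe
      fix v assume v: "v \<in> P \<omega>" "v \<in> {0<..<s}"
      have "card (P \<omega> \<inter> {0<..<v}) \<le> card (P \<omega> \<inter> {0<..<s})"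
        using v by (intro card_mono finite_subset[OF _ finite_points[OF point_process \<omega>, of s]]) auto
      then show "v \<in> ?Q \<omega>" using v that by (simp add: first_points_def)
    qed
    then have "P \<omega> \<inter> {0<..<s} = ?Q \<omega> \<inter> {0<..<s}" if "card (P \<omega> \<inter> {0<..<s}) < n"
      using that by (auto simp: first_points_def)
    then show "(if card (P \<omega> \<inter> {0<..<s}) < n then
      ennreal (\<mu> (s - last_renewal Y T s \<omega>)) + ennreal (\<Sum>v\<in>P \<omega> \<inter> {0<..<s}. \<eta> * h (s - v)) else 0)
      \<le> ennreal (\<mu> (s - last_renewal Y T s \<omega>)) + ennreal (\<Sum>v\<in>?Q \<omega> \<inter> {0<..<s}. \<eta> * h (s - v))"
      by simp
  qed simp
  also have "\<dots> = immigrant_mean t + conv (point_mean M ?Q) offspring t"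
    by (intro mean_compensator simple_point_process_first_points point_process)
  finally show ?thesis .
qed

lemma immigrant_mean_mono: "mono immigrant_mean"
  unfolding immigrant_mean_def by (intro conv_mono_arg mono_renewal_fun)

lemma immigrant_mean_finite: "immigrant_mean t < \<infinity>"
proof -
  have "immigrant_mean t \<le> conv renewal_mean (halfline (n2 \<mu> F f)) t"
    unfolding immigrant_mean_def by (intro conv_mono) (auto simp: halfline_n2)
  also have "\<dots> \<le> renewal_mean t" by (simp add: renewal_fun_equation[of _ t])
  finally show ?thesis using renewal_mean_finite[of t] by (rule le_less_trans)
qed

text \<open>The renewal equation \<open>R = 1 + R * n\<^sub>2\<close>, convolved with \<open>F\<^sub>g\<close>.\<close>

lemma immigrant_mean_equation:
  "immigrant_mean t = conv (indicator {0..}) (halfline (Fg \<mu> F)) t +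
    conv immigrant_mean (halfline (n2 \<mu> F f)) t"
proof -
  have R: "renewal_mean = (\<lambda>t. indicator {0..} t + conv renewal_mean (halfline (n2 \<mu> F f)) t)"
    by (rule ext) (rule renewal_fun_equation, measurable)
  have "immigrant_mean t = conv (\<lambda>t. indicator {0..} t + conv renewal_mean (halfline (n2 \<mu> F f)) t) (halfline (Fg \<mu> F)) t"
    unfolding immigrant_mean_def using R by simp
  also have "\<dots> = conv (indicator {0..}) (halfline (Fg \<mu> F)) t +
      conv (conv renewal_mean (halfline (n2 \<mu> F f))) (halfline (Fg \<mu> F)) t"
    by (intro conv_add_left) auto
  also have "conv (conv renewal_mean (halfline (n2 \<mu> F f))) (halfline (Fg \<mu> F))
      = conv immigrant_mean (halfline (n2 \<mu> F f))"
    unfolding immigrant_mean_def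
    by (simp add: conv_assoc conv_commute[of "halfline (n2 \<mu> F f)" "halfline (Fg \<mu> F)"])
  finally show ?thesis .
qed

lemma nn_integral_offspring: "(\<integral>\<^sup>+t. offspring t \<partial>lborel) = ennreal \<eta>"
proof -
  have "(\<integral>\<^sup>+t. offspring t \<partial>lborel) = (\<integral>\<^sup>+t. indicator {0..} t * ennreal (\<eta> * h t) \<partial>lborel)"
    by (simp add: halfline_def)
  also have "\<dots> = ennreal (LBINT t:{0..}. \<eta> * h t)"
    using h_integrable eta_pos h_pos
    by (intro nn_integral_set_integrable) (auto intro: mult_nonneg_nonneg less_imp_le)
  finally show ?thesis by (simp add: h_integral)
qed

lemma offspring_exponent: "\<exists>\<theta>\<ge>0. nn_laplace \<theta> offspring \<le> ennreal (1/2)"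
  by (intro exists_exponent_nn_laplace_le) (auto simp: nn_integral_offspring)

text \<open>The stopped means are at most \<open>n\<close>, so the Gronwall estimate applies to them and gives a bound that
does not depend on \<open>n\<close>.\<close>

lemma events_mean_finite: "events_mean t < \<infinity>"
proof (cases "0 \<le> t")
  case True
  obtain \<theta> where \<theta>: "0 \<le> \<theta>" "nn_laplace \<theta> offspring \<le> ennreal (1/2)"
    using offspring_exponent by auto
  obtain \<alpha> where \<alpha>: "immigrant_mean t = ennreal \<alpha>" "0 \<le> \<alpha>"
    using immigrant_mean_finite[of t] by (cases "immigrant_mean t") auto
  have bound: "point_mean M (first_points n P) t \<le> ennreal (2 * \<alpha> * exp (\<theta> * t))" for n
  proof (rule volterra_gronwall[where B = "real n" and \<tau> = t])
    fix s assume s: "0 \<le> s" "s \<le> t"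
    have "point_mean M (first_points n P) s \<le> (\<integral>\<^sup>+\<omega>. of_nat n \<partial>M)"
      unfolding point_mean_def using num_points_first_points[OF point_process]
      by (intro nn_integral_mono) auto
    then show "point_mean M (first_points n P) s \<le> ennreal (real n)"
      by (simp add: emeasure_space_1 ennreal_of_nat_eq_real_of_nat)
    show "point_mean M (first_points n P) s \<le> ennreal \<alpha> + conv (point_mean M (first_points n P)) offspring s"
      using first_points_mean_le[OF s(1), of n] monoD[OF immigrant_mean_mono s(2)] \<alpha>(1)
      by (auto intro: order.trans add_right_mono)
  qed (use \<theta> \<alpha> True causal_point_mean in auto)
  have "events_mean t = (\<integral>\<^sup>+\<omega>. (SUP n. of_nat (num_points (first_points n P) t \<omega>)) \<partial>M)"
    unfolding point_mean_def
  proof (rule nn_integral_cong)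
    fix \<omega> assume \<omega>: "\<omega> \<in> space M"
    have "(SUP n. (of_nat (min n (num_points P t \<omega>)) :: ennreal)) = of_nat (num_points P t \<omega>)"
    proof (rule antisym)
      show "(SUP n. (of_nat (min n (num_points P t \<omega>)) :: ennreal)) \<le> of_nat (num_points P t \<omega>)"
        by (intro SUP_least) simp
      show "of_nat (num_points P t \<omega>) \<le> (SUP n. (of_nat (min n (num_points P t \<omega>)) :: ennreal))"
        by (rule SUP_upper2[of "num_points P t \<omega>"]) auto
    qed
    then show "of_nat (num_points P t \<omega>) = (SUP n. (of_nat (num_points (first_points n P) t \<omega>) :: ennreal))"
      using \<omega> by (simp add: num_points_first_points[OF point_process])
  qed
  also have "\<dots> = (SUP n. point_mean M (first_points n P) t)"
    unfolding point_mean_def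
  proof (rule nn_integral_monotone_convergence_SUP_AE)
    show "AE \<omega> in M. (of_nat (num_points (first_points n P) t \<omega>) :: ennreal) \<le> of_nat (num_points (first_points (Suc n) P) t \<omega>)" for n
      by (intro AE_I2) (simp add: num_points_first_points[OF point_process])
    show "(\<lambda>\<omega>. of_nat (num_points (first_points n P) t \<omega>) :: ennreal) \<in> borel_measurable M" for n
      using measurable_num_points_fixed[OF simple_point_process_first_points[OF point_process, of n], of t] by simp
  qed
  also have "\<dots> \<le> ennreal (2 * \<alpha> * exp (\<theta> * t))"
    by (intro SUP_least bound)
  finally show ?thesis by (simp add: le_less_trans)
next
  case False
  then show ?thesis using causalD[OF causal_point_mean[of M P], of t] by simp
qed

end

section \<open>The integral equation\<close>

lemma set_integral_conv:
  fixes \<alpha> \<beta> :: "real \<Rightarrow> real"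
  assumes [measurable]: "a \<in> borel_measurable borel" "b \<in> borel_measurable borel"
    and causal: "causal a" "causal b"
    and a: "\<And>s. 0 \<le> s \<Longrightarrow> s \<le> t \<Longrightarrow> a s = ennreal (\<alpha> s) \<and> 0 \<le> \<alpha> s"
    and b: "\<And>s. 0 \<le> s \<Longrightarrow> s \<le> t \<Longrightarrow> b s = ennreal (\<beta> s) \<and> 0 \<le> \<beta> s"
  shows "(LBINT v:{0..t}. \<alpha> (t - v) * \<beta> v) = enn2real (conv a b t)"
proof -
  have "a (t - v) * b v = indicator {0..t} v * ennreal (\<alpha> (t - v) * \<beta> v)" for v
  proof (cases "v \<in> {0..t}")
    case True
    then show ?thesis using a[of "t - v"] b[of v] by (simp add: ennreal_mult)
  next
    case False
    then show ?thesis using causalD[OF causal(1), of "t - v"] causalD[OF causal(2), of v]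
      by (cases "v < 0") auto
  qed
  note eq = this
  show ?thesis
    unfolding conv_def
  proof (rule set_integral_eq_nn_integral(1)[OF _ eq])
    show "(\<lambda>v. a (t - v) * b v) \<in> borel_measurable borel" by measurable
  qed (use a b in auto)
qed

context R2_Hawkes
begin

text \<open>The mean number of points within time \<open>t\<close> in the cluster of one immigrant, itself included. It is
\<open>1 + k\<^sub>2\<^sub>,\<^sub>0(t)\<close> by lemma k20_unique.\<close>

abbreviation mean_cluster :: "real \<Rightarrow> ennreal" where
  "mean_cluster \<equiv> renewal_fun offspring"

lemma mean_cluster_finite: "mean_cluster t < \<infinity>"
proof -
  obtain \<theta> where "0 \<le> \<theta>" "nn_laplace \<theta> offspring \<le> ennreal (1/2)"
    using offspring_exponent by auto
  moreover have "ennreal (1/2) < 1" by (simp add: ennreal_less_one_iff del: ennreal_half)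
  ultimately show ?thesis by (intro renewal_fun_finite[of _ \<theta>]) (auto intro: le_less_trans)
qed

lemma mean_cluster_ge_1: "0 \<le> t \<Longrightarrow> 1 \<le> mean_cluster t"
  by (simp add: renewal_fun_equation[of _ t])

lemma h_bound:
  assumes "0 \<le> t"
  shows "\<exists>C\<ge>0. \<forall>v\<in>{0..t}. \<bar>h v\<bar> \<le> C"
proof -
  obtain C where C: "\<forall>x\<in>h ` {0..t}. norm x \<le> C"
    using h_locally_bounded[OF assms] unfolding bounded_iff by blast
  then have "0 \<le> C" using assms by (auto intro: order.trans[OF abs_ge_zero])
  with C show ?thesis by auto
qed

lemma set_integrable_times_offspring:
  fixes D :: "real \<Rightarrow> real"
  assumes t: "0 \<le> t" and D: "set_integrable lborel {0..t} D"
  shows "set_integrable lborel {0..t} (\<lambda>v. D (t - v) * (\<eta> * h v))"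
proof -
  obtain C where C0: "0 \<le> C" and C: "\<And>v. v \<in> {0..t} \<Longrightarrow> \<bar>h v\<bar> \<le> C"
    using h_bound[OF t] by blast
  have "integrable lborel (\<lambda>v. indicator {0..t} (t + (-1) * v) * D (t + (-1) * v))"
    using D unfolding set_integrable_def real_scaleR_def
    by (intro lborel_integrable_real_affine) auto
  then have *: "integrable lborel (\<lambda>v. (\<eta> * C) * (indicator {0..t} (t - v) * D (t - v)))"
    by (intro integrable_mult_right) simp
  have D_meas: "(\<lambda>v. indicator {0..t} (t - v) * D (t - v)) \<in> borel_measurable lborel"
    using \<open>integrable lborel (\<lambda>v. indicator {0..t} (t + (-1) * v) * D (t + (-1) * v))\<close>
    by (auto dest: borel_measurable_integrable)
  have eq: "indicator {0..t} v * (D (t - v) * (\<eta> * h v)) =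
      \<eta> * ((indicator {0..t} (t - v) * D (t - v)) * (indicator {0..} v * h v))" for v
    by (auto simp: indicator_def)
  show ?thesis
    unfolding set_integrable_def real_scaleR_def
  proof (rule Bochner_Integration.integrable_bound[OF *])
    show "(\<lambda>v. indicator {0..t} v * (D (t - v) * (\<eta> * h v))) \<in> borel_measurable lborel"
      unfolding eq using D_meas measurable_h_real by measurable
    show "AE v in lborel. norm (indicator {0..t} v * (D (t - v) * (\<eta> * h v)))
        \<le> norm ((\<eta> * C) * (indicator {0..t} (t - v) * D (t - v)))"
    proof (rule AE_I2)
      fix v
      show "norm (indicator {0..t} v * (D (t - v) * (\<eta> * h v)))
        \<le> norm ((\<eta> * C) * (indicator {0..t} (t - v) * D (t - v)))"
      proof (cases "v \<in> {0..t}")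
        case True
        have "\<bar>D (t - v)\<bar> * (\<eta> * \<bar>h v\<bar>) \<le> \<bar>D (t - v)\<bar> * (\<eta> * C)"
          using C[OF True] eta_pos by (intro mult_left_mono) auto
        then show ?thesis using True eta_pos C0 by (simp add: abs_mult mult_ac)
      qed simp
    qed
  qed
qed

text \<open>A locally integrable solution is locally bounded since \<open>h\<close> is, and then the Gronwall estimate for
\<open>\<bar>D\<bar>\<close> shows that it vanishes.\<close>

lemma homogeneous_offspring_equation:
  fixes D :: "real \<Rightarrow> real"
  assumes int: "\<And>t. 0 \<le> t \<Longrightarrow> set_integrable lborel {0..t} D"
    and eq: "\<And>t. 0 \<le> t \<Longrightarrow> D t = (LBINT v:{0..t}. D (t - v) * (\<eta> * h v))"
    and \<tau>: "0 \<le> \<tau>"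
  shows "D \<tau> = 0"
proof -
  let ?d = "halfline (\<lambda>t. \<bar>D t\<bar>)"
  have [measurable]: "?d \<in> borel_measurable borel"
    using int by (intro measurable_halfline borel_measurable_on_halfline) (auto intro: set_integrable_abs)
  have le: "?d t \<le> conv ?d offspring t" if t: "0 \<le> t" for t
  proof -
    have "ennreal (norm (LBINT v:{0..t}. D (t - v) * (\<eta> * h v)))
        \<le> (\<integral>\<^sup>+v. ennreal (norm (indicator {0..t} v *\<^sub>R (D (t - v) * (\<eta> * h v)))) \<partial>lborel)"
      using set_integrable_times_offspring[OF t int[OF t]]
      unfolding set_lebesgue_integral_def set_integrable_def by (rule integral_norm_bound_ennreal)
    also have "\<dots> = conv ?d offspring t"
      unfolding conv_def
    proof (rule nn_integral_cong)
      fix v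
      show "ennreal (norm (indicator {0..t} v *\<^sub>R (D (t - v) * (\<eta> * h v)))) = ?d (t - v) * offspring v"
      proof (cases "v \<in> {0..t}")
        case True
        then show ?thesis
          using eta_pos h_pos[of v] by (simp add: abs_mult flip: ennreal_mult)
      next
        case False
        then show ?thesis by (cases "v < 0") auto
      qed
    qed
    finally show ?thesis using eq[OF t] t by simp
  qed
  obtain C where C0: "0 \<le> C" and C: "\<And>v. v \<in> {0..\<tau>} \<Longrightarrow> \<bar>h v\<bar> \<le> C"
    using h_bound[OF \<tau>] by blast
  define B where "B = \<eta> * C * (LBINT v:{0..\<tau>}. \<bar>D v\<bar>)"
  have I: "(\<integral>\<^sup>+v. indicator {0..\<tau>} v * ennreal \<bar>D v\<bar> \<partial>lborel) = ennreal (LBINT v:{0..\<tau>}. \<bar>D v\<bar>)"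
    using int[OF \<tau>] by (intro nn_integral_set_integrable set_integrable_abs) auto
  have I0: "0 \<le> (LBINT v:{0..\<tau>}. \<bar>D v\<bar>)"
    unfolding set_lebesgue_integral_def by (intro integral_nonneg_AE) auto
  have bd: "?d t \<le> ennreal B" if t: "0 \<le> t" "t \<le> \<tau>" for t
  proof -
    have "?d t \<le> conv offspring ?d t"
      using le[OF t(1)] conv_commute[of ?d offspring] by simp
    also have "\<dots> \<le> (\<integral>\<^sup>+v. ennreal (\<eta> * C) * (indicator {0..\<tau>} v * ennreal \<bar>D v\<bar>) \<partial>lborel)"
      unfolding conv_def
    proof (rule nn_integral_mono)
      fix v
      show "offspring (t - v) * ?d v \<le> ennreal (\<eta> * C) * (indicator {0..\<tau>} v * ennreal \<bar>D v\<bar>)"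
      proof (cases "v \<in> {0..t}")
        case True
        have "\<eta> * h (t - v) \<le> \<eta> * C" using C[of "t - v"] True t eta_pos by (intro mult_left_mono) auto
        then show ?thesis using True t by (auto intro!: mult_right_mono ennreal_leI)
      next
        case False
        then show ?thesis by (cases "v < 0") auto
      qed
    qed
    also have "\<dots> = ennreal (\<eta> * C) * ennreal (LBINT v:{0..\<tau>}. \<bar>D v\<bar>)"
    proof -
      have "(\<lambda>v. indicator {0..\<tau>} v * ennreal \<bar>D v\<bar>) = (\<lambda>v. indicator {0..\<tau>} v * ?d v)"
        by (auto simp: fun_eq_iff indicator_def)
      then have "(\<lambda>v. indicator {0..\<tau>} v * ennreal \<bar>D v\<bar>) \<in> borel_measurable lborel" by simp
      then show ?thesis using I by (subst nn_integral_cmult) auto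
    qed
    also have "\<dots> = ennreal B"
      using C0 I0 eta_pos by (simp add: B_def ennreal_mult)
    finally show ?thesis .
  qed
  have B: "0 \<le> B" using C0 I0 eta_pos by (simp add: B_def)
  obtain \<theta> where \<theta>: "0 \<le> \<theta>" "nn_laplace \<theta> offspring \<le> ennreal (1/2)"
    using offspring_exponent by auto
  have "?d \<tau> \<le> ennreal (2 * 0 * exp (\<theta> * \<tau>))"
    by (rule volterra_gronwall[where b = offspring and B = B and \<tau> = \<tau>]) (use bd le B \<theta> \<tau> in auto)
  then show ?thesis using \<tau> by (simp add: ennreal_eq_0_iff)
qed

lemma k20_solution: "k20_equation \<eta> h (\<lambda>t. enn2real (mean_cluster t) - 1)" (is "k20_equation \<eta> h ?k")
  unfolding k20_equation_def
proof (intro allI impI conjI)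
  fix t :: real assume t: "0 \<le> t"
  have nonneg: "0 \<le> ?k v" if "0 \<le> v" for v
    using mean_cluster_ge_1[OF that] mean_cluster_finite[of v]
    by (cases "mean_cluster v") auto
  show "set_integrable lborel {0..t} ?k"
  proof (rule set_integral_eq_nn_integral(2)[of "\<lambda>v. indicator {0..t} v * ennreal (?k v)"])
    have "(\<integral>\<^sup>+v. indicator {0..t} v * ennreal (?k v) \<partial>lborel) \<le> (\<integral>\<^sup>+v. mean_cluster t * indicator {0..t} v \<partial>lborel)"
    proof (rule nn_integral_mono)
      fix v
      have "ennreal (?k v) \<le> mean_cluster t" if "v \<le> t"
      proof -
        have "ennreal (?k v) \<le> ennreal (enn2real (mean_cluster v))" by (rule ennreal_leI) simp
        also have "\<dots> = mean_cluster v" using mean_cluster_finite[of v] by simp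
        finally show ?thesis using monoD[OF mono_renewal_fun that] by (rule order.trans)
      qed
      then show "indicator {0..t} v * ennreal (?k v) \<le> mean_cluster t * indicator {0..t} v"
        by (auto simp: indicator_def)
    qed
    also have "\<dots> < \<infinity>"
      using mean_cluster_finite[of t] t
      by (simp add: nn_integral_cmult ennreal_mult_less_top emeasure_lborel_Icc)
    finally show "(\<integral>\<^sup>+v. indicator {0..t} v * ennreal (?k v) \<partial>lborel) < \<infinity>" .
  qed (use nonneg in auto)
  have "(LBINT v:{0..t}. enn2real (mean_cluster (t - v)) * (\<eta> * h v)) = enn2real (conv mean_cluster offspring t)"
    using mean_cluster_finite eta_pos h_pos
    by (intro set_integral_conv causal_renewal_fun) (auto intro: less_imp_le)
  moreover have "enn2real (mean_cluster t) = 1 + enn2real (conv mean_cluster offspring t)"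
  proof -
    have "mean_cluster t = 1 + conv mean_cluster offspring t"
      using renewal_fun_equation[OF measurable_h, of t] t by simp
    then show ?thesis
      using mean_cluster_finite[of t] by (simp add: enn2real_plus)
  qed
  ultimately show "?k t = (LBINT v:{0..t}. (1 + ?k (t - v)) * (\<eta> * h v))"
    by simp
qed

text \<open>The difference of two solutions satisfies the homogeneous equation.\<close>

lemma k20_unique:
  assumes k: "k20_equation \<eta> h k" and t: "0 \<le> t"
  shows "1 + k t = enn2real (mean_cluster t)"
proof -
  let ?k = "\<lambda>t. enn2real (mean_cluster t) - 1"
  have int: "set_integrable lborel {0..t} k" "set_integrable lborel {0..t} ?k" if "0 \<le> t" for t
    using k k20_solution that unfolding k20_equation_def by auto
  have eq: "k t = (LBINT v:{0..t}. (1 + k (t - v)) * (\<eta> * h v))"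
    "?k t = (LBINT v:{0..t}. (1 + ?k (t - v)) * (\<eta> * h v))" if "0 \<le> t" for t
    using k k20_solution that unfolding k20_equation_def by blast+
  have one: "set_integrable lborel {0..t} (\<lambda>_. 1 :: real)" for t :: real
    by (intro borel_integrable_atLeastAtMost' continuous_intros)
  have "k t - ?k t = 0"
  proof (rule homogeneous_offspring_equation[of "\<lambda>t. k t - ?k t", OF _ _ t])
    fix t :: real assume t: "0 \<le> t"
    show "set_integrable lborel {0..t} (\<lambda>t. k t - ?k t)"
      by (intro set_integral_diff int t)
    have "k t - ?k t = (LBINT v:{0..t}. (1 + k (t - v)) * (\<eta> * h v)) - (LBINT v:{0..t}. (1 + ?k (t - v)) * (\<eta> * h v))"
      using eq[OF t] by simp
    also have "\<dots> = (LBINT v:{0..t}. (1 + k (t - v)) * (\<eta> * h v) - (1 + ?k (t - v)) * (\<eta> * h v))"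
      using set_integrable_times_offspring[OF t set_integral_add(1)[OF one int(1)[OF t]]]
        set_integrable_times_offspring[OF t set_integral_add(1)[OF one int(2)[OF t]]]
      by (intro set_integral_diff(2)[symmetric])
    also have "\<dots> = (LBINT v:{0..t}. (k (t - v) - ?k (t - v)) * (\<eta> * h v))"
      by (simp add: algebra_simps)
    finally show "k t - ?k t = (LBINT v:{0..t}. (k (t - v) - ?k (t - v)) * (\<eta> * h v))" .
  qed
  then show ?thesis by simp
qed

lemma nn_integral_n2_total: "(\<integral>\<^sup>+v. halfline (n2 \<mu> F f) v \<partial>lborel) = 1"
proof -
  have "emeasure (distr M borel (gap 0)) UNIV = 1"
    by (simp add: emeasure_distr emeasure_space_1)
  then show ?thesis by (simp add: distr_gap emeasure_density)
qed

lemma nn_integral_Fg_le: "(\<integral>\<^sup>+v. halfline (Fg \<mu> F) v \<partial>lborel) \<le> 1"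
proof -
  have "(\<integral>\<^sup>+v. halfline (Fg \<mu> F) v \<partial>lborel) \<le> (\<integral>\<^sup>+v. halfline (n2 \<mu> F f) v \<partial>lborel)"
    by (intro nn_integral_mono) (simp add: halfline_n2)
  then show ?thesis by (simp add: nn_integral_n2_total)
qed

lemma mono_events_mean: "mono events_mean"
  by (intro monoI point_mean_mono point_process)

text \<open>Both sides are solutions of \<open>x = A + x * \<eta>h\<close>. For the right-hand side \<open>z = K * F\<^sub>g + m\<^sub>2 * n\<^sub>2\<close>,
expand one factor \<open>K = 1 + K * \<eta>h\<close> and \<open>m\<^sub>2 = A + m\<^sub>2 * \<eta>h\<close>: the terms without \<open>\<eta>h\<close> add up to
\<open>1 * F\<^sub>g + A * n\<^sub>2 = A\<close> and the others to \<open>z * \<eta>h\<close>.\<close>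

lemma events_mean_renewal_equation:
  "events_mean t = conv mean_cluster (halfline (Fg \<mu> F)) t + conv events_mean (halfline (n2 \<mu> F f)) t"
proof -
  let ?Fg = "halfline (Fg \<mu> F)" and ?n2 = "halfline (n2 \<mu> F f)"
  define z where "z t = conv mean_cluster ?Fg t + conv events_mean ?n2 t" for t
  have [measurable]: "z \<in> borel_measurable borel" unfolding z_def by measurable
  have K: "mean_cluster = (\<lambda>t. indicator {0..} t + conv mean_cluster offspring t)"
    by (rule ext) (rule renewal_fun_equation, measurable)
  have m: "events_mean = (\<lambda>t. immigrant_mean t + conv events_mean offspring t)"
    by (rule ext) (rule events_mean_equation)
  have z: "z t = immigrant_mean t + conv z offspring t" for t
  proof -
    have "conv mean_cluster ?Fg t = conv (indicator {0..}) ?Fg t + conv (conv mean_cluster ?Fg) offspring t"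
    proof -
      have "conv mean_cluster ?Fg t = conv (\<lambda>t. indicator {0..} t + conv mean_cluster offspring t) ?Fg t"
        using K by simp
      also have "\<dots> = conv (indicator {0..}) ?Fg t + conv (conv mean_cluster offspring) ?Fg t"
        by (intro conv_add_left) auto
      also have "conv (conv mean_cluster offspring) ?Fg = conv (conv mean_cluster ?Fg) offspring"
        by (simp add: conv_assoc conv_commute[of offspring ?Fg])
      finally show ?thesis .
    qed
    moreover have "conv events_mean ?n2 t = conv immigrant_mean ?n2 t + conv (conv events_mean ?n2) offspring t"
    proof -
      have "conv events_mean ?n2 t = conv (\<lambda>t. immigrant_mean t + conv events_mean offspring t) ?n2 t"
        using m by simp
      also have "\<dots> = conv immigrant_mean ?n2 t + conv (conv events_mean offspring) ?n2 t"
        by (intro conv_add_left) auto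
      also have "conv (conv events_mean offspring) ?n2 = conv (conv events_mean ?n2) offspring"
        by (simp add: conv_assoc conv_commute[of offspring ?n2])
      finally show ?thesis .
    qed
    moreover have "conv z offspring t = conv (conv mean_cluster ?Fg) offspring t + conv (conv events_mean ?n2) offspring t"
      unfolding z_def[abs_def] by (intro conv_add_left) auto
    ultimately show ?thesis
      by (simp add: z_def immigrant_mean_equation[of t] ac_simps)
  qed
  obtain \<theta> where \<theta>: "0 \<le> \<theta>" "nn_laplace \<theta> offspring \<le> ennreal (1/2)"
    using offspring_exponent by auto
  have "events_mean = z"
  proof (rule volterra_unique[where \<theta> = \<theta> and a = immigrant_mean and b = offspring])
    show "causal z"
      using causal_conv[OF causal_renewal_fun[OF causal_halfline] causal_halfline]
        causal_conv[OF causal_point_mean causal_halfline]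
      by (simp add: causal_def z_def)
    have mono: "mono (conv mean_cluster ?Fg)" "mono (conv events_mean ?n2)"
      by (intro conv_mono_arg mono_renewal_fun mono_events_mean)+
    show "mono z"
      unfolding z_def using monoD[OF mono(1)] monoD[OF mono(2)] by (intro monoI add_mono) auto
    show "z t < \<infinity>" for t
    proof -
      have "conv mean_cluster ?Fg t \<le> mean_cluster t" "conv events_mean ?n2 t \<le> events_mean t"
        by (intro conv_le_of_mono mono_renewal_fun mono_events_mean;
            simp add: nn_integral_Fg_le nn_integral_n2_total)+
      then show ?thesis
        using mean_cluster_finite[of t] events_mean_finite[of t]
        by (auto simp: z_def intro: le_less_trans)
    qed
    show "z t = immigrant_mean t + conv z offspring t" for t by (rule z)
    show "events_mean t = immigrant_mean t + conv events_mean offspring t" for t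
      by (rule events_mean_equation)
  qed (use \<theta> events_mean_finite mono_events_mean causal_point_mean in auto)
  then show ?thesis by (simp add: z_def)
qed

lemma integrable_num_points: "integrable M (\<lambda>\<omega>. real (num_points P t \<omega>))"
proof (rule integrableI_nonneg)
  note [measurable] = measurable_num_points_fixed[OF point_process, of t]
  show "(\<lambda>\<omega>. real (num_points P t \<omega>)) \<in> borel_measurable M" by measurable
  show "(\<integral>\<^sup>+\<omega>. ennreal (real (num_points P t \<omega>)) \<partial>M) < \<infinity>"
    using events_mean_finite[of t] by (simp add: point_mean_def ennreal_of_nat_eq_real_of_nat)
qed simp

lemma m2_eq: "ennreal (m2 M P t) = events_mean t"
  unfolding m2_def point_mean_def using integrable_num_points[of t]
  by (subst nn_integral_eq_integral[symmetric]) (auto simp: ennreal_of_nat_eq_real_of_nat)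

lemma m2_nonneg: "0 \<le> m2 M P t"
  unfolding m2_def by simp

lemma m2_integral_equation:
  assumes k: "k20_equation \<eta> h k" and t: "0 \<le> t"
  shows "m2 M P t = Psi2 \<mu> F k t + (LBINT v:{0..t}. m2 M P (t - v) * n2 \<mu> F f v)"
proof -
  have "Psi2 \<mu> F k t = enn2real (conv mean_cluster (halfline (Fg \<mu> F)) t)"
    unfolding Psi2_def
    using mean_cluster_finite k20_unique[OF k] Fg_nonneg
    by (intro set_integral_conv causal_renewal_fun) auto
  moreover have "(LBINT v:{0..t}. m2 M P (t - v) * n2 \<mu> F f v) = enn2real (conv events_mean (halfline (n2 \<mu> F f)) t)"
    using m2_eq m2_nonneg n2_nonneg
    by (intro set_integral_conv causal_point_mean) auto
  moreover have "enn2real (events_mean t) =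
      enn2real (conv mean_cluster (halfline (Fg \<mu> F)) t) + enn2real (conv events_mean (halfline (n2 \<mu> F f)) t)"
    using events_mean_finite[of t] unfolding events_mean_renewal_equation[of t]
    by (intro enn2real_plus) auto
  moreover have "m2 M P t = enn2real (events_mean t)"
    using m2_nonneg by (simp flip: m2_eq)
  ultimately show ?thesis by simp
qed

end

section \<open>Laplace transforms\<close>

text \<open>The transform at a complex point, for the same class of functions as convolution. It agrees with
\<open>laplace\<close> by lemma laplace_eq_complex_laplace, and it converges absolutely exactly if \<open>nn_laplace\<close> is
finite at the real part of the point.\<close>

definition complex_laplace :: "complex \<Rightarrow> (real \<Rightarrow> ennreal) \<Rightarrow> complex" where
  "complex_laplace s a = (LINT t|lborel. exp (- (s * of_real t)) * of_real (enn2real (a t)))"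

lemma norm_laplace_integrand:
  "norm (exp (- (s * of_real t)) * of_real (enn2real x) :: complex) = exp (- (Re s * t)) * enn2real x"
  by (simp add: norm_mult)

lemma ennreal_norm_laplace_integrand:
  assumes "x < \<infinity>"
  shows "ennreal (norm (exp (- (s * of_real t)) * of_real (enn2real x) :: complex)) = ennreal (exp (- (Re s * t))) * x"
  using assms unfolding norm_laplace_integrand by (simp add: ennreal_mult)

lemma laplace_eq_complex_laplace:
  fixes s :: complex
  assumes "\<And>t. 0 \<le> t \<Longrightarrow> 0 \<le> w t"
  shows "laplace w s = complex_laplace s (halfline w)"
  unfolding laplace_def complex_laplace_def set_lebesgue_integral_def laplace_kernel_def
  using assms by (intro Bochner_Integration.integral_cong) (auto simp: halfline_def indicator_def)

lemma integrable_laplace_integrand_iff: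
  assumes [measurable]: "a \<in> borel_measurable borel" and finite: "\<And>t. a t < \<infinity>"
  shows "integrable lborel (\<lambda>t. exp (- (s * of_real t)) * of_real (enn2real (a t)) :: complex)
    \<longleftrightarrow> nn_laplace (Re s) a < \<infinity>"
  unfolding integrable_iff_bounded ennreal_norm_laplace_integrand[OF finite] nn_laplace_def
  by simp

lemma laplace_exists_iff:
  fixes s :: complex
  assumes nonneg: "\<And>t. 0 \<le> t \<Longrightarrow> 0 \<le> w t" and meas: "halfline w \<in> borel_measurable borel"
  shows "laplace_exists w s \<longleftrightarrow> nn_laplace (Re s) (halfline w) < \<infinity>"
proof -
  have "indicator {0..} t *\<^sub>R laplace_kernel w s t = exp (- (s * of_real t)) * of_real (enn2real (halfline w t))" for t
    using nonneg[of t] by (auto simp: halfline_def indicator_def laplace_kernel_def)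
  then show ?thesis
    unfolding laplace_exists_def set_integrable_def
    using integrable_laplace_integrand_iff[OF meas, of s]
    by (simp add: halfline_def indicator_def split: if_splits)
qed

lemma norm_complex_laplace_le:
  assumes [measurable]: "a \<in> borel_measurable borel" and finite: "\<And>t. a t < \<infinity>"
    and int: "nn_laplace (Re s) a < \<infinity>"
  shows "ennreal (norm (complex_laplace s a)) \<le> nn_laplace (Re s) a"
proof -
  have "ennreal (norm (complex_laplace s a)) \<le>
      (\<integral>\<^sup>+t. ennreal (norm (exp (- (s * of_real t)) * of_real (enn2real (a t)) :: complex)) \<partial>lborel)"
    unfolding complex_laplace_def
    using int integrable_laplace_integrand_iff[OF assms(1,2)] by (intro integral_norm_bound_ennreal) simp
  then show ?thesis
    unfolding ennreal_norm_laplace_integrand[OF finite] nn_laplace_def .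
qed

lemma complex_laplace_add:
  assumes [measurable]: "a \<in> borel_measurable borel" "b \<in> borel_measurable borel"
    and finite: "\<And>t. a t < \<infinity>" "\<And>t. b t < \<infinity>"
    and int: "nn_laplace (Re s) a < \<infinity>" "nn_laplace (Re s) b < \<infinity>"
  shows "complex_laplace s (\<lambda>t. a t + b t) = complex_laplace s a + complex_laplace s b"
proof -
  have "enn2real (a t + b t) = enn2real (a t) + enn2real (b t)" for t
    using finite[of t] by (simp add: enn2real_plus)
  then show ?thesis
    unfolding complex_laplace_def
    using int integrable_laplace_integrand_iff[OF assms(1) finite(1), of s]
      integrable_laplace_integrand_iff[OF assms(2) finite(2), of s]
    by (subst Bochner_Integration.integral_add[symmetric]) (auto simp: distrib_left)
qed

lemma complex_laplace_conv:
  assumes [measurable]: "a \<in> borel_measurable borel" "b \<in> borel_measurable borel"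
    and finite: "\<And>t. a t < \<infinity>" "\<And>t. b t < \<infinity>"
    and int: "nn_laplace (Re s) a < \<infinity>" "nn_laplace (Re s) b < \<infinity>"
  shows "complex_laplace s (conv a b) = complex_laplace s a * complex_laplace s b"
proof -
  define A where "A t = exp (- (s * of_real t)) * (of_real (enn2real (a t)) :: complex)" for t
  define B where "B t = exp (- (s * of_real t)) * (of_real (enn2real (b t)) :: complex)" for t
  have [measurable]: "A \<in> borel_measurable borel" "B \<in> borel_measurable borel"
    unfolding A_def B_def by measurable
  have AB: "A (t - v) * B v = exp (- (s * of_real t)) * of_real (enn2real (a (t - v)) * enn2real (b v))" for t v
  proof -
    have "exp (- (s * of_real t)) = exp (- (s * of_real (t - v))) * exp (- (s * of_real v))"
      by (simp add: algebra_simps flip: exp_add)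
    then show ?thesis by (simp add: A_def B_def)
  qed
  have nab: "enn2real (a (t - v)) * enn2real (b v) = enn2real (a (t - v) * b v)" for t v
    by (simp add: enn2real_mult)
  have norm_AB: "ennreal (norm (A (t - v) * B v)) = ennreal (exp (- (Re s * t))) * (a (t - v) * b v)" for t v
    unfolding AB nab using finite by (intro ennreal_norm_laplace_integrand) (auto simp: ennreal_mult_less_top)
  have "integrable (lborel \<Otimes>\<^sub>M lborel) (\<lambda>(t, v). A (t - v) * B v)"
  proof (rule integrableI_bounded)
    have "(\<integral>\<^sup>+p. ennreal (norm (case p of (t, v) \<Rightarrow> A (t - v) * B v)) \<partial>(lborel \<Otimes>\<^sub>M lborel))
        = (\<integral>\<^sup>+t. (\<integral>\<^sup>+v. ennreal (norm (A (t - v) * B v)) \<partial>lborel) \<partial>lborel)"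
      by (subst lborel.nn_integral_fst[symmetric]) auto
    also have "\<dots> = nn_laplace (Re s) (conv a b)"
      unfolding norm_AB nn_laplace_def conv_def by (simp add: nn_integral_cmult)
    also have "\<dots> < \<infinity>"
      using int by (simp add: nn_laplace_conv ennreal_mult_less_top)
    finally show "(\<integral>\<^sup>+p. ennreal (norm (case p of (t, v) \<Rightarrow> A (t - v) * B v)) \<partial>(lborel \<Otimes>\<^sub>M lborel)) < \<infinity>" .
  qed measurable
  then have "(LINT v|lborel. (LINT t|lborel. A (t - v) * B v)) = (LINT t|lborel. (LINT v|lborel. A (t - v) * B v))"
    by (rule lborel_pair.Fubini_integral)
  also have "(LINT t|lborel. (LINT v|lborel. A (t - v) * B v)) = complex_laplace s (conv a b)"
    unfolding complex_laplace_def
  proof (rule Bochner_Integration.integral_cong[OF refl])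
    fix t
    have "(LINT v|lborel. A (t - v) * B v)
        = exp (- (s * of_real t)) * (LINT v|lborel. of_real (enn2real (a (t - v) * b v)))"
      unfolding AB nab by simp
    also have "(LINT v|lborel. of_real (enn2real (a (t - v) * b v))) = complex_of_real (LINT v|lborel. enn2real (a (t - v) * b v))"
      by (rule integral_complex_of_real)
    also have "(LINT v|lborel. enn2real (a (t - v) * b v)) = enn2real (\<integral>\<^sup>+v. ennreal (enn2real (a (t - v) * b v)) \<partial>lborel)"
      by (rule integral_eq_nn_integral) auto
    also have "(\<integral>\<^sup>+v. ennreal (enn2real (a (t - v) * b v)) \<partial>lborel) = conv a b t"
      unfolding conv_def using finite by (intro nn_integral_cong) (simp add: ennreal_mult_less_top)
    finally show "(LINT v|lborel. A (t - v) * B v) = exp (- (s * of_real t)) * of_real (enn2real (conv a b t))" .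
  qed
  also have "(LINT v|lborel. (LINT t|lborel. A (t - v) * B v)) = (LINT v|lborel. (LINT t|lborel. A t) * B v)"
  proof (rule Bochner_Integration.integral_cong[OF refl])
    fix v
    have "(LINT t|lborel. A (t - v)) = (LINT t|lborel. A t)"
      using lborel_integral_real_affine[of 1 A "- v"] by simp
    then show "(LINT t|lborel. A (t - v) * B v) = (LINT t|lborel. A t) * B v" by simp
  qed
  also have "\<dots> = complex_laplace s a * complex_laplace s b"
    by (simp add: complex_laplace_def A_def[symmetric] B_def[symmetric])
  finally show ?thesis ..
qed

lemma nn_laplace_indicator:
  assumes "0 < \<sigma>"
  shows "nn_laplace \<sigma> (indicator {0..}) = ennreal (1 / \<sigma>)"
proof -
  have "((\<lambda>t. - exp (- (\<sigma> * t)) / \<sigma>) \<longlongrightarrow> 0) at_top"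
    using assms by real_asymp
  then have "(\<integral>\<^sup>+t. ennreal (exp (- (\<sigma> * t))) * indicator {0..} t \<partial>lborel) = 0 - (- exp (- (\<sigma> * 0)) / \<sigma>)"
    using assms by (intro nn_integral_FTC_atLeast) (auto intro!: derivative_eq_intros)
  then show ?thesis by (simp add: nn_laplace_def)
qed

lemma complex_laplace_indicator:
  assumes s: "0 < Re s"
  shows "complex_laplace s (indicator {0..}) = 1 / s"
proof -
  let ?e = "\<lambda>t. exp (- (s * of_real t)) :: complex"
  have s0: "s \<noteq> 0" using s by auto
  have "integrable lborel (\<lambda>t. ?e t * of_real (enn2real (indicator {0..} t)))"
    using nn_laplace_indicator[OF s] by (subst integrable_laplace_integrand_iff) (auto simp: indicator_def)
  moreover have "?e t * of_real (enn2real (indicator {0..} t)) = indicator {0..} t *\<^sub>R ?e t" for t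
    by (simp add: indicator_def)
  ultimately have int: "set_integrable lborel {0..} ?e" by (simp add: set_integrable_def)
  have "(LBINT t=ereal 0..\<infinity>. ?e t) = 0 - (- (?e 0 / s))"
  proof (rule interval_integral_FTC_integrable)
    show "set_integrable lborel (einterval (ereal 0) \<infinity>) ?e"
      by (rule set_integrable_subset[OF int]) (auto simp: einterval_def)
    show "((\<lambda>t. - (?e t / s)) has_vector_derivative ?e t) (at t)" for t
    proof -
      have "((\<lambda>z. - (exp (- (s * z)) / s)) has_field_derivative ?e t) (at (of_real t))"
        using s0 by (auto intro!: derivative_eq_intros)
      from has_vector_derivative_real_field[OF this] show ?thesis by (simp add: o_def)
    qed
    have "((\<lambda>t. - (?e t / s)) \<longlongrightarrow> 0) at_top"
    proof (rule tendsto_norm_zero_cancel)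
      have "norm (- (?e t / s)) = exp (- (Re s * t)) / norm s" for t
        by (simp add: norm_divide)
      moreover have "((\<lambda>t. exp (- (Re s * t)) / norm s) \<longlongrightarrow> 0) at_top"
        using s s0 by real_asymp
      ultimately show "((\<lambda>t. norm (- (?e t / s))) \<longlongrightarrow> 0) at_top" by simp
    qed
    then show "(((\<lambda>t. - (?e t / s)) \<circ> real_of_ereal) \<longlongrightarrow> 0) (at_left \<infinity>)"
      by (simp add: ereal_tendsto_simps)
    have "((\<lambda>t. - (?e t / s)) \<longlongrightarrow> - (?e 0 / s)) (at_right 0)"
      using s0 by (intro tendsto_intros) auto
    then show "(((\<lambda>t. - (?e t / s)) \<circ> real_of_ereal) \<longlongrightarrow> - (?e 0 / s)) (at_right (ereal 0))"
      by (simp only: ereal_tendsto_simps)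
  qed (auto intro!: continuous_intros)
  then have "(LBINT t:{0<..}. ?e t) = 1 / s"
    by (simp add: interval_integral_to_infinity_eq)
  moreover have "(LBINT t:{0<..}. ?e t) = complex_laplace s (indicator {0..})"
    unfolding complex_laplace_def set_lebesgue_integral_def
  proof (rule integral_cong_AE)
    show "AE t in lborel. indicator {0<..} t *\<^sub>R ?e t = ?e t * of_real (enn2real (indicator {0..} t))"
      using AE_lborel_singleton[of "0::real"] by eventually_elim (auto simp: indicator_def)
  qed auto
  ultimately show ?thesis by simp
qed

context R2_Hawkes
begin

lemma nn_laplace_offspring_finite:
  assumes "0 \<le> \<sigma>"
  shows "nn_laplace \<sigma> offspring < \<infinity>"
proof -
  have "nn_laplace \<sigma> offspring \<le> (\<integral>\<^sup>+t. offspring t \<partial>lborel)"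
    unfolding nn_laplace_def
  proof (rule nn_integral_mono)
    fix t
    show "ennreal (exp (- (\<sigma> * t))) * offspring t \<le> offspring t"
    proof (cases "0 \<le> t")
      case True
      then have "ennreal (exp (- (\<sigma> * t))) \<le> ennreal 1" using assms by (intro ennreal_leI) simp
      then show ?thesis using mult_right_mono[of _ 1 "offspring t"] by simp
    qed simp
  qed
  then show ?thesis by (simp add: nn_integral_offspring le_less_trans)
qed

lemma nn_laplace_offspring:
  assumes "0 \<le> \<sigma>"
  shows "nn_laplace \<sigma> offspring = ennreal (\<eta> * laplace h \<sigma>)"
proof -
  have "\<eta> * laplace h \<sigma> = (LBINT t:{0..}. exp (- (\<sigma> * t)) * (\<eta> * h t))"
    unfolding laplace_def laplace_kernel_def
    by (subst set_integral_mult_right[symmetric]) (simp add: mult.left_commute)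
  also have "\<dots> = enn2real (nn_laplace \<sigma> offspring)"
    unfolding nn_laplace_def
  proof (rule set_integral_eq_nn_integral(1))
    show "(\<lambda>t. ennreal (exp (- (\<sigma> * t))) * offspring t) \<in> borel_measurable borel" by measurable
    fix v
    show "ennreal (exp (- (\<sigma> * v))) * offspring v = indicator {0..} v * ennreal (exp (- (\<sigma> * v)) * (\<eta> * h v))"
      using eta_pos h_pos[of v] by (cases "0 \<le> v") (auto simp: ennreal_mult)
    show "0 \<le> exp (- (\<sigma> * v)) * (\<eta> * h v)" if "v \<in> {0..}"
      using that eta_pos h_pos[of v] by (intro mult_nonneg_nonneg) auto
  qed
  finally show ?thesis using nn_laplace_offspring_finite[OF assms] by simp
qed

lemma complex_laplace_offspring:
  fixes s :: complex
  shows "complex_laplace s offspring = \<eta> * laplace h s"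
proof -
  have "laplace h s * \<eta> = (LBINT t:{0..}. laplace_kernel h s t * \<eta>)"
    unfolding laplace_def by simp
  also have "\<dots> = laplace (\<lambda>t. \<eta> * h t) s"
    unfolding laplace_def laplace_kernel_def by (simp add: mult_ac)
  also have "\<dots> = complex_laplace s offspring"
    using eta_pos h_pos by (intro laplace_eq_complex_laplace) (auto intro: mult_nonneg_nonneg less_imp_le)
  finally show ?thesis by (simp add: mult.commute)
qed

lemma halfline_finite: "halfline \<phi> t < \<infinity>"
  by (cases "0 \<le> t") auto

lemma immigrant_mean_ge: "conv (indicator {0..}) (halfline (Fg \<mu> F)) t \<le> immigrant_mean t"
  by (simp add: immigrant_mean_equation)

lemma immigrant_mean_le_events_mean: "immigrant_mean t \<le> events_mean t"
  by (simp add: events_mean_equation)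

text \<open>\<open>F\<close> is right-continuous and \<open>F(0) = 0\<close>, as \<open>Y\<^sub>1\<close> is positive.\<close>

lemma F_less_1: "\<exists>\<epsilon>>0. F \<epsilon> < 1"
proof -
  interpret D: real_distribution "distr M borel (Y 1)"
    using measurable_Y[of 1] by (intro real_distribution_distr) simp
  have "F 0 = 0"
  proof -
    have "{\<omega>\<in>space M. Y 1 \<omega> \<le> 0} = {}" using Y_pos[of 1] by (force simp: not_le)
    then show ?thesis by (simp only: F_prob[of 1] measure_empty order.refl)
  qed
  moreover have "(F \<longlongrightarrow> F 0) (at_right 0)"
    using D.cdf_is_right_cont[of 0] Y_cdf[of 1] by (simp add: continuous_within)
  ultimately have "eventually (\<lambda>x. F x < 1) (at_right 0)"
    by (intro order_tendstoD(2)[where y = "F 0"]) auto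
  moreover have "eventually (\<lambda>x::real. 0 < x) (at_right 0)"
    by (simp add: eventually_at_right_less)
  ultimately have "eventually (\<lambda>x. 0 < x \<and> F x < 1) (at_right 0)"
    by eventually_elim simp
  then show ?thesis
    using eventually_happens'[of "at_right (0::real)"] trivial_limit_at_right_real by blast
qed

text \<open>\<open>F\<^sub>g > 0\<close> on an interval \<open>[0, \<epsilon>]\<close>, hence \<open>A(\<epsilon>) \<ge> \<integral>\<^sub>0\<^sup>\<epsilon> F\<^sub>g > 0\<close>, and \<open>A\<close> is increasing.\<close>

lemma immigrant_mean_positive: "\<exists>c t\<^sub>0. 0 < c \<and> 0 \<le> t\<^sub>0 \<and> (\<forall>t\<ge>t\<^sub>0. ennreal c \<le> immigrant_mean t)"
proof -
  obtain \<epsilon> where \<epsilon>: "0 < \<epsilon>" "F \<epsilon> < 1" using F_less_1 by blast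
  let ?\<Phi> = "conv (indicator {0..}) (halfline (Fg \<mu> F)) \<epsilon>"
  have "?\<Phi> \<noteq> 0"
  proof
    assume "?\<Phi> = 0"
    then have "AE v in lborel. (indicator {0..} (\<epsilon> - v) :: ennreal) * halfline (Fg \<mu> F) v = 0"
      unfolding conv_def by (subst (asm) nn_integral_0_iff_AE) auto
    then have "AE v in lborel. v \<notin> {0..\<epsilon>}"
    proof eventually_elim
      case (elim v)
      show ?case
      proof
        assume v: "v \<in> {0..\<epsilon>}"
        have "F v \<le> F \<epsilon>" using v monoD[OF F_bounds(3)] by auto
        then have "0 < Fg \<mu> F v" using \<epsilon> g_pos[of v] v by (simp add: Fg_def)
        then show False using elim v by (simp add: ennreal_eq_0_iff)
      qed
    qed
    then have "emeasure lborel {0..\<epsilon>} = 0"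
      by (intro AE_iff_measurable[THEN iffD1, of _ _ "\<lambda>v. v \<notin> {0..\<epsilon>}"]) auto
    then show False using \<epsilon> by (simp add: emeasure_lborel_Icc_eq)
  qed
  moreover have "?\<Phi> < \<infinity>"
    using immigrant_mean_ge immigrant_mean_finite by (rule le_less_trans)
  ultimately obtain c where c: "?\<Phi> = ennreal c" "0 < c"
    by (cases ?\<Phi>) (auto simp: less_le)
  have "ennreal c \<le> immigrant_mean t" if "\<epsilon> \<le> t" for t
    using immigrant_mean_ge[of \<epsilon>] monoD[OF immigrant_mean_mono that] c by simp
  with c \<epsilon> show ?thesis by (intro exI[of _ c] exI[of _ \<epsilon>]) auto
qed

text \<open>\<open>A\<close>, and with it \<open>m\<^sub>2 \<ge> A\<close>, is at least a positive constant from some time on. So its transform is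
positive, and it diverges at every \<open>\<sigma> \<le> 0\<close>.\<close>

lemma nn_laplace_immigrant_mean_pos: "0 < nn_laplace \<sigma> immigrant_mean"
  and nn_laplace_events_mean_finite_imp: "nn_laplace \<sigma> events_mean < \<infinity> \<Longrightarrow> 0 < \<sigma>"
proof -
  obtain c t\<^sub>0 where c: "0 < c" "0 \<le> t\<^sub>0" "\<And>t. t\<^sub>0 \<le> t \<Longrightarrow> ennreal c \<le> immigrant_mean t"
    using immigrant_mean_positive by blast
  have ge: "(\<integral>\<^sup>+t. ennreal (exp (- (\<sigma> * t)) * c) * indicator {t\<^sub>0..} t \<partial>lborel) \<le> nn_laplace \<sigma> immigrant_mean"
    unfolding nn_laplace_def using c
    by (intro nn_integral_mono) (auto simp: indicator_def ennreal_mult intro!: mult_left_mono)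
  show "0 < nn_laplace \<sigma> immigrant_mean"
  proof (rule ccontr)
    assume "\<not> ?thesis"
    then have "(\<integral>\<^sup>+t. ennreal (exp (- (\<sigma> * t)) * c) * indicator {t\<^sub>0..} t \<partial>lborel) = 0"
      using ge by simp
    then have "AE t in lborel. ennreal (exp (- (\<sigma> * t)) * c) * indicator {t\<^sub>0..} t = 0"
      by (subst (asm) nn_integral_0_iff_AE) auto
    then have "AE t in lborel. t \<notin> {t\<^sub>0..t\<^sub>0 + 1}"
      by eventually_elim (use c in \<open>auto simp: indicator_def ennreal_eq_0_iff mult_le_0_iff not_le\<close>)
    then have "emeasure lborel {t\<^sub>0..t\<^sub>0 + 1} = 0"
      by (intro AE_iff_measurable[THEN iffD1, of _ _ "\<lambda>v. v \<notin> {t\<^sub>0..t\<^sub>0 + 1}"]) auto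
    then show False by simp
  qed
  show "0 < \<sigma>" if fin: "nn_laplace \<sigma> events_mean < \<infinity>"
  proof (rule ccontr)
    assume "\<not> 0 < \<sigma>"
    have "(\<integral>\<^sup>+t. ennreal c * indicator {t\<^sub>0..} t \<partial>lborel)
        \<le> (\<integral>\<^sup>+t. ennreal (exp (- (\<sigma> * t)) * c) * indicator {t\<^sub>0..} t \<partial>lborel)"
    proof (rule nn_integral_mono)
      fix t
      have "1 * c \<le> exp (- (\<sigma> * t)) * c" if "t\<^sub>0 \<le> t"
      proof (rule mult_right_mono)
        have "\<sigma> * t \<le> 0" using \<open>\<not> 0 < \<sigma>\<close> that c(2) by (auto simp: mult_le_0_iff)
        then show "1 \<le> exp (- (\<sigma> * t))" by simp
      qed (use c in simp)
      then show "ennreal c * indicator {t\<^sub>0..} t \<le> ennreal (exp (- (\<sigma> * t)) * c) * indicator {t\<^sub>0..} t"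
        by (auto simp: indicator_def intro: ennreal_leI)
    qed
    also have "\<dots> \<le> nn_laplace \<sigma> events_mean"
      using ge nn_laplace_mono[OF immigrant_mean_le_events_mean] by (rule order.trans)
    also have "(\<integral>\<^sup>+t. ennreal c * indicator {t\<^sub>0..} t \<partial>lborel) = \<infinity>"
    proof -
      have "emeasure lborel {t\<^sub>0..} = \<infinity>"
      proof (rule ccontr)
        assume "emeasure lborel {t\<^sub>0..} \<noteq> \<infinity>"
        then obtain l where l: "emeasure lborel {t\<^sub>0..} = ennreal l" "0 \<le> l"
          by (cases "emeasure lborel {t\<^sub>0..}") auto
        have "emeasure lborel {t\<^sub>0..t\<^sub>0 + (l + 1)} \<le> emeasure lborel {t\<^sub>0..}"
          by (intro emeasure_mono) auto
        then show False using l by simp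
      qed
      then show ?thesis using c by (simp add: nn_integral_cmult ennreal_mult_top)
    qed
    finally show False using fin by (simp add: top_unique)
  qed
qed

lemma nn_laplace_Fg_le: "nn_laplace \<sigma> (halfline (Fg \<mu> F)) \<le> nn_laplace \<sigma> (halfline (n2 \<mu> F f))"
  and nn_laplace_Gf_le: "nn_laplace \<sigma> (halfline (Gf \<mu> f)) \<le> nn_laplace \<sigma> (halfline (n2 \<mu> F f))"
  by (intro nn_laplace_mono; simp add: halfline_n2)+

lemma nn_laplace_immigrant_mean_finite:
  assumes "0 < \<sigma>"
  shows "nn_laplace \<sigma> immigrant_mean < \<infinity>"
proof (rule volterra_laplace_finite[where a = "conv (indicator {0..}) (halfline (Fg \<mu> F))"])
  have "nn_laplace \<sigma> (halfline (Fg \<mu> F)) < 1"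
    using nn_laplace_Fg_le nn_laplace_n2_less_1[OF assms] by (rule le_less_trans)
  then have "nn_laplace \<sigma> (halfline (Fg \<mu> F)) < \<infinity>"
    by (rule less_trans) simp
  then show "nn_laplace \<sigma> (conv (indicator {0..}) (halfline (Fg \<mu> F))) < \<infinity>"
    by (simp add: nn_laplace_conv nn_laplace_indicator[OF assms] ennreal_mult_less_top)
  show "immigrant_mean t \<le> conv (indicator {0..}) (halfline (Fg \<mu> F)) t + conv immigrant_mean (halfline (n2 \<mu> F f)) t" for t
    by (rule eq_refl) (rule immigrant_mean_equation)
qed (use assms nn_laplace_n2_less_1[OF assms] causal_immigrant_mean immigrant_mean_mono
      immigrant_mean_finite in auto)

lemma halfline_m2: "halfline (m2 M P) = events_mean"
proof
  fix t show "halfline (m2 M P) t = events_mean t"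
    using causalD[OF causal_point_mean[of M P], of t] by (cases "0 \<le> t") (auto simp: m2_eq)
qed

lemma laplace_exists_m2_iff:
  fixes s :: complex
  shows "laplace_exists (m2 M P) s \<longleftrightarrow> nn_laplace (Re s) events_mean < \<infinity>"
  using laplace_exists_iff[of "m2 M P" s] m2_nonneg by (simp add: halfline_m2)

lemma laplace_exists_m2:
  fixes s :: complex
  assumes s: "0 < Re s" and less: "\<eta> * laplace h (Re s) < 1"
  shows "laplace_exists (m2 M P) s"
  unfolding laplace_exists_m2_iff
proof (rule volterra_laplace_finite[where a = immigrant_mean])
  show "nn_laplace (Re s) offspring < 1"
    using s less by (simp add: nn_laplace_offspring ennreal_less_one_iff)
  show "events_mean t \<le> immigrant_mean t + conv events_mean offspring t" for t
    by (rule eq_refl) (rule events_mean_equation)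
qed (use s nn_laplace_immigrant_mean_finite[OF s] causal_point_mean mono_events_mean
      events_mean_finite in auto)

text \<open>The transform of \<open>m\<^sub>2 = A + m\<^sub>2 * \<eta>h\<close> and \<open>A = 1 * F\<^sub>g + A * n\<^sub>2\<close> is a triangular linear system, which
is solved after checking that its coefficients do not vanish.\<close>

lemma laplace_m2:
  fixes s :: complex
  assumes "laplace_exists (m2 M P) s"
  shows "laplace (m2 M P) s = laplace (Fg \<mu> F) s /
    (s * (1 - \<eta> * laplace h s) * (1 - laplace (Gf \<mu> f) s - laplace (Fg \<mu> F) s))"
proof -
  let ?\<sigma> = "Re s" and ?Fg = "halfline (Fg \<mu> F)" and ?Gf = "halfline (Gf \<mu> f)" and ?n2 = "halfline (n2 \<mu> F f)"
  have m_fin: "nn_laplace ?\<sigma> events_mean < \<infinity>"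
    using assms by (simp add: laplace_exists_m2_iff)
  then have \<sigma>: "0 < ?\<sigma>" by (rule nn_laplace_events_mean_finite_imp)
  have one_fin: "nn_laplace ?\<sigma> (indicator {0..}) < \<infinity>"
    by (simp add: nn_laplace_indicator[OF \<sigma>])
  have im_fin: "nn_laplace ?\<sigma> immigrant_mean < \<infinity>"
    by (rule nn_laplace_immigrant_mean_finite[OF \<sigma>])
  have n2_less: "nn_laplace ?\<sigma> ?n2 < 1" by (rule nn_laplace_n2_less_1[OF \<sigma>])
  then have n2_fin: "nn_laplace ?\<sigma> ?n2 < \<infinity>" by (rule less_trans) simp
  have Fg_fin: "nn_laplace ?\<sigma> ?Fg < \<infinity>" and Gf_fin: "nn_laplace ?\<sigma> ?Gf < \<infinity>"
    using nn_laplace_Fg_le nn_laplace_Gf_le n2_fin by (auto intro: le_less_trans)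
  have off_fin: "nn_laplace ?\<sigma> offspring < \<infinity>"
    using \<sigma> by (intro nn_laplace_offspring_finite) simp
  have m_eq: "events_mean = (\<lambda>t. immigrant_mean t + conv events_mean offspring t)"
    by (rule ext) (rule events_mean_equation)
  have conv_m_fin: "conv events_mean offspring t < \<infinity>" for t
  proof -
    have "conv events_mean offspring t \<le> events_mean t" by (subst (2) m_eq) simp
    then show ?thesis using events_mean_finite by (rule le_less_trans)
  qed
  \<comment> \<open>otherwise \<open>m\<^sub>2\<^sup>*(\<sigma>) = A\<^sup>*(\<sigma>) + m\<^sub>2\<^sup>*(\<sigma>) \<eta>h\<^sup>*(\<sigma>)\<close> would exceed \<open>m\<^sub>2\<^sup>*(\<sigma>)\<close>\<close>
  have off_less: "nn_laplace ?\<sigma> offspring < 1"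
  proof (rule ccontr)
    assume "\<not> ?thesis"
    then have "1 \<le> nn_laplace ?\<sigma> offspring" by simp
    then have "nn_laplace ?\<sigma> events_mean * 1 \<le> nn_laplace ?\<sigma> events_mean * nn_laplace ?\<sigma> offspring"
      by (rule mult_left_mono) simp
    moreover have "nn_laplace ?\<sigma> events_mean = nn_laplace ?\<sigma> immigrant_mean + nn_laplace ?\<sigma> events_mean * nn_laplace ?\<sigma> offspring"
      by (subst (1) m_eq) (simp add: nn_laplace_add nn_laplace_conv)
    ultimately have "nn_laplace ?\<sigma> immigrant_mean + nn_laplace ?\<sigma> events_mean \<le> 0 + nn_laplace ?\<sigma> events_mean"
      by (metis add_left_mono add_0 mult.right_neutral)
    then show False
      using m_fin nn_laplace_immigrant_mean_pos[of ?\<sigma>]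
      by (auto simp: ennreal_add_left_cancel_le)
  qed
  have m_laplace: "complex_laplace s events_mean =
      complex_laplace s immigrant_mean + complex_laplace s events_mean * complex_laplace s offspring"
  proof -
    have "complex_laplace s events_mean = complex_laplace s (\<lambda>t. immigrant_mean t + conv events_mean offspring t)"
      using m_eq by simp
    also have "\<dots> = complex_laplace s immigrant_mean + complex_laplace s (conv events_mean offspring)"
      using im_fin m_fin off_fin immigrant_mean_finite conv_m_fin
      by (intro complex_laplace_add) (auto simp: nn_laplace_conv ennreal_mult_less_top)
    also have "complex_laplace s (conv events_mean offspring) = complex_laplace s events_mean * complex_laplace s offspring"
      using m_fin off_fin events_mean_finite halfline_finite by (intro complex_laplace_conv) auto
    finally show ?thesis .
  qed
  have im_laplace: "complex_laplace s immigrant_mean =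
      complex_laplace s ?Fg / s + complex_laplace s immigrant_mean * complex_laplace s ?n2"
  proof -
    have fin: "conv (indicator {0..}) ?Fg t < \<infinity>" "conv immigrant_mean ?n2 t < \<infinity>" for t
      using immigrant_mean_finite[of t] unfolding immigrant_mean_equation[of t] by auto
    have "complex_laplace s immigrant_mean = complex_laplace s (\<lambda>t. conv (indicator {0..}) ?Fg t + conv immigrant_mean ?n2 t)"
      by (intro arg_cong[where f = "complex_laplace s"] ext immigrant_mean_equation)
    also have "\<dots> = complex_laplace s (conv (indicator {0..}) ?Fg) + complex_laplace s (conv immigrant_mean ?n2)"
      using fin one_fin Fg_fin im_fin n2_fin
      by (intro complex_laplace_add) (auto simp: nn_laplace_conv ennreal_mult_less_top)
    also have "complex_laplace s (conv (indicator {0..}) ?Fg) = complex_laplace s (indicator {0..}) * complex_laplace s ?Fg"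
      using one_fin Fg_fin halfline_finite by (intro complex_laplace_conv) (auto simp: indicator_def)
    also have "complex_laplace s (indicator {0..}) = 1 / s" by (rule complex_laplace_indicator[OF \<sigma>])
    also have "complex_laplace s (conv immigrant_mean ?n2) = complex_laplace s immigrant_mean * complex_laplace s ?n2"
      using im_fin n2_fin immigrant_mean_finite halfline_finite by (intro complex_laplace_conv) auto
    finally show ?thesis unfolding times_divide_eq_left mult_1_left .
  qed
  have n2_laplace: "complex_laplace s ?n2 = complex_laplace s ?Gf + complex_laplace s ?Fg"
    using Gf_fin Fg_fin halfline_finite unfolding halfline_n2[abs_def] by (intro complex_laplace_add) auto
  have norm_less: "norm (complex_laplace s a) < 1"
    if "a \<in> borel_measurable borel" "\<And>t. a t < \<infinity>" "nn_laplace ?\<sigma> a < 1" for a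
  proof -
    have "ennreal (norm (complex_laplace s a)) \<le> nn_laplace ?\<sigma> a"
      using that by (intro norm_complex_laplace_le) (auto intro: less_trans)
    then have "ennreal (norm (complex_laplace s a)) < 1" using that(3) by (rule le_less_trans)
    then show ?thesis by (simp add: ennreal_less_one_iff)
  qed
  have nz: "1 - complex_laplace s offspring \<noteq> 0" "1 - complex_laplace s ?n2 \<noteq> 0" "s \<noteq> 0"
    using norm_less[of offspring] norm_less[of ?n2] off_less n2_less halfline_finite \<sigma> by auto
  have e1: "complex_laplace s events_mean * (1 - complex_laplace s offspring) = complex_laplace s immigrant_mean"
    using m_laplace by (simp add: algebra_simps)
  have e2: "complex_laplace s immigrant_mean * (1 - complex_laplace s ?n2) = complex_laplace s ?Fg / s"
    using im_laplace by (simp add: algebra_simps)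
  have "complex_laplace s events_mean * (s * (1 - complex_laplace s offspring) * (1 - complex_laplace s ?n2))
      = s * (complex_laplace s events_mean * (1 - complex_laplace s offspring) * (1 - complex_laplace s ?n2))"
    by (simp only: mult_ac)
  also have "\<dots> = s * (complex_laplace s ?Fg / s)" by (simp only: e1 e2)
  also have "\<dots> = complex_laplace s ?Fg" using nz by simp
  finally have "complex_laplace s events_mean = complex_laplace s ?Fg /
      (s * (1 - complex_laplace s offspring) * (1 - complex_laplace s ?n2))"
    using nz by (intro nonzero_eq_divide_eq[THEN iffD2]) simp_all
  moreover have "laplace (m2 M P) s = complex_laplace s events_mean"
    using laplace_eq_complex_laplace[of "m2 M P" s] m2_nonneg by (simp add: halfline_m2)
  moreover have "laplace (Fg \<mu> F) s = complex_laplace s ?Fg" "laplace (Gf \<mu> f) s = complex_laplace s ?Gf"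
    using Fg_nonneg Gf_nonneg by (auto intro: laplace_eq_complex_laplace)
  ultimately show ?thesis
    by (simp add: complex_laplace_offspring n2_laplace diff_diff_eq)
qed

end

theorem theorem3p6:
  fixes M :: "'a measure" and \<mu> h F f :: "real \<Rightarrow> real" and \<eta> :: real
    and Y :: "nat \<Rightarrow> 'a \<Rightarrow> real" and T :: "nat \<Rightarrow> 'a \<Rightarrow> ereal" and P :: "'a \<Rightarrow> real set"
  assumes "R2_Hawkes M \<mu> \<eta> h F f Y T P"
  shows "(\<forall>t\<ge>0. integrable M (\<lambda>\<omega>. real (num_points P t \<omega>))) \<and>
    (\<exists>k. k20_equation \<eta> h k) \<and>
    (\<forall>k. k20_equation \<eta> h k \<longrightarrow>
      (\<forall>t\<ge>0. m2 M P t = Psi2 \<mu> F k t + (LBINT v:{0..t}. m2 M P (t - v) * n2 \<mu> F f v))) \<and>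
    (\<forall>s :: complex. 0 < Re s \<and> \<eta> * laplace h (Re s) < 1 \<longrightarrow> laplace_exists (m2 M P) s) \<and>
    (\<forall>s :: complex. laplace_exists (m2 M P) s \<longrightarrow>
      laplace (m2 M P) s = laplace (Fg \<mu> F) s /
        (s * (1 - \<eta> * laplace h s) * (1 - laplace (Gf \<mu> f) s - laplace (Fg \<mu> F) s)))"
proof -
  interpret R2_Hawkes M \<mu> \<eta> h F f Y T P by fact
  show ?thesis
    using integrable_num_points k20_solution m2_integral_equation laplace_exists_m2 laplace_m2 by blast
qed

end
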